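(* Let $\Gamma$ be a mandarin graph with $N\ge3$ edges. Let $q$ be a polynomial on $\mathbb{C}^N\times\mathbb{C}^{4N}$ that is homogeneous in the $\mathbb{C}^{4N}$ coordinates. Suppose there exist $\boldsymbol{\ell}\in\mathbb{R}_+^N$ and an eigenpair $(k^2,f)$ of $(\Gamma,\boldsymbol{\ell})$ such that (i) $k^2$ is a non-zero simple eigenvalue, and (ii) $f$ is symmetric (respectively anti-symmetric) and $q(\exp(ik\boldsymbol{\ell}),\mathrm{tr}_k(f))\ne0$. Then the following property of eigenpairs $(k^2,f)$ with $k>0$ is both strongly and ergodically generic: (1) $k^2$ is a simple eigenvalue, and (2) $q(\exp(ik\boldsymbol{\ell}),\mathrm{tr}_k(f))\neq0$ whenever $f$ is symmetric (respectively anti-symmetric).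
   Context: A mandarin graph has exactly two vertices and $N$ edges $e_1,\dots,e_N$, each joining the two vertices; orient every edge. $(\Gamma,\boldsymbol{\ell})$: edge $e_j\cong[0,\ell_j]$, Laplacian $-d^2/dt^2$ edgewise with standard vertex conditions (continuity at each vertex and vanishing sum of outgoing derivatives at each vertex). Let $R$ be the map reflecting every edge, $t\mapsto\ell_j-t$ on $e_j$ (it swaps the two vertices). An eigenfunction $f$ is symmetric if $f\circ R=f$ and anti-symmetric if $f\circ R=-f$. $\exp(ik\boldsymbol{\ell}):=(e^{ik\ell_1},\dots,e^{ik\ell_N})$. For an eigenpair with $k>0$, $f|_{e_j}(t)=A_j\cos(kt)+B_j\sin(kt)=C_j\cos(k(\ell_j-t))+D_j\sin(k(\ell_j-t))$, and $\mathrm{tr}_k(f)\in\mathbb{C}^{4N}$ is the vector of all $A_j,B_j,C_j,D_j$ in a fixed order. For a property $\mathcal{P}$ of eigenpairs, let $G$ be the set of $\boldsymbol{\ell}$ such that every eigenpair with $k>0$ satisfies $\mathcal{P}$; $\mathcal{P}$ is strongly generic if $\mathbb{R}_+^N\setminus G$ is a countable union of closed subanalytic sets (locally finite unions/intersections of projections of sets defined by real-analytic equalities and strict inequalities over compact parameter sets) of dimension at most $N-1$; $\mathcal{P}$ is ergodically generic if for every $\mathbb{Q}$-independent $\boldsymbol{\ell}$ the proportion of $k\in\mathrm{spec}(\Gamma,\boldsymbol{\ell})\cap[0,T]$ (multiset of $k\ge0$ with $k^2$ an eigenvalue) having an eigenfunction $f$ with $(k^2,f)$ satisfying $\mathcal{P}$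 tends to $1$ as $T\to\infty$. *)

theory Defs
  imports "HOL-Analysis.Analysis"
begin

definition rn :: "nat \<Rightarrow> (nat \<Rightarrow> real) set" where
  "rn n = {x. \<forall>i\<ge>n. x i = 0}"

definition nball :: "nat \<Rightarrow> (nat \<Rightarrow> real) \<Rightarrow> real \<Rightarrow> (nat \<Rightarrow> real) set" where
  "nball n x r = {y \<in> rn n. (\<Sum>i<n. (y i - x i)^2) < r^2}"

definition n_open :: "nat \<Rightarrow> (nat \<Rightarrow> real) set \<Rightarrow> bool" where
  "n_open n U \<longleftrightarrow> U \<subseteq> rn n \<and> (\<forall>x\<in>U. \<exists>r>0. nball n x r \<subseteq> U)"

definition n_closed :: "nat \<Rightarrow> (nat \<Rightarrow> real) set \<Rightarrow> bool" where
  "n_closed n A \<longleftrightarrow> A \<subseteq> rn n \<and> n_open n (rn n - A)"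

definition n_bounded :: "nat \<Rightarrow> (nat \<Rightarrow> real) set \<Rightarrow> bool" where
  "n_bounded n A \<longleftrightarrow> A \<subseteq> rn n \<and> (\<exists>R. \<forall>x\<in>A. (\<Sum>i<n. (x i)^2) \<le> R)"

definition real_analytic_on_n :: "nat \<Rightarrow> (nat \<Rightarrow> real) set \<Rightarrow> ((nat \<Rightarrow> real) \<Rightarrow> real) \<Rightarrow> bool" where
  "real_analytic_on_n n U g \<longleftrightarrow> n_open n U \<and>
     (\<forall>x\<in>U. \<exists>r>0. nball n x r \<subseteq> U \<and>
        (\<exists>c :: (nat \<Rightarrow> nat) \<Rightarrow> real. \<forall>y\<in>nball n x r.
           ((\<lambda>\<alpha>. c \<alpha> * (\<Prod>i<n. (y i - x i) ^ (\<alpha> i))) has_sum g y) {\<alpha>. \<forall>i\<ge>n. \<alpha> i = 0}))"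

definition semianalytic :: "nat \<Rightarrow> (nat \<Rightarrow> real) set \<Rightarrow> bool" where
  "semianalytic n A \<longleftrightarrow> A \<subseteq> rn n \<and>
     (\<forall>x\<in>rn n. \<exists>U. n_open n U \<and> x \<in> U \<and>
        (\<exists>(p::nat) (E :: nat \<Rightarrow> ((nat \<Rightarrow> real) \<Rightarrow> real) set) (P :: nat \<Rightarrow> ((nat \<Rightarrow> real) \<Rightarrow> real) set).
           (\<forall>i<p. finite (E i) \<and> finite (P i) \<and> (\<forall>g\<in>E i \<union> P i. real_analytic_on_n n U g)) \<and>
           A \<inter> U = (\<Union>i<p. {y\<in>U. (\<forall>g\<in>E i. g y = 0) \<and> (\<forall>g\<in>P i. 0 < g y)})))"

definition proj_n :: "nat \<Rightarrow> (nat \<Rightarrow> real) \<Rightarrow> (nat \<Rightarrow> real)" where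
  "proj_n n z = (\<lambda>i. if i < n then z i else 0)"

definition subanalytic :: "nat \<Rightarrow> (nat \<Rightarrow> real) set \<Rightarrow> bool" where
  "subanalytic n A \<longleftrightarrow> A \<subseteq> rn n \<and>
     (\<forall>x\<in>rn n. \<exists>U. n_open n U \<and> x \<in> U \<and>
        (\<exists>m B. semianalytic (n + m) B \<and> n_bounded (n + m) B \<and> A \<inter> U = proj_n n ` B))"

text \<open>Dimension at most n-1 for a subset of R^n: it contains no n-dimensional
  submanifold, i.e. no nonempty open subset of R^n.\<close>
definition dim_le_pred :: "nat \<Rightarrow> (nat \<Rightarrow> real) set \<Rightarrow> bool" where
  "dim_le_pred n A \<longleftrightarrow> \<not> (\<exists>x r. x \<in> rn n \<and> r > 0 \<and> nball n x r \<subseteq> A)"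

text \<open>Edge lengths in R_+^N. Edge j (j<N) is [0, l j], oriented from vertex v1 (t=0) to v2 (t = l j).
  A function on the graph is f :: nat => real => complex, f j being its restriction to edge j.\<close>

definition posorth :: "nat \<Rightarrow> (nat \<Rightarrow> real) set" where
  "posorth N = {l. (\<forall>j<N. 0 < l j) \<and> (\<forall>j\<ge>N. l j = 0)}"

definition edge_deriv :: "(nat \<Rightarrow> real) \<Rightarrow> (nat \<Rightarrow> real \<Rightarrow> complex) \<Rightarrow> nat \<Rightarrow> real \<Rightarrow> complex" where
  "edge_deriv l f j t = vector_derivative (f j) (at t within {0..l j})"

definition mandarin_sol :: "nat \<Rightarrow> (nat \<Rightarrow> real) \<Rightarrow> real \<Rightarrow> (nat \<Rightarrow> real \<Rightarrow> complex) \<Rightarrow> bool" where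
  "mandarin_sol N l lam f \<longleftrightarrow>
     (\<forall>j<N. \<exists>g. \<forall>t\<in>{0..l j}.
         (f j has_vector_derivative g t) (at t within {0..l j}) \<and>
         (g has_vector_derivative (- of_real lam * f j t)) (at t within {0..l j})) \<and>
     (\<forall>i<N. \<forall>j<N. f i 0 = f j 0 \<and> f i (l i) = f j (l j)) \<and>
     (\<Sum>j<N. edge_deriv l f j 0) = 0 \<and>
     (\<Sum>j<N. - edge_deriv l f j (l j)) = 0"

definition eigenfunction :: "nat \<Rightarrow> (nat \<Rightarrow> real) \<Rightarrow> real \<Rightarrow> (nat \<Rightarrow> real \<Rightarrow> complex) \<Rightarrow> bool" where
  "eigenfunction N l lam f \<longleftrightarrow> mandarin_sol N l lam f \<and> (\<exists>j<N. \<exists>t\<in>{0..l j}. f j t \<noteq> 0)"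

definition eigen_mult :: "nat \<Rightarrow> (nat \<Rightarrow> real) \<Rightarrow> real \<Rightarrow> nat" where
  "eigen_mult N l lam = Sup {n. \<exists>fs :: nat \<Rightarrow> nat \<Rightarrow> real \<Rightarrow> complex.
      (\<forall>i<n. mandarin_sol N l lam (fs i)) \<and>
      (\<forall>c :: nat \<Rightarrow> complex. (\<forall>j<N. \<forall>t\<in>{0..l j}. (\<Sum>i<n. c i * fs i j t) = 0) \<longrightarrow> (\<forall>i<n. c i = 0))}"

definition is_eigenvalue :: "nat \<Rightarrow> (nat \<Rightarrow> real) \<Rightarrow> real \<Rightarrow> bool" where
  "is_eigenvalue N l lam \<longleftrightarrow> (\<exists>f. eigenfunction N l lam f)"

definition simple_ev :: "nat \<Rightarrow> (nat \<Rightarrow> real) \<Rightarrow> real \<Rightarrow> bool" where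
  "simple_ev N l lam \<longleftrightarrow> eigen_mult N l lam = 1"

text \<open>sym_type with s = 1: symmetric (f o R = f); with s = -1: anti-symmetric (f o R = -f).\<close>
definition sym_type :: "nat \<Rightarrow> (nat \<Rightarrow> real) \<Rightarrow> complex \<Rightarrow> (nat \<Rightarrow> real \<Rightarrow> complex) \<Rightarrow> bool" where
  "sym_type N l s f \<longleftrightarrow> (\<forall>j<N. \<forall>t\<in>{0..l j}. f j (l j - t) = s * f j t)"

definition expikl :: "nat \<Rightarrow> (nat \<Rightarrow> real) \<Rightarrow> real \<Rightarrow> nat \<Rightarrow> complex" where
  "expikl N l k = (\<lambda>j. if j < N then exp (\<i> * of_real (k * l j)) else 0)"

text \<open>tr_k(f) in C^(4N): coordinate 4j+0,1,2,3 = A_j, B_j, C_j, D_j where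
  f_j(t) = A_j cos(kt) + B_j sin(kt) = C_j cos(k(l_j - t)) + D_j sin(k(l_j - t)),
  i.e. A_j = f_j(0), B_j = f_j'(0)/k, C_j = f_j(l_j), D_j = -f_j'(l_j)/k.\<close>
definition trk :: "nat \<Rightarrow> (nat \<Rightarrow> real) \<Rightarrow> real \<Rightarrow> (nat \<Rightarrow> real \<Rightarrow> complex) \<Rightarrow> nat \<Rightarrow> complex" where
  "trk N l k f = (\<lambda>i. if i < 4 * N then
       (let j = i div 4; r = i mod 4 in
         if r = 0 then f j 0
         else if r = 1 then edge_deriv l f j 0 / of_real k
         else if r = 2 then f j (l j)
         else - edge_deriv l f j (l j) / of_real k)
     else 0)"

text \<open>A polynomial is given by its coefficient function on monomials (alpha, beta), where
  alpha is the exponent vector for the C^N variables z and beta for the C^(4N) variables w.\<close>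
definition homog_poly :: "nat \<Rightarrow> ((nat \<Rightarrow> nat) \<times> (nat \<Rightarrow> nat) \<Rightarrow> complex) \<Rightarrow> nat \<Rightarrow> bool" where
  "homog_poly N c d \<longleftrightarrow> finite {m. c m \<noteq> 0} \<and>
     (\<forall>\<alpha> \<beta>. c (\<alpha>, \<beta>) \<noteq> 0 \<longrightarrow>
        (\<forall>i\<ge>N. \<alpha> i = 0) \<and> (\<forall>i\<ge>4 * N. \<beta> i = 0) \<and> (\<Sum>i<4 * N. \<beta> i) = d)"

definition poly_eval :: "nat \<Rightarrow> ((nat \<Rightarrow> nat) \<times> (nat \<Rightarrow> nat) \<Rightarrow> complex) \<Rightarrow> (nat \<Rightarrow> complex) \<Rightarrow> (nat \<Rightarrow> complex) \<Rightarrow> complex" where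
  "poly_eval N c z w = (\<Sum>m\<in>{m. c m \<noteq> 0}.
      c m * (\<Prod>i<N. z i ^ (fst m i)) * (\<Prod>i<4 * N. w i ^ (snd m i)))"

type_synonym eprop = "(nat \<Rightarrow> real) \<Rightarrow> real \<Rightarrow> (nat \<Rightarrow> real \<Rightarrow> complex) \<Rightarrow> bool"

definition good_lengths :: "nat \<Rightarrow> eprop \<Rightarrow> (nat \<Rightarrow> real) set" where
  "good_lengths N P = {l \<in> posorth N. \<forall>k>0. \<forall>f. eigenfunction N l (k^2) f \<longrightarrow> P l k f}"

definition strongly_generic :: "nat \<Rightarrow> eprop \<Rightarrow> bool" where
  "strongly_generic N P \<longleftrightarrow>
     (\<exists>S :: nat \<Rightarrow> (nat \<Rightarrow> real) set.
        (\<forall>i. n_closed N (S i) \<and> subanalytic N (S i) \<and> dim_le_pred N (S i)) \<and>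
        posorth N - good_lengths N P = (\<Union>i. S i))"

definition Q_independent :: "nat \<Rightarrow> (nat \<Rightarrow> real) \<Rightarrow> bool" where
  "Q_independent N l \<longleftrightarrow> (\<forall>q :: nat \<Rightarrow> rat. (\<Sum>j<N. of_rat (q j) * l j) = 0 \<longrightarrow> (\<forall>j<N. q j = 0))"

definition spec_upto :: "nat \<Rightarrow> (nat \<Rightarrow> real) \<Rightarrow> real \<Rightarrow> real set" where
  "spec_upto N l T = {k. 0 \<le> k \<and> k \<le> T \<and> is_eigenvalue N l (k^2)}"

definition spec_count :: "nat \<Rightarrow> (nat \<Rightarrow> real) \<Rightarrow> real \<Rightarrow> real" where
  "spec_count N l T = (\<Sum>k\<in>spec_upto N l T. real (eigen_mult N l (k^2)))"

definition good_count :: "nat \<Rightarrow> eprop \<Rightarrow> (nat \<Rightarrow> real) \<Rightarrow> real \<Rightarrow> real" where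
  "good_count N P l T = (\<Sum>k\<in>{k\<in>spec_upto N l T. 0 < k \<and> (\<exists>f. eigenfunction N l (k^2) f \<and> P l k f)}.
       real (eigen_mult N l (k^2)))"

definition ergodically_generic :: "nat \<Rightarrow> eprop \<Rightarrow> bool" where
  "ergodically_generic N P \<longleftrightarrow>
     (\<forall>l\<in>posorth N. Q_independent N l \<longrightarrow>
        ((\<lambda>T. good_count N P l T / spec_count N l T) \<longlongrightarrow> 1) at_top)"

definition prop_q :: "nat \<Rightarrow> ((nat \<Rightarrow> nat) \<times> (nat \<Rightarrow> nat) \<Rightarrow> complex) \<Rightarrow> complex \<Rightarrow> eprop" where
  "prop_q N c s = (\<lambda>l k f. simple_ev N l (k^2) \<and>
      (sym_type N l s f \<longrightarrow> poly_eval N c (expikl N l k) (trk N l k f) \<noteq> 0))"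

end

theory Submission
  imports Defs
begin

text \<open>
  For a symmetric or anti-symmetric eigenfunction the half angles k l_j / 2 satisfy a secular equation
  a sin + b cos = 0 in any chosen coordinate p, with a and b independent of that coordinate. Solving for the p-th
  coordinate turns the condition q = 0 (via an explicit kernel vector) and the coincidence of a symmetric with an
  anti-symmetric eigenvalue into the vanishing of one trigonometric polynomial Z in the other coordinates;
  the hypothesis on q and N >= 3 make Z nonzero, the index p being chosen at the given eigenpair.

  Strong genericity: the exceptional lengths are a countable union of projections of compact analytic sets. They contain
  no ball, since for rationally independent lengths off p the function Z vanishes for only countably many k, each of which
  excludes countably many values of the p-th length.

  Ergodic genericity: exceptional k lie in unit windows that hit the compact codimension two set where Z and the secular
  equation vanish. Suitable translates of this set, swept along the flow for unit time, overlap boundedly, and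
  Kronecker's theorem realises the translates by time shifts; hence exceptional windows have density zero, while the
  number of eigenvalues up to T grows linearly.
\<close>

section \<open>Zeros of trigonometric polynomials along lines\<close>

text \<open>The obstacle: the zero set of a secular function is not a torus, and a single eigenpair
  with q nonzero must keep q from vanishing on all of it. Solving for the p-th angle parametrises
  the nondegenerate part of this set by the torus of the other angles. There a product of nonzero
  trigonometric polynomials is nonzero, so one nonzero value suffices. The choice of p at the
  witness is forced: the kernel vector for p is zero as soon as \<open>cs\<close> vanishes on two
  edges other than p. At a simple eigenvalue \<open>cs\<close> vanishes on at most two edges, and
  taking p among them leaves at most one. The kernel vector is then nonzero and spans the solutions
  of type s, so homogeneity carries q \<noteq> 0 over to it. At other points p may degenerate;
  rational independence excludes this along an orbit, and among the translates of the density
  argument it affects only boundedly many values of one index. N \<ge> 3 is essential: for two edges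
  the two secular functions agree up to sign, so symmetric and anti-symmetric eigenvalues always
  coincide. All counts of zeros have to be uniform in the base point, which is why they rest on a
  Rolle bound depending only on the frequencies.\<close>

lemma Rolle_finite_zeros:
  fixes f f' :: "real \<Rightarrow> real"
  assumes der: "\<And>t. t \<in> {u<..<v} \<Longrightarrow> (f has_real_derivative f' t) (at t)"
    and "finite Z" "card Z = Suc n" "Z \<subseteq> {u<..<v}" "\<And>t. t \<in> Z \<Longrightarrow> f t = 0"
  shows "\<exists>Y. finite Y \<and> card Y = n \<and> Y \<subseteq> {u<..<Max Z} \<and> (\<forall>t\<in>Y. f' t = 0)"
  using assms(2-5)
proof (induction n arbitrary: Z)
  case 0
  then show ?case by (intro exI[of _ "{}"]) auto
next
  case (Suc n)
  define M where "M = Max Z"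
  define Z' where "Z' = Z - {M}"
  have M: "M \<in> Z" unfolding M_def using Suc.prems by (intro Max_in) auto
  have Z': "finite Z'" "card Z' = Suc n" "Z' \<subseteq> {u<..<v}" "\<And>t. t \<in> Z' \<Longrightarrow> f t = 0"
    unfolding Z'_def using Suc.prems M by (auto simp: card_Diff_singleton)
  from Suc.IH[OF Z'] obtain Y where Y: "finite Y" "card Y = n" "Y \<subseteq> {u<..<Max Z'}" "\<forall>t\<in>Y. f' t = 0"
    by blast
  define M' where "M' = Max Z'"
  have M': "M' \<in> Z'" unfolding M'_def using Z' by (intro Max_in) auto
  have lt: "M' < M" using M' Suc.prems(1) unfolding Z'_def M_def
    by (metis Diff_iff Max_ge insertI1 order_le_less)
  have "M \<in> {u<..<v}" "M' \<in> {u<..<v}" using M M' Suc.prems(3) Z'(3) by auto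
  then have sub: "{M'..M} \<subseteq> {u<..<v}" by auto
  have "\<exists>z. M' < z \<and> z < M \<and> f' z = 0"
  proof -
    have "f M' = f M" using M M' Suc.prems(4) Z'(4) by auto
    moreover have "continuous_on {M'..M} f"
      by (meson der sub DERIV_isCont continuous_at_imp_continuous_on subsetD)
    moreover have "f differentiable (at x)" if "M' < x" "x < M" for x
      using der[of x] sub that real_differentiable_def by (meson atLeastAtMost_iff less_imp_le subsetD)
    ultimately obtain z where z: "M' < z" "z < M" "DERIV f z :> 0"
      using Rolle[OF lt] by blast
    have "z \<in> {u<..<v}" using sub z by (meson atLeastAtMost_iff less_imp_le subsetD)
    then have "f' z = 0" using DERIV_unique[OF der[of z] z(3)] by auto
    then show ?thesis using z by blast
  qed
  then obtain z where z: "M' < z" "z < M" "f' z = 0" by blast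
  \<comment> \<open>All of \<open>Y\<close> lies below \<open>Max Z'\<close>, so the zero gained
    between the two largest points is new. The bound by \<open>Max Z\<close> in the claim is there
    for this.\<close>
  have "z \<notin> Y" using Y(3) z unfolding M'_def by auto
  then show ?case
    using Y z M' Z'(3) unfolding M_def[symmetric] M'_def[symmetric]
    by (intro exI[of _ "insert z Y"]) (auto simp: subset_iff)
qed

text \<open>\<open>w\<close> is the Wronskian of f and cos (c (t - m)), two solutions of the same
  equation. The phase m is left free because first integrals for different phases are combined
  later.\<close>

lemma harmonic_ode_first_integral:
  fixes f f' :: "real \<Rightarrow> real"
  assumes "\<And>t. (f has_real_derivative f' t) (at t)"
    and "\<And>t. (f' has_real_derivative - (c\<^sup>2) * f t) (at t)"
    and "w = (\<lambda>t. f' t * cos (c * (t - m)) + f t * (c * sin (c * (t - m))))"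
  shows "w t = w s"
proof -
  have "(w has_real_derivative 0) (at t)" for t
    unfolding assms(3)
    by (rule derivative_eq_intros assms(1,2) refl | simp add: algebra_simps power2_eq_square)+
  then show ?thesis by (rule DERIV_isconst_all[rule_format]) 
qed

text \<open>Polya's factorisation: with u = cos (c (t - m)) positive on the interval, f'' + c^2 f equals
  (f' u - f u')' / u, so two applications of Rolle lose only two zeros while removing
  the frequency c from f.\<close>

lemma trig_sum_zeros:
  fixes \<Lambda> :: "real set" and a b :: "real \<Rightarrow> real"
  assumes "finite \<Lambda>" "\<And>c. c \<in> \<Lambda> \<Longrightarrow> \<bar>c\<bar> * \<delta> < pi" "\<delta> > 0"
    and "finite Z" "card Z = 2 * card \<Lambda>" "Z \<subseteq> {u<..<u+\<delta>}"
    and "\<And>t. t \<in> Z \<Longrightarrow> (\<Sum>c\<in>\<Lambda>. a c * cos (c * t) + b c * sin (c * t)) = 0"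
  shows "(\<Sum>c\<in>\<Lambda>. a c * cos (c * t) + b c * sin (c * t)) = 0"
  using assms
proof (induction \<Lambda> arbitrary: a b Z t rule: finite_induct)
  case empty
  then show ?case by simp
next
  case (insert d \<Lambda>)
  define f where "f = (\<lambda>t. \<Sum>c\<in>insert d \<Lambda>. a c * cos (c * t) + b c * sin (c * t))"
  define f1 where "f1 = (\<lambda>t. \<Sum>c\<in>insert d \<Lambda>. - a c * c * sin (c * t) + b c * c * cos (c * t))"
  define f2 where "f2 = (\<lambda>t. \<Sum>c\<in>insert d \<Lambda>. - c\<^sup>2 * (a c * cos (c * t) + b c * sin (c * t)))"
  \<comment> \<open>Centring the cosine at the midpoint keeps |d (t - m)| below pi/2 on the whole
    window, by the smallness of \<delta>.\<close>
  define m where "m = u + \<delta> / 2"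
  define U where "U = (\<lambda>t. cos (d * (t - m)))"
  define U1 where "U1 = (\<lambda>t. - d * sin (d * (t - m)))"
  define w where "w = (\<lambda>t. f1 t * U t - f t * U1 t)"
  define g where "g = (\<lambda>t. f2 t + d\<^sup>2 * f t)"
  have df: "(f has_real_derivative f1 t) (at t)" for t
    unfolding f_def f1_def
    by (rule DERIV_sum) (auto intro!: derivative_eq_intros simp: algebra_simps)
  have df1: "(f1 has_real_derivative f2 t) (at t)" for t
    unfolding f1_def f2_def
    by (rule DERIV_sum) (auto intro!: derivative_eq_intros simp: algebra_simps power2_eq_square)
  have dU: "(U has_real_derivative U1 t) (at t)" for t
    unfolding U_def U1_def by (auto intro!: derivative_eq_intros)
  have dU1: "(U1 has_real_derivative - d\<^sup>2 * U t) (at t)" for t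
    unfolding U_def U1_def by (auto intro!: derivative_eq_intros simp: power2_eq_square)
  have dw: "(w has_real_derivative U t * g t) (at t)" for t
    unfolding w_def g_def
    by (rule derivative_eq_intros df df1 dU dU1 refl | simp add: algebra_simps)+
  have Upos: "U t > 0" if "t \<in> {u<..<u+\<delta>}" for t
  proof -
    have "\<bar>d * (t - m)\<bar> \<le> \<bar>d\<bar> * (\<delta> / 2)"
      unfolding abs_mult m_def using that by (intro mult_left_mono) (auto simp: abs_if)
    also have "\<dots> < pi / 2" using insert.prems(1)[of d] by simp
    finally show ?thesis unfolding U_def by (intro cos_gt_zero_pi) auto
  qed
  have cZ: "card Z = Suc (Suc (2 * card \<Lambda>))" using insert.prems(4) insert.hyps by simp
  have dq: "((\<lambda>t. f t / U t) has_real_derivative w t / (U t)\<^sup>2) (at t)" if "t \<in> {u<..<u+\<delta>}" for t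
    using Upos[OF that] unfolding w_def
    by (auto intro!: derivative_eq_intros df dU simp: power2_eq_square)
  obtain Y where Y: "finite Y" "card Y = Suc (2 * card \<Lambda>)" "Y \<subseteq> {u<..<Max Z}" "\<forall>t\<in>Y. w t / (U t)\<^sup>2 = 0"
    using Rolle_finite_zeros[where u = u and v = "u+\<delta>" and Z = Z and n = "Suc (2 * card \<Lambda>)", OF dq]
      insert.prems(3,5,6) cZ
    unfolding f_def by auto
  have MaxZ: "Max Z < u + \<delta>" using insert.prems(3,5) cZ
    by (metis Max_in card.empty greaterThanLessThan_iff nat.distinct(1) subsetD)
  have Ysub: "Y \<subseteq> {u<..<u+\<delta>}" using Y(3) MaxZ by auto
  have Yw: "w t = 0" if "t \<in> Y" for t using Y(4) Upos[of t] Ysub that by (force simp: divide_eq_0_iff)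
  obtain X where X: "finite X" "card X = 2 * card \<Lambda>" "X \<subseteq> {u<..<Max Y}" "\<forall>t\<in>X. U t * g t = 0"
    using Rolle_finite_zeros[of u "u+\<delta>" w "\<lambda>t. U t * g t" Y "2 * card \<Lambda>"] dw Y Ysub Yw by auto
  have "Max Y < u + \<delta>" using Y Ysub
    by (metis Max_in card.empty greaterThanLessThan_iff nat.distinct(1) subsetD)
  then have Xsub: "X \<subseteq> {u<..<u+\<delta>}" using X(3) by auto
  have gform: "g t = (\<Sum>c\<in>\<Lambda>. ((d\<^sup>2 - c\<^sup>2) * a c) * cos (c * t) + ((d\<^sup>2 - c\<^sup>2) * b c) * sin (c * t))" for t
    unfolding g_def f_def f2_def using insert.hyps
    by (simp add: sum_distrib_left sum.distrib[symmetric] algebra_simps)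
  \<comment> \<open>\<open>g\<close> has no frequency d left and still has 2 card \<Lambda> zeros,
    so the induction hypothesis applies and f solves f'' = - d^2 f.\<close>
  have g0: "g t = 0" for t
    unfolding gform
  proof (rule insert.IH)
    show "finite X" "card X = 2 * card \<Lambda>" "X \<subseteq> {u<..<u+\<delta>}" using X Xsub by auto
    show "(\<Sum>c\<in>\<Lambda>. ((d\<^sup>2 - c\<^sup>2) * a c) * cos (c * t) + ((d\<^sup>2 - c\<^sup>2) * b c) * sin (c * t)) = 0" if "t \<in> X" for t
      using X(4) Upos[of t] Xsub that unfolding gform[symmetric] by force
  qed (use insert.prems in auto)
  have df1': "(f1 has_real_derivative - (d\<^sup>2) * f t) (at t)" for t
    proof -
    have "f2 t = - (d\<^sup>2) * f t" using g0[of t] unfolding g_def by linarith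
    then show ?thesis using df1[of t] by simp
  qed
  obtain y where y: "y \<in> Y" using Y(2) by fastforce
  have winv: "w t = 0" for t
  proof -
    have "w = (\<lambda>t. f1 t * cos (d * (t - m)) + f t * (d * sin (d * (t - m))))"
      unfolding w_def U_def U1_def by auto
    from harmonic_ode_first_integral[OF df df1' this] have "w t = w y" .
    then show ?thesis using Yw[OF y] by simp
  qed
  obtain z where z: "z \<in> Z" using cZ by fastforce
  have fz: "f z = 0" using insert.prems(6)[OF z] by (simp add: f_def)
  have "z \<in> {u<..<u+\<delta>}" using z insert.prems(5) by auto
  then have f1z: "f1 z = 0" using winv[of z] fz Upos[of z] unfolding w_def by auto
  have "f t = 0"
  proof (cases "d = 0")
    case True
    have "f1 t = 0" for t using winv[of t] True unfolding w_def U_def U1_def by simp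
    then have "\<forall>t. DERIV f t :> 0" using df by simp
    then show ?thesis using DERIV_isconst_all[of f t z] fz by simp
  next
    case False
    have "f1 t * cos (d * (t - z)) + f t * (d * sin (d * (t - z))) = 
          f1 z * cos (d * (z - z)) + f z * (d * sin (d * (z - z)))" for t
      using harmonic_ode_first_integral[OF df df1' refl, where m=z and t=t and s=z] by simp
    then have 1: "f1 t * cos (d * (t - z)) + f t * (d * sin (d * (t - z))) = 0"
      using f1z fz by simp
    \<comment> \<open>A quarter period shift of the phase. The two first integrals, both zero since
      f and f' vanish at z, determine f; for d = 0 this shift makes no sense, hence the case
      split.\<close>
    let ?z = "z + pi / (2 * d)"
    have "f1 t * cos (d * (t - ?z)) + f t * (d * sin (d * (t - ?z))) = 
          f1 z * cos (d * (z - ?z)) + f z * (d * sin (d * (z - ?z)))"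
      using harmonic_ode_first_integral[OF df df1' refl, where m="?z" and t=t and s=z] by simp
    then have "f1 t * cos (d * (t - ?z)) + f t * (d * sin (d * (t - ?z))) = 0"
      using f1z fz by simp
    moreover have "d * (t - ?z) = d * (t - z) - pi / 2" using False by (simp add: field_simps)
    ultimately have 2: "f1 t * sin (d * (t - z)) - f t * (d * cos (d * (t - z))) = 0"
      by (simp add: cos_diff sin_diff)
    have "x * d * (S\<^sup>2 + C\<^sup>2) = S * (y * C + x * (d * S)) - C * (y * S - x * (d * C))" for x y S C :: real
      by (simp add: algebra_simps power2_eq_square)
    from this[of "f t" "sin (d * (t - z))" "cos (d * (t - z))" "f1 t"]
    have "f t * d = 0" unfolding 1 2 by simp
    then show ?thesis using False by simp
  qed
  then show ?case unfolding f_def .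
qed

text \<open>Generated by closure rather than given by coefficients, so that bounds, continuity,
  periodicity and restriction to lines follow by rule induction. J records the coordinates on which
  the function may depend; J = {..<N} - {p} certifies independence of the p-th angle.\<close>

inductive trig_poly :: "nat set \<Rightarrow> ((nat \<Rightarrow> real) \<Rightarrow> complex) \<Rightarrow> bool" for J where
  trig_poly_const: "trig_poly J (\<lambda>x. c)"
| trig_poly_exp: "j \<in> J \<Longrightarrow> trig_poly J (\<lambda>x. exp (\<i> * of_real (x j)))"
| trig_poly_exp_minus: "j \<in> J \<Longrightarrow> trig_poly J (\<lambda>x. exp (- \<i> * of_real (x j)))"
| trig_poly_add: "trig_poly J g \<Longrightarrow> trig_poly J h \<Longrightarrow> trig_poly J (\<lambda>x. g x + h x)"
| trig_poly_mult: "trig_poly J g \<Longrightarrow> trig_poly J h \<Longrightarrow> trig_poly J (\<lambda>x. g x * h x)"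

lemma trig_poly_mono: "trig_poly J g \<Longrightarrow> J \<subseteq> J' \<Longrightarrow> trig_poly J' g"
  by (induction rule: trig_poly.induct; rule trig_poly.intros; auto)

lemma trig_poly_uminus: "trig_poly J g \<Longrightarrow> trig_poly J (\<lambda>x. - g x)"
  using trig_poly_mult[OF trig_poly_const[of J "-1"]] by simp

lemma trig_poly_diff: "trig_poly J g \<Longrightarrow> trig_poly J h \<Longrightarrow> trig_poly J (\<lambda>x. g x - h x)"
  using trig_poly_add[OF _ trig_poly_uminus] by simp

lemma trig_poly_sum: "(\<And>i. i \<in> I \<Longrightarrow> trig_poly J (g i)) \<Longrightarrow> trig_poly J (\<lambda>x. \<Sum>i\<in>I. g i x)"
  by (induction I rule: infinite_finite_induct) (auto intro: trig_poly_const trig_poly_add)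

lemma trig_poly_prod: "(\<And>i. i \<in> I \<Longrightarrow> trig_poly J (g i)) \<Longrightarrow> trig_poly J (\<lambda>x. \<Prod>i\<in>I. g i x)"
  by (induction I rule: infinite_finite_induct) (auto intro: trig_poly_const trig_poly_mult)

lemma trig_poly_power: "trig_poly J g \<Longrightarrow> trig_poly J (\<lambda>x. g x ^ n)"
  by (induction n) (auto intro: trig_poly_const trig_poly_mult)

lemma trig_poly_cos: "j \<in> J \<Longrightarrow> trig_poly J (\<lambda>x. of_real (cos (x j)))"
proof -
  assume j: "j \<in> J"
  have "trig_poly J (\<lambda>x. (1/2) * (exp (\<i> * of_real (x j)) + exp (- \<i> * of_real (x j))))"
    by (intro trig_poly.intros j)
  then show ?thesis by (simp add: cos_of_real[symmetric] cos_exp_eq)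
qed

lemma trig_poly_sin: "j \<in> J \<Longrightarrow> trig_poly J (\<lambda>x. of_real (sin (x j)))"
proof -
  assume j: "j \<in> J"
  have "trig_poly J (\<lambda>x. (1/(2*\<i>)) * (exp (\<i> * of_real (x j)) + (-1) * exp (- \<i> * of_real (x j))))"
    by (intro trig_poly.intros j)
  then show ?thesis by (simp add: sin_of_real[symmetric] sin_exp_eq)
qed

lemmas trig_poly_intros = trig_poly_const trig_poly_add trig_poly_mult trig_poly_uminus
  trig_poly_diff trig_poly_sum trig_poly_prod trig_poly_power

lemma trig_poly_cong_on: "trig_poly J g \<Longrightarrow> (\<And>j. j \<in> J \<Longrightarrow> x j = y j) \<Longrightarrow> g x = g y"
  by (induction rule: trig_poly.induct) auto

lemma trig_poly_periodic:
  "trig_poly J g \<Longrightarrow> g (\<lambda>j. x j + 2 * pi * of_int (h j)) = g x"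
proof (induction rule: trig_poly.induct)
  case (trig_poly_exp j)
  have "exp (\<i> * of_real (x j + 2 * pi * of_int (h j))) =
     exp (\<i> * of_real (x j) + (2 * of_int (h j) * pi) * \<i>)"
    by (simp add: algebra_simps)
  then show ?case unfolding exp_add exp_integer_2pi[OF Ints_of_int] by simp
next
  case (trig_poly_exp_minus j)
  have "exp (- \<i> * of_real (x j + 2 * pi * of_int (h j))) =
     exp (- \<i> * of_real (x j) + (2 * of_int (- h j) * pi) * \<i>)"
    by (simp add: algebra_simps)
  then show ?case unfolding exp_add exp_integer_2pi[OF Ints_of_int] by simp
qed auto

lemma norm_exp_i_diff_le: "cmod (exp (\<i> * of_real a) - exp (\<i> * of_real b)) \<le> \<bar>a - b\<bar>"
proof -
  have "exp (\<i> * of_real a) - exp (\<i> * of_real b) = exp (\<i> * of_real b) * (exp (\<i> * of_real (a - b)) - 1)"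
    by (simp add: algebra_simps exp_diff)
  then have "cmod (exp (\<i> * of_real a) - exp (\<i> * of_real b)) = cmod (exp (\<i> * of_real (a - b)) - 1)"
    by (simp add: norm_mult)
  also have "\<dots> = 2 * \<bar>sin ((a - b) / 2)\<bar>" by (rule dist_exp_i_1)
  also have "\<dots> \<le> \<bar>a - b\<bar>" using abs_sin_x_le_abs_x[of "(a - b) / 2"] by simp
  finally show ?thesis .
qed

text \<open>The uniform bound K is carried along for the product case. The Lipschitz bound is what
  allows Kronecker approximations to replace exact points of the torus.\<close>

lemma trig_poly_Lipschitz:
  assumes "trig_poly J g" "finite J"
  shows "\<exists>K L. 0 \<le> K \<and> 0 \<le> L \<and> (\<forall>x y. cmod (g x) \<le> K \<and> cmod (g x - g y) \<le> L * (\<Sum>j\<in>J. \<bar>x j - y j\<bar>))"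
  using assms(1)
proof (induction rule: trig_poly.induct)
  case (trig_poly_const c)
  then show ?case by (intro exI[of _ "cmod c"] exI[of _ 0]) auto
next
  case (trig_poly_exp j)
  have "\<bar>x j - y j\<bar> \<le> (\<Sum>j\<in>J. \<bar>x j - y j\<bar>)" for x y :: "nat \<Rightarrow> real"
    by (rule member_le_sum[OF trig_poly_exp _ \<open>finite J\<close>]) simp
  then have "cmod (exp (\<i> * of_real (x j)) - exp (\<i> * of_real (y j))) \<le> 1 * (\<Sum>j\<in>J. \<bar>x j - y j\<bar>)"
    for x y :: "nat \<Rightarrow> real"
    using norm_exp_i_diff_le[of "x j" "y j"] order_trans by fastforce
  then show ?case by (intro exI[of _ 1] conjI allI) auto
next
  case (trig_poly_exp_minus j)
  have le: "\<bar>x j - y j\<bar> \<le> (\<Sum>j\<in>J. \<bar>x j - y j\<bar>)" for x y :: "nat \<Rightarrow> real"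
    by (rule member_le_sum[OF trig_poly_exp_minus _ \<open>finite J\<close>]) simp
  have "cmod (exp (- \<i> * of_real (x j)) - exp (- \<i> * of_real (y j))) \<le> 1 * (\<Sum>j\<in>J. \<bar>x j - y j\<bar>)"
    for x y :: "nat \<Rightarrow> real"
  proof -
    have "cmod (exp (- \<i> * of_real (x j)) - exp (- \<i> * of_real (y j))) \<le> \<bar>x j - y j\<bar>"
      using norm_exp_i_diff_le[of "- x j" "- y j"] by simp
    then show ?thesis using le[of x y] by linarith
  qed
  then show ?case by (intro exI[of _ 1] conjI allI) auto
next
  case (trig_poly_add g h)
  from this(3,4) obtain K L K' L' where *: "0 \<le> K" "0 \<le> L" "0 \<le> K'" "0 \<le> L'"
    "\<And>x. cmod (g x) \<le> K" "\<And>x y. cmod (g x - g y) \<le> L * (\<Sum>j\<in>J. \<bar>x j - y j\<bar>)"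
    "\<And>x. cmod (h x) \<le> K'" "\<And>x y. cmod (h x - h y) \<le> L' * (\<Sum>j\<in>J. \<bar>x j - y j\<bar>)" by blast
  have "cmod (g x + h x) \<le> K + K'" for x
    using norm_triangle_ineq[of "g x" "h x"] *(5,7)[of x] by linarith
  moreover have "cmod (g x + h x - (g y + h y)) \<le> (L + L') * (\<Sum>j\<in>J. \<bar>x j - y j\<bar>)" for x y
    using norm_triangle_ineq[of "g x - g y" "h x - h y"] *(6)[of x y] *(8)[of x y]
    by (simp add: algebra_simps)
  ultimately show ?case using * by (intro exI[of _ "K+K'"] exI[of _ "L+L'"]) auto
next
  case (trig_poly_mult g h)
  from this(3,4) obtain K L K' L' where *: "0 \<le> K" "0 \<le> L" "0 \<le> K'" "0 \<le> L'"
    "\<And>x. cmod (g x) \<le> K" "\<And>x y. cmod (g x - g y) \<le> L * (\<Sum>j\<in>J. \<bar>x j - y j\<bar>)"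
    "\<And>x. cmod (h x) \<le> K'" "\<And>x y. cmod (h x - h y) \<le> L' * (\<Sum>j\<in>J. \<bar>x j - y j\<bar>)" by blast
  have "cmod (g x * h x) \<le> K * K'" for x
    using * by (simp add: norm_mult mult_mono)
  moreover have "cmod (g x * h x - g y * h y) \<le> (L * K' + K * L') * (\<Sum>j\<in>J. \<bar>x j - y j\<bar>)" for x y
  proof -
    let ?S = "\<Sum>j\<in>J. \<bar>x j - y j\<bar>"
    have "g x * h x - g y * h y = (g x - g y) * h x + g y * (h x - h y)" by (simp add: algebra_simps)
    then have "cmod (g x * h x - g y * h y) \<le> cmod (g x - g y) * cmod (h x) + cmod (g y) * cmod (h x - h y)"
      using norm_triangle_ineq[of "(g x - g y) * h x" "g y * (h x - h y)"] by (simp add: norm_mult)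
    also have "\<dots> \<le> (L * ?S) * K' + K * (L' * ?S)"
      using * by (intro add_mono mult_mono) (auto simp: sum_nonneg)
    finally show ?thesis by (simp add: algebra_simps)
  qed
  ultimately show ?case using * by (intro exI[of _ "K*K'"] exI[of _ "L * K' + K * L'"]) auto
qed

lemma trig_poly_continuous: "trig_poly J g \<Longrightarrow> continuous_on UNIV g"
  by (induction rule: trig_poly.induct) (auto intro!: continuous_intros)

section \<open>Restriction of trigonometric polynomials to lines\<close>

lemma exp_sum_mult:
  fixes \<Lambda> \<Lambda>' :: "real set"
  assumes "finite \<Lambda>" "finite \<Lambda>'"
  shows "\<exists>c. \<forall>t::real. (\<Sum>a\<in>\<Lambda>. c1 a * exp (\<i> * of_real (a * t))) * (\<Sum>b\<in>\<Lambda>'. c2 b * exp (\<i> * of_real (b * t)))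
    = (\<Sum>a\<in>(\<lambda>(a,b). a + b) ` (\<Lambda> \<times> \<Lambda>'). c a * exp (\<i> * of_real (a * t)))"
proof -
  \<comment> \<open>Different pairs (a, b) can have the same sum, so the coefficient of a frequency
    collects a whole fibre.\<close>
  define c where "c = (\<lambda>s. \<Sum>p\<in>{p\<in>\<Lambda> \<times> \<Lambda>'. (\<lambda>(a,b). a + b) p = s}. c1 (fst p) * c2 (snd p))"
  have "(\<Sum>a\<in>\<Lambda>. c1 a * exp (\<i> * of_real (a * t))) * (\<Sum>b\<in>\<Lambda>'. c2 b * exp (\<i> * of_real (b * t)))
    = (\<Sum>a\<in>(\<lambda>(a,b). a + b) ` (\<Lambda> \<times> \<Lambda>'). c a * exp (\<i> * of_real (a * t)))" for t :: real
  proof -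
    have "(\<Sum>a\<in>\<Lambda>. c1 a * exp (\<i> * of_real (a * t))) * (\<Sum>b\<in>\<Lambda>'. c2 b * exp (\<i> * of_real (b * t)))
      = (\<Sum>p\<in>\<Lambda> \<times> \<Lambda>'. c1 (fst p) * c2 (snd p) * exp (\<i> * of_real ((case p of (a,b) \<Rightarrow> a + b) * t)))"
      unfolding sum_product sum.cartesian_product
      by (rule sum.cong) (auto simp: exp_add algebra_simps)
    also have "\<dots> = (\<Sum>s\<in>(\<lambda>(a,b). a + b) ` (\<Lambda> \<times> \<Lambda>').
        \<Sum>p\<in>{p\<in>\<Lambda> \<times> \<Lambda>'. (\<lambda>(a,b). a + b) p = s}. c1 (fst p) * c2 (snd p) * exp (\<i> * of_real ((case p of (a,b) \<Rightarrow> a + b) * t)))"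
      using assms by (intro sum.image_gen) auto
    also have "\<dots> = (\<Sum>s\<in>(\<lambda>(a,b). a + b) ` (\<Lambda> \<times> \<Lambda>'). c s * exp (\<i> * of_real (s * t)))"
      unfolding c_def sum_distrib_right by (intro sum.cong refl) auto
    finally show ?thesis .
  qed
  then show ?thesis by blast
qed

text \<open>The order of quantifiers matters: the frequencies depend only on the direction v, and
  only the coefficients depend on x. Zero counts therefore become uniform in the base point.\<close>

lemma trig_poly_line:
  fixes v :: "nat \<Rightarrow> real"
  assumes "trig_poly J g"
  shows "\<exists>\<Lambda>. finite \<Lambda> \<and> (\<forall>x. \<exists>c. \<forall>t. g (\<lambda>j. x j + t * v j) = (\<Sum>a\<in>\<Lambda>. c a * exp (\<i> * of_real (a * t))))"
  using assms
proof (induction rule: trig_poly.induct)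
  case (trig_poly_const c)
  show ?case by (intro exI[of _ "{0}"] conjI allI exI[of _ "\<lambda>_. c"]) auto
next
  case (trig_poly_exp j)
  have "exp (\<i> * of_real (x j + t * v j)) = exp (\<i> * of_real (x j)) * exp (\<i> * of_real (v j * t))" for x t
    by (simp add: algebra_simps exp_add)
  then show ?case by (intro exI[of _ "{v j}"] conjI allI exI[of _ "\<lambda>_. exp (\<i> * of_real (_ j))"]) simp_all
next
  case (trig_poly_exp_minus j)
  have "exp (- \<i> * of_real (x j + t * v j)) = exp (- \<i> * of_real (x j)) * exp (\<i> * of_real (- v j * t))" for x t
    by (simp add: exp_add[symmetric] algebra_simps)
  then show ?case by (intro exI[of _ "{- v j}"] conjI allI exI[of _ "\<lambda>_. exp (- \<i> * of_real (_ j))"]) simp_all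
next
  case (trig_poly_add g h)
  from this(3,4) obtain \<Lambda> \<Lambda>' where fin: "finite \<Lambda>" "finite \<Lambda>'"
    and g: "\<forall>x. \<exists>c. \<forall>t. g (\<lambda>j. x j + t * v j) = (\<Sum>a\<in>\<Lambda>. c a * exp (\<i> * of_real (a * t)))"
    and h: "\<forall>x. \<exists>c. \<forall>t. h (\<lambda>j. x j + t * v j) = (\<Sum>a\<in>\<Lambda>'. c a * exp (\<i> * of_real (a * t)))"
    by blast
  from choice[OF g] choice[OF h] fin obtain c1 c2 where *: "finite \<Lambda>" "finite \<Lambda>'"
    "\<And>x t. g (\<lambda>j. x j + t * v j) = (\<Sum>a\<in>\<Lambda>. c1 x a * exp (\<i> * of_real (a * t)))"
    "\<And>x t. h (\<lambda>j. x j + t * v j) = (\<Sum>a\<in>\<Lambda>'. c2 x a * exp (\<i> * of_real (a * t)))"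
    by blast
  have "(\<Sum>a\<in>\<Lambda>. c1 x a * exp (\<i> * of_real (a * t))) =
      (\<Sum>a\<in>\<Lambda>\<union>\<Lambda>'. (if a \<in> \<Lambda> then c1 x a else 0) * exp (\<i> * of_real (a * t)))" for x t
    using * by (intro sum.mono_neutral_cong_left) auto
  moreover have "(\<Sum>a\<in>\<Lambda>'. c2 x a * exp (\<i> * of_real (a * t))) =
      (\<Sum>a\<in>\<Lambda>\<union>\<Lambda>'. (if a \<in> \<Lambda>' then c2 x a else 0) * exp (\<i> * of_real (a * t)))" for x t
    using * by (intro sum.mono_neutral_cong_left) auto
  ultimately have "g (\<lambda>j. x j + t * v j) + h (\<lambda>j. x j + t * v j) = (\<Sum>a\<in>\<Lambda>\<union>\<Lambda>'.
      ((if a \<in> \<Lambda> then c1 x a else 0) + (if a \<in> \<Lambda>' then c2 x a else 0)) * exp (\<i> * of_real (a * t)))" for x t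
    unfolding *(3,4) by (simp only: distrib_right sum.distrib)
  then have "\<exists>c. \<forall>t. g (\<lambda>j. x j + t * v j) + h (\<lambda>j. x j + t * v j) = (\<Sum>a\<in>\<Lambda>\<union>\<Lambda>'. c a * exp (\<i> * of_real (a * t)))" for x
    by (intro exI allI)
  then show ?case using *(1,2) by (intro exI[of _ "\<Lambda>\<union>\<Lambda>'"] conjI allI finite_UnI)
next
  case (trig_poly_mult g h)
  from this(3,4) obtain \<Lambda> \<Lambda>' where fin: "finite \<Lambda>" "finite \<Lambda>'"
    and g: "\<forall>x. \<exists>c. \<forall>t. g (\<lambda>j. x j + t * v j) = (\<Sum>a\<in>\<Lambda>. c a * exp (\<i> * of_real (a * t)))"
    and h: "\<forall>x. \<exists>c. \<forall>t. h (\<lambda>j. x j + t * v j) = (\<Sum>a\<in>\<Lambda>'. c a * exp (\<i> * of_real (a * t)))"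
    by blast
  from choice[OF g] choice[OF h] fin obtain c1 c2 where *: "finite \<Lambda>" "finite \<Lambda>'"
    "\<And>x t. g (\<lambda>j. x j + t * v j) = (\<Sum>a\<in>\<Lambda>. c1 x a * exp (\<i> * of_real (a * t)))"
    "\<And>x t. h (\<lambda>j. x j + t * v j) = (\<Sum>a\<in>\<Lambda>'. c2 x a * exp (\<i> * of_real (a * t)))"
    by blast
  show ?case unfolding *(3,4) using *(1,2)
    by (intro exI[of _ "(\<lambda>(a,b). a + b) ` (\<Lambda> \<times> \<Lambda>')"] conjI allI exp_sum_mult) auto
qed

lemma large_set_has_finite_subset:
  assumes "\<not> (finite Z \<and> card Z \<le> n)"
  shows "\<exists>Y\<subseteq>Z. finite Y \<and> card Y = n"
proof (cases "finite Z")
  case True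
  then have "n \<le> card Z" using assms by linarith
  then show ?thesis by (metis obtain_subset_with_card_n)
next
  case False
  then show ?thesis by (metis infinite_arbitrarily_large)
qed

text \<open>Real and imaginary part are real trigonometric sums with the same frequencies, so 2 card
  \<Lambda> zeros in a short window would make both vanish identically.\<close>

lemma exp_sum_zeros_short:
  fixes \<Lambda> :: "real set"
  assumes "finite \<Lambda>" "\<And>c. c \<in> \<Lambda> \<Longrightarrow> \<bar>c\<bar> * \<delta> < pi" "\<delta> > 0"
    and nz: "\<exists>t. (\<Sum>a\<in>\<Lambda>. c a * exp (\<i> * of_real (a * t))) \<noteq> 0"
  shows "finite {t\<in>{u<..<u+\<delta>}. (\<Sum>a\<in>\<Lambda>. c a * exp (\<i> * of_real (a * t))) = 0} \<and>
    card {t\<in>{u<..<u+\<delta>}. (\<Sum>a\<in>\<Lambda>. c a * exp (\<i> * of_real (a * t))) = 0} \<le> 2 * card \<Lambda>"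
proof (rule ccontr)
  let ?Z = "{t\<in>{u<..<u+\<delta>}. (\<Sum>a\<in>\<Lambda>. c a * exp (\<i> * of_real (a * t))) = 0}"
  assume "\<not> ?thesis"
  from large_set_has_finite_subset[OF this] obtain Z where Z: "Z \<subseteq> ?Z" "finite Z" "card Z = 2 * card \<Lambda>" by blast
  have re: "Re (\<Sum>a\<in>\<Lambda>. c a * exp (\<i> * of_real (a * t))) =
    (\<Sum>a\<in>\<Lambda>. Re (c a) * cos (a * t) + (- Im (c a)) * sin (a * t))" for t
    by (simp add: Re_exp Im_exp)
  have im: "Im (\<Sum>a\<in>\<Lambda>. c a * exp (\<i> * of_real (a * t))) =
    (\<Sum>a\<in>\<Lambda>. Im (c a) * cos (a * t) + Re (c a) * sin (a * t))" for t
    by (simp add: Re_exp Im_exp add.commute)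
  have "Re (\<Sum>a\<in>\<Lambda>. c a * exp (\<i> * of_real (a * t))) = 0" for t
    unfolding re
  proof (rule trig_sum_zeros[OF assms(1-3) Z(2,3)])
    show "Z \<subseteq> {u<..<u+\<delta>}" using Z(1) by auto
  next
    fix t assume "t \<in> Z"
    then have "(\<Sum>a\<in>\<Lambda>. c a * exp (\<i> * of_real (a * t))) = 0" using Z(1) by auto
    then show "(\<Sum>a\<in>\<Lambda>. Re (c a) * cos (a * t) + (- Im (c a)) * sin (a * t)) = 0"
      unfolding re[symmetric] by (simp only: zero_complex.sel)
  qed
  moreover have "Im (\<Sum>a\<in>\<Lambda>. c a * exp (\<i> * of_real (a * t))) = 0" for t
    unfolding im
  proof (rule trig_sum_zeros[OF assms(1-3) Z(2,3)])
    show "Z \<subseteq> {u<..<u+\<delta>}" using Z(1) by auto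
  next
    fix t assume "t \<in> Z"
    then have "(\<Sum>a\<in>\<Lambda>. c a * exp (\<i> * of_real (a * t))) = 0" using Z(1) by auto
    then show "(\<Sum>a\<in>\<Lambda>. Im (c a) * cos (a * t) + Re (c a) * sin (a * t)) = 0"
      unfolding im[symmetric] by (simp only: zero_complex.sel)
  qed
  ultimately show False using nz by (metis complex_eqI zero_complex.sel)
qed

lemma trig_poly_zeros_bounded:
  assumes "trig_poly J g"
  shows "\<exists>M::nat. \<forall>x. (\<exists>t. g (\<lambda>j. x j + t * v j) \<noteq> 0) \<longrightarrow>
     finite {t\<in>{a..b::real}. g (\<lambda>j. x j + t * v j) = 0} \<and>
     card {t\<in>{a..b}. g (\<lambda>j. x j + t * v j) = 0} \<le> M"
proof -
  obtain \<Lambda> where fin: "finite \<Lambda>"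
    and "\<forall>x. \<exists>c. \<forall>t. g (\<lambda>j. x j + t * v j) = (\<Sum>a\<in>\<Lambda>. c a * exp (\<i> * of_real (a * t)))"
    using trig_poly_line[OF assms, of v] by blast
  from choice[OF this(2)] obtain c
    where g: "\<And>x t. g (\<lambda>j. x j + t * v j) = (\<Sum>a\<in>\<Lambda>. c x a * exp (\<i> * of_real (a * t)))"
    by blast
  \<comment> \<open>Makes |a| \<delta> \<le> 1 < pi for every frequency a; the inserted 1 keeps the
    denominator positive when \<Lambda> has no nonzero element.\<close>
  define \<delta> where "\<delta> = 1 / (\<Sum>a\<in>insert 1 \<Lambda>. \<bar>a\<bar>)"
  have pos: "(\<Sum>a\<in>insert 1 \<Lambda>. \<bar>a\<bar>) > 0"
    using fin by (intro sum_pos2[of _ 1]) auto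
  have \<delta>: "\<delta> > 0" unfolding \<delta>_def using pos by simp
  have small: "\<bar>a\<bar> * \<delta> < pi" if "a \<in> \<Lambda>" for a
  proof -
    have "\<bar>a\<bar> \<le> (\<Sum>a\<in>insert 1 \<Lambda>. \<bar>a\<bar>)" using that fin by (intro member_le_sum) auto
    then have "\<bar>a\<bar> * \<delta> \<le> 1" unfolding \<delta>_def using pos by (simp add: field_simps)
    then show ?thesis using pi_gt3 by linarith
  qed
  define n where "n = nat \<lceil>(b - a) / (\<delta> / 2)\<rceil> + 1"
  \<comment> \<open>Open windows of length \<delta> in steps of \<delta>/2, started at a -
    \<delta>/4 so that every point of the closed interval has a margin of \<delta>/4 in its
    window.\<close>
  define I where "I = (\<lambda>m::nat. {a - \<delta> / 4 + real m * (\<delta> / 2)<..<a - \<delta> / 4 + real m * (\<delta> / 2) + \<delta>})"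
  have cover: "{a..b} \<subseteq> (\<Union>m<n. I m)"
  proof
    fix t assume t: "t \<in> {a..b}"
    define m where "m = nat \<lfloor>(t - a) / (\<delta> / 2)\<rfloor>"
    have m: "real m \<le> (t - a) / (\<delta> / 2)" "(t - a) / (\<delta> / 2) < real m + 1"
      unfolding m_def using t \<delta> by (auto simp: of_nat_nat intro: floor_divide_lower) 
    have "(t - a) / (\<delta> / 2) \<le> (b - a) / (\<delta> / 2)" using t \<delta> by (intro divide_right_mono) auto
    then have "m < n" unfolding n_def using m(1) by linarith
    moreover have "t \<in> I m" unfolding I_def using m \<delta> by (auto simp: field_simps)
    ultimately show "t \<in> (\<Union>m<n. I m)" by blast
  qed
  show ?thesis
  proof (intro exI[of _ "n * (2 * card \<Lambda>)"] allI impI)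
    fix x assume nz: "\<exists>t. g (\<lambda>j. x j + t * v j) \<noteq> 0"
    let ?Z = "\<lambda>m. {t\<in>I m. g (\<lambda>j. x j + t * v j) = 0}"
    have Z: "finite (?Z m) \<and> card (?Z m) \<le> 2 * card \<Lambda>" for m
      unfolding g I_def by (rule exp_sum_zeros_short[OF fin small \<delta>]) (use nz g in auto)
    have sub: "{t\<in>{a..b}. g (\<lambda>j. x j + t * v j) = 0} \<subseteq> (\<Union>m<n. ?Z m)" using cover by blast
    have fin': "finite (\<Union>m<n. ?Z m)" using Z by blast
    have "card (\<Union>m<n. ?Z m) \<le> (\<Sum>m<n. card (?Z m))" by (rule card_UN_le) simp
    also have "\<dots> \<le> (\<Sum>m<n. 2 * card \<Lambda>)" using Z by (intro sum_mono) blast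
    finally have "card (\<Union>m<n. ?Z m) \<le> n * (2 * card \<Lambda>)" by simp
    then show "finite {t\<in>{a..b::real}. g (\<lambda>j. x j + t * v j) = 0} \<and>
     card {t\<in>{a..b}. g (\<lambda>j. x j + t * v j) = 0} \<le> n * (2 * card \<Lambda>)"
      using finite_subset[OF sub fin'] card_mono[OF fin' sub] by linarith
  qed
qed

lemma trig_poly_zeros_countable:
  assumes "trig_poly J g" "g (\<lambda>j. x j + t0 * v j) \<noteq> 0"
  shows "countable {t. g (\<lambda>j. x j + t * v j) = 0}"
proof -
  have "{t. g (\<lambda>j. x j + t * v j) = 0} = (\<Union>n::nat. {t\<in>{-real n..real n}. g (\<lambda>j. x j + t * v j) = 0})"
  proof (intro equalityI subsetI)
    fix t assume t: "t \<in> {t. g (\<lambda>j. x j + t * v j) = 0}"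
    obtain n :: nat where "\<bar>t\<bar> \<le> real n" using real_arch_simple[of "\<bar>t\<bar>"] by blast
    then have "t \<in> {-real n..real n}" by (simp add: abs_le_iff)
    then show "t \<in> (\<Union>n::nat. {t\<in>{-real n..real n}. g (\<lambda>j. x j + t * v j) = 0})" using t by blast
  qed blast
  moreover have "finite {t\<in>{-real n..real n}. g (\<lambda>j. x j + t * v j) = 0}" for n
    using trig_poly_zeros_bounded[OF assms(1), of v "- real n" "real n"] assms(2) by blast
  ultimately show ?thesis by (simp add: countable_finite)
qed

text \<open>On the segment from x to y each factor is nonzero somewhere and so has only finitely
  many zeros; some point of the segment avoids them all.\<close>

lemma trig_poly_mult_nonzero:
  assumes "trig_poly J g" "trig_poly J h" "g x \<noteq> 0" "h y \<noteq> 0"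
  shows "\<exists>z. g z * h z \<noteq> 0"
proof -
  let ?p = "\<lambda>t. (\<lambda>j. x j + t * (y j - x j))"
  have "g (?p 0) \<noteq> 0" using assms(3) by simp
  have "finite {t\<in>{0..1}. g (?p t) = 0}"
    using trig_poly_zeros_bounded[OF assms(1), of "\<lambda>j. y j - x j" 0 1] \<open>g (?p 0) \<noteq> 0\<close> by blast
  moreover have "h (?p 1) \<noteq> 0" using assms(4) by simp
  then have "finite {t\<in>{0..1}. h (?p t) = 0}"
    using trig_poly_zeros_bounded[OF assms(2), of "\<lambda>j. y j - x j" 0 1] by blast
  ultimately have fin: "finite ({t\<in>{0..1}. g (?p t) = 0} \<union> {t\<in>{0..1}. h (?p t) = 0})" by simp
  have "infinite {0..1::real}" by (simp add: infinite_Icc)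
  then obtain t where "t \<in> {0..1}" "t \<notin> {t\<in>{0..1}. g (?p t) = 0} \<union> {t\<in>{0..1}. h (?p t) = 0}"
    using finite_subset[OF _ fin, of "{0..1}"] by blast
  then show ?thesis by (intro exI[of _ "?p t"]) auto
qed

section \<open>Eigenfunctions of the mandarin graph\<close>

text \<open>Rotating the vector (f, f'/k) back by the angle k t makes it constant; \<open>u\<close>
  and \<open>v\<close> are the components of the rotated vector.\<close>

lemma complex_ode_solution:
  fixes f g :: "real \<Rightarrow> complex"
  assumes k: "k > 0" and L: "L > 0"
    and f: "\<And>t. t \<in> {0..L} \<Longrightarrow> (f has_vector_derivative g t) (at t within {0..L})"
    and g: "\<And>t. t \<in> {0..L} \<Longrightarrow> (g has_vector_derivative (- of_real (k\<^sup>2) * f t)) (at t within {0..L})"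
    and t: "t \<in> {0..L}"
  shows "f t = f 0 * of_real (cos (k * t)) + (g 0 / of_real k) * of_real (sin (k * t))"
proof -
  let ?c = "\<lambda>t. complex_of_real (cos (k * t))" and ?s = "\<lambda>t. complex_of_real (sin (k * t))"
  have dc: "(?c has_vector_derivative of_real (- k * sin (k * t))) (at t within S)" for t S
    by (rule has_vector_derivative_of_real)
       (auto intro!: derivative_eq_intros simp: has_real_derivative_iff_has_vector_derivative[symmetric])
  have ds: "(?s has_vector_derivative of_real (k * cos (k * t))) (at t within S)" for t S
    by (rule has_vector_derivative_of_real)
       (auto intro!: derivative_eq_intros simp: has_real_derivative_iff_has_vector_derivative[symmetric])
  define u where "u = (\<lambda>t. f t * ?c t - (g t * ?s t) / of_real k)"
  define v where "v = (\<lambda>t. f t * ?s t + (g t * ?c t) / of_real k)"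
  have du: "(u has_vector_derivative 0) (at t within {0..L})" if "t \<in> {0..L}" for t
  proof -
    have "(u has_vector_derivative
       (f t * of_real (- k * sin (k * t)) + g t * ?c t -
       (g t * of_real (k * cos (k * t)) + (- of_real (k\<^sup>2) * f t) * ?s t) / of_real k)) (at t within {0..L})"
      unfolding u_def
      by (intro has_vector_derivative_diff has_vector_derivative_mult has_vector_derivative_divide dc ds f g that)
    moreover have "f t * of_real (- k * sin (k * t)) + g t * ?c t -
       (g t * of_real (k * cos (k * t)) + (- of_real (k\<^sup>2) * f t) * ?s t) / of_real k = 0"
      using k by (simp add: field_simps power2_eq_square)
    ultimately show ?thesis by simp
  qed
  have dv: "(v has_vector_derivative 0) (at t within {0..L})" if "t \<in> {0..L}" for t
  proof -
    have "(v has_vector_derivative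
       (f t * of_real (k * cos (k * t)) + g t * ?s t +
       (g t * of_real (- k * sin (k * t)) + (- of_real (k\<^sup>2) * f t) * ?c t) / of_real k)) (at t within {0..L})"
      unfolding v_def
      by (intro has_vector_derivative_add has_vector_derivative_mult has_vector_derivative_divide dc ds f g that)
    moreover have "f t * of_real (k * cos (k * t)) + g t * ?s t +
       (g t * of_real (- k * sin (k * t)) + (- of_real (k\<^sup>2) * f t) * ?c t) / of_real k = 0"
      using k by (simp add: field_simps power2_eq_square)
    ultimately show ?thesis by simp
  qed
  have "u t = u 0" "v t = v 0"
    using has_vector_derivative_zero_constant[of "{0..L}" u] has_vector_derivative_zero_constant[of "{0..L}" v]
      du dv t L by (metis atLeastAtMost_iff convex_real_interval(5) less_imp_le order_refl)+
  then have uv: "f t * ?c t - (g t * ?s t) / of_real k = f 0"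
    "f t * ?s t + (g t * ?c t) / of_real k = g 0 / of_real k"
    unfolding u_def v_def by auto
  have "f t = f t * of_real ((cos (k * t))\<^sup>2 + (sin (k * t))\<^sup>2)" by simp
  also have "\<dots> = (f t * ?c t - (g t * ?s t) / of_real k) * ?c t + (f t * ?s t + (g t * ?c t) / of_real k) * ?s t"
    by (simp only: of_real_add of_real_power) (simp add: algebra_simps power2_eq_square)
  finally show ?thesis unfolding uv .
qed

text \<open>By continuity at the first vertex the coefficient A_j does not depend on the edge j.\<close>

definition edge_fun :: "real \<Rightarrow> complex \<Rightarrow> (nat \<Rightarrow> complex) \<Rightarrow> nat \<Rightarrow> real \<Rightarrow> complex" where
  "edge_fun k A B j t = A * of_real (cos (k * t)) + B j * of_real (sin (k * t))"

definition agrees :: "nat \<Rightarrow> (nat \<Rightarrow> real) \<Rightarrow> real \<Rightarrow> (nat \<Rightarrow> real \<Rightarrow> complex) \<Rightarrow> complex \<Rightarrow> (nat \<Rightarrow> complex) \<Rightarrow> bool" where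
  "agrees N l k f A B \<longleftrightarrow> (\<forall>j<N. \<forall>t\<in>{0..l j}. f j t = edge_fun k A B j t)"

text \<open>Vertex conditions in terms of coefficients. Here x is the full angle k l; half angles
  enter later through 2 x.\<close>

definition sol_par :: "nat \<Rightarrow> (nat \<Rightarrow> real) \<Rightarrow> complex \<Rightarrow> (nat \<Rightarrow> complex) \<Rightarrow> bool" where
  "sol_par N x A B \<longleftrightarrow>
     (\<forall>i<N. \<forall>j<N. A * of_real (cos (x i)) + B i * of_real (sin (x i)) = A * of_real (cos (x j)) + B j * of_real (sin (x j))) \<and>
     (\<Sum>j<N. B j) = 0 \<and> (\<Sum>j<N. A * of_real (sin (x j)) - B j * of_real (cos (x j))) = 0"

lemma edge_fun_deriv:
  "(edge_fun k A B j has_vector_derivative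
     of_real k * (B j * of_real (cos (k * t)) - A * of_real (sin (k * t)))) (at t within S)"
proof -
  have dc: "((\<lambda>t. complex_of_real (cos (k * t))) has_vector_derivative of_real (- k * sin (k * t))) (at t within S)"
    by (rule has_vector_derivative_of_real)
       (auto intro!: derivative_eq_intros simp: has_real_derivative_iff_has_vector_derivative[symmetric])
  have ds: "((\<lambda>t. complex_of_real (sin (k * t))) has_vector_derivative of_real (k * cos (k * t))) (at t within S)"
    by (rule has_vector_derivative_of_real)
       (auto intro!: derivative_eq_intros simp: has_real_derivative_iff_has_vector_derivative[symmetric])
  have "((\<lambda>t. A * of_real (cos (k * t)) + B j * of_real (sin (k * t))) has_vector_derivative
     A * of_real (- k * sin (k * t)) + B j * of_real (k * cos (k * t))) (at t within S)"
    by (intro has_vector_derivative_add has_vector_derivative_mult_right dc ds)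
  then show ?thesis unfolding edge_fun_def by (simp add: algebra_simps)
qed

lemma edge_fun_deriv2:
  "((\<lambda>t. of_real k * (B j * of_real (cos (k * t)) - A * of_real (sin (k * t)))) has_vector_derivative
     - of_real (k\<^sup>2) * edge_fun k A B j t) (at t within S)"
proof -
  have "((\<lambda>t. of_real k * edge_fun k (B j) (\<lambda>_. - A) j t) has_vector_derivative
     of_real k * (of_real k * (- A * of_real (cos (k * t)) - B j * of_real (sin (k * t))))) (at t within S)"
    by (intro has_vector_derivative_mult_right edge_fun_deriv)
  then show ?thesis unfolding edge_fun_def by (simp add: algebra_simps power2_eq_square)
qed

lemma agrees_deriv:
  assumes "agrees N l k f A B" "j < N" "t \<in> {0..l j}"
  shows "(f j has_vector_derivative of_real k * (B j * of_real (cos (k * t)) - A * of_real (sin (k * t)))) (at t within {0..l j})"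
  by (rule has_vector_derivative_transform[OF assms(3) _ edge_fun_deriv])
    (use assms in \<open>auto simp: agrees_def\<close>)

lemma agrees_edge_deriv:
  assumes "l \<in> posorth N" "agrees N l k f A B" "j < N" "t \<in> {0..l j}"
  shows "edge_deriv l f j t = of_real k * (B j * of_real (cos (k * t)) - A * of_real (sin (k * t)))"
  unfolding edge_deriv_def
  using vector_derivative_within_cbox[of 0 "l j" t "f j"] agrees_deriv[OF assms(2-4)] assms(1,3,4)
  by (auto simp: posorth_def)

lemma agrees_mandarin_sol_iff:
  assumes l: "l \<in> posorth N" and k: "k > 0" and ag: "agrees N l k f A B"
  shows "mandarin_sol N l (k\<^sup>2) f \<longleftrightarrow> sol_par N (\<lambda>j. k * l j) A B"
proof -
  have lpos: "l j > 0" if "j < N" for j using l that by (auto simp: posorth_def)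
  have "\<exists>g. \<forall>t\<in>{0..l j}. (f j has_vector_derivative g t) (at t within {0..l j}) \<and>
         (g has_vector_derivative (- of_real (k\<^sup>2) * f j t)) (at t within {0..l j})" if "j < N" for j
  proof (intro exI ballI conjI)
    fix t assume t: "t \<in> {0..l j}"
    show "(f j has_vector_derivative of_real k * (B j * of_real (cos (k * t)) - A * of_real (sin (k * t)))) (at t within {0..l j})"
      by (rule agrees_deriv[OF ag that t])
    have "f j t = edge_fun k A B j t" using ag t that by (auto simp: agrees_def)
    then show "((\<lambda>t. of_real k * (B j * of_real (cos (k * t)) - A * of_real (sin (k * t)))) has_vector_derivative - of_real (k\<^sup>2) * f j t) (at t within {0..l j})"
      using edge_fun_deriv2[of k B j A t "{0..l j}"] by simp
  qed
  moreover have "f j 0 = A" if "j < N" for j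
    using ag lpos[OF that] that by (auto simp: agrees_def edge_fun_def)
  moreover have "f j (l j) = A * of_real (cos (k * l j)) + B j * of_real (sin (k * l j))" if "j < N" for j
    using ag lpos[OF that] that by (auto simp: agrees_def edge_fun_def)
  moreover have "(\<Sum>j<N. edge_deriv l f j 0) = of_real k * (\<Sum>j<N. B j)"
    unfolding sum_distrib_left using lpos
    by (intro sum.cong) (auto simp: agrees_edge_deriv[OF l ag] less_imp_le)
  moreover have "(\<Sum>j<N. - edge_deriv l f j (l j)) = of_real k * (\<Sum>j<N. A * of_real (sin (k * l j)) - B j * of_real (cos (k * l j)))"
    unfolding sum_distrib_left using lpos
    by (intro sum.cong) (auto simp: agrees_edge_deriv[OF l ag] less_imp_le algebra_simps)
  ultimately show ?thesis using k unfolding mandarin_sol_def sol_par_def by auto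
qed

lemma mandarin_sol_agrees:
  assumes l: "l \<in> posorth N" and k: "k > 0" and N: "N > 0" and sol: "mandarin_sol N l (k\<^sup>2) f"
  obtains A B where "agrees N l k f A B" "sol_par N (\<lambda>j. k * l j) A B"
proof -
  have "\<forall>j. \<exists>b. j < N \<longrightarrow> (\<forall>t\<in>{0..l j}. f j t = f j 0 * of_real (cos (k * t)) + b * of_real (sin (k * t)))"
  proof
    fix j
    show "\<exists>b. j < N \<longrightarrow> (\<forall>t\<in>{0..l j}. f j t = f j 0 * of_real (cos (k * t)) + b * of_real (sin (k * t)))"
    proof (cases "j < N")
      case True
      then obtain g where g: "\<forall>t\<in>{0..l j}. (f j has_vector_derivative g t) (at t within {0..l j}) \<and>
         (g has_vector_derivative (- of_real (k\<^sup>2) * f j t)) (at t within {0..l j})"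
        using sol unfolding mandarin_sol_def by blast
      have "l j > 0" using l True by (auto simp: posorth_def)
      from complex_ode_solution[OF k this, of "f j" g] g show ?thesis by blast
    qed auto
  qed
  from choice[OF this] obtain B where
    B: "\<And>j t. j < N \<Longrightarrow> t \<in> {0..l j} \<Longrightarrow> f j t = f j 0 * of_real (cos (k * t)) + B j * of_real (sin (k * t))" by blast
  have "f j 0 = f 0 0" if "j < N" for j using sol that N unfolding mandarin_sol_def by blast
  then have ag: "agrees N l k f (f 0 0) B" unfolding agrees_def edge_fun_def using B by metis
  show ?thesis using that[OF ag] agrees_mandarin_sol_iff[OF l k ag] sol by blast
qed

lemma edge_fun_zero_iff:
  assumes "L > 0" "k > 0"
  shows "(\<forall>t\<in>{0..L}. A * of_real (cos (k * t)) + b * of_real (sin (k * t)) = (0::complex)) \<longleftrightarrow> A = 0 \<and> b = 0"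
proof
  assume *: "\<forall>t\<in>{0..L}. A * of_real (cos (k * t)) + b * of_real (sin (k * t)) = 0"
  from bspec[OF *, of 0] assms have A: "A = 0" by simp
  \<comment> \<open>A time inside the edge with 0 < k t \<le> pi/2, where the sine is
    positive.\<close>
  define t where "t = min L (pi / (2 * k))"
  have t: "t \<in> {0..L}" "0 < k * t" "k * t \<le> pi / 2"
    using assms pi_gt_zero unfolding t_def by (auto simp: min_def field_simps)
  have "sin (k * t) > 0" using t pi_gt_zero by (intro sin_gt_zero) linarith+
  then show "A = 0 \<and> b = 0" using bspec[OF * t(1)] A by simp
qed auto

lemma agrees_zero_iff:
  assumes "l \<in> posorth N" "k > 0" "agrees N l k f A B" "N > 0"
  shows "(\<forall>j<N. \<forall>t\<in>{0..l j}. f j t = 0) \<longleftrightarrow> A = 0 \<and> (\<forall>j<N. B j = 0)"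
proof -
  have "(\<forall>t\<in>{0..l j}. f j t = 0) \<longleftrightarrow> A = 0 \<and> B j = 0" if "j < N" for j
    using edge_fun_zero_iff[of "l j" k A "B j"] assms that by (auto simp: agrees_def edge_fun_def posorth_def)
  then show ?thesis using assms(4) by blast
qed

lemma agrees_edge_fun: "agrees N l k (edge_fun k A B) A B"
  by (simp add: agrees_def)

lemma eigenfunction_iff_sol_par:
  assumes "l \<in> posorth N" "k > 0" "N > 0" "agrees N l k f A B"
  shows "eigenfunction N l (k\<^sup>2) f \<longleftrightarrow> sol_par N (\<lambda>j. k * l j) A B \<and> (A \<noteq> 0 \<or> (\<exists>j<N. B j \<noteq> 0))"
  unfolding eigenfunction_def agrees_mandarin_sol_iff[OF assms(1,2,4)]
  using agrees_zero_iff[OF assms(1,2,4,3)] by blast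

subsection \<open>Multiplicity\<close>

text \<open>Gaussian elimination: a vector with nonzero last coordinate serves as pivot, and the
  induction hypothesis applies to the others after their last coordinate is cleared.\<close>

lemma linear_dependence:
  fixes v :: "nat \<Rightarrow> nat \<Rightarrow> complex"
  shows "m < n \<Longrightarrow> \<exists>c. (\<exists>i<n. c i \<noteq> 0) \<and> (\<forall>j<m. (\<Sum>i<n. c i * v i j) = 0)"
proof (induction m arbitrary: n v)
  case 0
  then show ?case by (intro exI[of _ "\<lambda>_. 1"]) auto
next
  case (Suc m)
  then obtain n' where n: "n = Suc n'" "m < n'" by (metis Suc_less_eq2)
  show ?case
  proof (cases "\<exists>p<n. v p m \<noteq> 0")
    case False
    then have "(\<Sum>i<n. c i * v i m) = 0" for c by simp
    moreover obtain c where "\<exists>i<n. c i \<noteq> 0" "\<forall>j<m. (\<Sum>i<n. c i * v i j) = 0"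
      using Suc.IH[of n v] Suc.prems by auto
    ultimately show ?thesis by (intro exI[of _ c]) (auto simp: less_Suc_eq)
  next
    case True
    then obtain p where p: "p < n" "v p m \<noteq> 0" by blast
    \<comment> \<open>Transposition that moves the pivot to the last position n'.\<close>
    define \<sigma> where "\<sigma> = (\<lambda>i. if i = p then n' else if i = n' then p else i)"
    have sig: "bij_betw \<sigma> {..<n} {..<n}"
      by (rule bij_betw_byWitness[where f' = \<sigma>]) (use p n in \<open>auto simp: \<sigma>_def\<close>)
    define u where "u = (\<lambda>i. v (\<sigma> i))"
    have u: "u n' m \<noteq> 0" using p unfolding u_def \<sigma>_def by auto
    define w where "w = (\<lambda>i j. u i j - (u i m / u n' m) * u n' j)"
    obtain c where c: "\<exists>i<n'. c i \<noteq> 0" "\<forall>j<m. (\<Sum>i<n'. c i * w i j) = 0"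
      using Suc.IH[OF n(2), of w] by blast
    \<comment> \<open>The coefficient of the pivot collects the multiples of it that were subtracted
      from the other vectors.\<close>
    define e where "e = (\<lambda>i. if i < n' then c i else - (\<Sum>i<n'. c i * (u i m / u n' m)))"
    have eu: "(\<Sum>i<n. e i * u i j) = (\<Sum>i<n'. c i * w i j)" for j
      unfolding n(1) e_def w_def by (simp add: algebra_simps sum_subtractf sum_distrib_left)
    have "w i m = 0" for i unfolding w_def using u by simp
    then have 0: "(\<Sum>i<n. e i * u i j) = 0" if "j < Suc m" for j
      unfolding eu using c(2) that by (cases "j = m") (auto simp: less_Suc_eq)
    have "(\<Sum>i<n. e (\<sigma> i) * v i j) = (\<Sum>i<n. e i * u i j)" for j
    proof -
      have "(\<Sum>i<n. e (\<sigma> i) * v i j) = (\<Sum>i<n. e (\<sigma> (\<sigma> i)) * v (\<sigma> i) j)"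
        using sum.reindex_bij_betw[OF sig, of "\<lambda>i. e (\<sigma> i) * v i j"] by simp
      moreover have "\<sigma> (\<sigma> i) = i" for i by (simp add: \<sigma>_def)
      ultimately show ?thesis by (simp add: u_def)
    qed
    moreover obtain i where "i < n'" "c i \<noteq> 0" using c(1) by blast
    then have "e (\<sigma> (\<sigma> i)) \<noteq> 0" "\<sigma> i < n" using p n by (auto simp: e_def \<sigma>_def)
    ultimately show ?thesis using 0 by (intro exI[of _ "\<lambda>i. e (\<sigma> i)"]) auto
  qed
qed

definition indep_sols :: "nat \<Rightarrow> (nat \<Rightarrow> real) \<Rightarrow> real \<Rightarrow> nat set" where
  "indep_sols N l lam = {n. \<exists>fs :: nat \<Rightarrow> nat \<Rightarrow> real \<Rightarrow> complex.
      (\<forall>i<n. mandarin_sol N l lam (fs i)) \<and>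
      (\<forall>c :: nat \<Rightarrow> complex. (\<forall>j<N. \<forall>t\<in>{0..l j}. (\<Sum>i<n. c i * fs i j t) = 0) \<longrightarrow> (\<forall>i<n. c i = 0))}"

lemma eigen_mult_eq: "eigen_mult N l lam = Sup (indep_sols N l lam)"
  by (simp add: eigen_mult_def indep_sols_def)

text \<open>A solution is determined by N + 1 numbers, A and the B_j. The bound is what gives
  \<open>eigen_mult\<close> a meaning, as \<open>Sup\<close> of an unbounded set of naturals says
  nothing.\<close>

lemma indep_sols_bound:
  assumes l: "l \<in> posorth N" and k: "k > 0" and N: "N > 0" and n: "n \<in> indep_sols N l (k\<^sup>2)"
  shows "n \<le> N + 1"
proof (rule ccontr)
  assume "\<not> n \<le> N + 1"
  obtain fs where fs: "\<And>i. i < n \<Longrightarrow> mandarin_sol N l (k\<^sup>2) (fs i)"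
    and ind: "\<And>c :: nat \<Rightarrow> complex. (\<forall>j<N. \<forall>t\<in>{0..l j}. (\<Sum>i<n. c i * fs i j t) = 0) \<longrightarrow> (\<forall>i<n. c i = 0)"
    using n unfolding indep_sols_def by blast
  have "\<exists>A B. i < n \<longrightarrow> agrees N l k (fs i) A B" for i
    using mandarin_sol_agrees[OF l k N fs] by metis
  then obtain A B where AB: "\<And>i. i < n \<Longrightarrow> agrees N l k (fs i) (A i) (B i)" by metis
  define v where "v = (\<lambda>i j. if j = N then A i else B i j)"
  obtain c where c: "\<exists>i<n. c i \<noteq> 0" "\<forall>j<N+1. (\<Sum>i<n. c i * v i j) = 0"
    using linear_dependence[of "N + 1" n v] \<open>\<not> n \<le> N + 1\<close> by auto
  have cA: "(\<Sum>i<n. c i * A i) = 0" using c(2)[rule_format, of N] by (simp add: v_def)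
  have cB: "(\<Sum>i<n. c i * B i j) = 0" if "j < N" for j
    using c(2)[rule_format, of j] that by (simp add: v_def)
  have "(\<Sum>i<n. c i * fs i j t) = 0" if "j < N" "t \<in> {0..l j}" for j t
  proof -
    have "(\<Sum>i<n. c i * fs i j t) =
       (\<Sum>i<n. c i * A i * of_real (cos (k * t)) + c i * B i j * of_real (sin (k * t)))"
      using AB that by (intro sum.cong) (auto simp: agrees_def edge_fun_def algebra_simps)
    also have "\<dots> = (\<Sum>i<n. c i * A i) * of_real (cos (k * t)) + (\<Sum>i<n. c i * B i j) * of_real (sin (k * t))"
      by (simp add: sum.distrib sum_distrib_right)
    finally show ?thesis using cA cB that by simp
  qed
  then show False using ind[of c] c(1) by blast
qed

lemma eigen_mult_le:
  assumes "l \<in> posorth N" "k > 0" "N > 0"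
  shows "eigen_mult N l (k\<^sup>2) \<le> N + 1"
proof -
  have "0 \<in> indep_sols N l (k\<^sup>2)" by (simp add: indep_sols_def)
  then show ?thesis
    unfolding eigen_mult_eq using indep_sols_bound[OF assms] by (intro cSup_least) auto
qed

lemma eigen_mult_ge:
  assumes "l \<in> posorth N" "k > 0" "N > 0" "n \<in> indep_sols N l (k\<^sup>2)"
  shows "n \<le> eigen_mult N l (k\<^sup>2)"
  unfolding eigen_mult_eq using indep_sols_bound[OF assms(1-3)] assms(4)
  by (intro cSup_upper) (auto simp: bdd_above_def)

lemma eigen_mult_in:
  assumes "l \<in> posorth N" "k > 0" "N > 0"
  shows "eigen_mult N l (k\<^sup>2) \<in> indep_sols N l (k\<^sup>2)"
proof -
  have "0 \<in> indep_sols N l (k\<^sup>2)" by (simp add: indep_sols_def)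
  moreover have "finite (indep_sols N l (k\<^sup>2))"
    using indep_sols_bound[OF assms] by (meson finite_nat_set_iff_bounded_le)
  ultimately show ?thesis
    unfolding eigen_mult_eq by (metis Max_in cSup_eq_Max empty_iff)
qed

lemma indep_sols_downward:
  assumes "n \<in> indep_sols N l lam" "m \<le> n"
  shows "m \<in> indep_sols N l lam"
proof -
  obtain fs where fs: "\<And>i. i < n \<Longrightarrow> mandarin_sol N l lam (fs i)"
    and ind: "\<And>c :: nat \<Rightarrow> complex. (\<forall>j<N. \<forall>t\<in>{0..l j}. (\<Sum>i<n. c i * fs i j t) = 0) \<Longrightarrow> (\<forall>i<n. c i = 0)"
    using assms(1) unfolding indep_sols_def by blast
  have "\<forall>i<m. c i = 0" if c: "\<forall>j<N. \<forall>t\<in>{0..l j}. (\<Sum>i<m. c i * fs i j t) = 0" for c :: "nat \<Rightarrow> complex"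
  proof -
    have "(\<Sum>i<n. (if i < m then c i else 0) * fs i j t) = (\<Sum>i<m. c i * fs i j t)" for j t
      using assms(2) by (intro sum.mono_neutral_cong_right) auto
    then show ?thesis using ind[of "\<lambda>i. if i < m then c i else 0"] c assms(2)
      by (metis (mono_tags, lifting) order_less_le_trans)
  qed
  moreover have "\<forall>i<m. mandarin_sol N l lam (fs i)" using fs assms(2) by simp
  ultimately show ?thesis unfolding indep_sols_def by (intro CollectI exI[of _ fs] conjI allI impI) blast+
qed

lemma one_in_indep_sols_iff:
  "1 \<in> indep_sols N l lam \<longleftrightarrow> is_eigenvalue N l lam"
proof
  assume "1 \<in> indep_sols N l lam"
  then obtain fs where fs: "mandarin_sol N l lam (fs 0)"
    and ind: "\<And>c :: nat \<Rightarrow> complex. (\<forall>j<N. \<forall>t\<in>{0..l j}. (\<Sum>i<1. c i * fs i j t) = 0) \<longrightarrow> (\<forall>i<1. c i = 0)"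
    unfolding indep_sols_def by blast
  have "\<exists>j<N. \<exists>t\<in>{0..l j}. fs 0 j t \<noteq> 0" using ind[of "\<lambda>_. 1"] by auto
  then show "is_eigenvalue N l lam" unfolding is_eigenvalue_def eigenfunction_def using fs by blast
next
  assume "is_eigenvalue N l lam"
  then obtain f where "mandarin_sol N l lam f" "\<exists>j<N. \<exists>t\<in>{0..l j}. f j t \<noteq> 0"
    unfolding is_eigenvalue_def eigenfunction_def by blast
  then show "1 \<in> indep_sols N l lam"
    unfolding indep_sols_def by (auto intro!: exI[of _ "\<lambda>_. f"])
qed

lemma two_in_indep_sols_iff:
  assumes l: "l \<in> posorth N" and k: "k > 0" and N: "N > 0"
  shows "2 \<in> indep_sols N l (k\<^sup>2) \<longleftrightarrow> (\<exists>A B A' B'. sol_par N (\<lambda>j. k * l j) A B \<and> sol_par N (\<lambda>j. k * l j) A' B' \<and>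
     (\<forall>c c'. c * A + c' * A' = 0 \<and> (\<forall>j<N. c * B j + c' * B' j = 0) \<longrightarrow> c = 0 \<and> c' = 0))" (is "_ \<longleftrightarrow> ?R")
proof
  assume "2 \<in> indep_sols N l (k\<^sup>2)"
  then obtain fs where fs: "\<And>i. i < 2 \<Longrightarrow> mandarin_sol N l (k\<^sup>2) (fs i)"
    and ind: "\<And>c :: nat \<Rightarrow> complex. (\<forall>j<N. \<forall>t\<in>{0..l j}. (\<Sum>i<2. c i * fs i j t) = 0) \<longrightarrow> (\<forall>i<2. c i = 0)"
    unfolding indep_sols_def by blast
  obtain A B where AB: "agrees N l k (fs 0) A B" "sol_par N (\<lambda>j. k * l j) A B"
    using mandarin_sol_agrees[OF l k N fs[of 0]] by auto
  obtain A' B' where AB': "agrees N l k (fs 1) A' B'" "sol_par N (\<lambda>j. k * l j) A' B'"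
    using mandarin_sol_agrees[OF l k N fs[of 1]] by auto
  have "c = 0 \<and> c' = 0" if c: "c * A + c' * A' = 0" "\<forall>j<N. c * B j + c' * B' j = 0" for c c'
  proof -
    have "(\<Sum>i<2. (if i = 0 then c else c') * fs i j t) = 0" if "j < N" "t \<in> {0..l j}" for j t
    proof -
      have "(\<Sum>i<2. (if i = 0 then c else c') * fs i j t) = c * fs 0 j t + c' * fs 1 j t"
        by (simp add: numeral_2_eq_2)
      also have "\<dots> = (c * A + c' * A') * of_real (cos (k * t)) + (c * B j + c' * B' j) * of_real (sin (k * t))"
        using AB AB' that by (simp add: agrees_def edge_fun_def algebra_simps)
      finally show ?thesis using c that by simp
    qed
    then have "\<forall>i<(2::nat). (if i = 0 then c else c') = 0" using ind[of "\<lambda>i. if i = (0::nat) then c else c'"] by blast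
    from this[rule_format, of 0] this[rule_format, of 1] show ?thesis by simp
  qed
  then show ?R using AB AB' by blast
next
  assume ?R
  then obtain A B A' B' where AB: "sol_par N (\<lambda>j. k * l j) A B" "sol_par N (\<lambda>j. k * l j) A' B'"
    and ind: "\<And>c c'. c * A + c' * A' = 0 \<and> (\<forall>j<N. c * B j + c' * B' j = 0) \<Longrightarrow> c = 0 \<and> c' = 0" by blast
  define fs where "fs = (\<lambda>i::nat. if i = 0 then edge_fun k A B else edge_fun k A' B')"
  have "mandarin_sol N l (k\<^sup>2) (fs i)" for i
    using AB agrees_mandarin_sol_iff[OF l k agrees_edge_fun] by (simp add: fs_def)
  moreover have "\<forall>i<2. c i = 0" if c: "\<forall>j<N. \<forall>t\<in>{0..l j}. (\<Sum>i<2. c i * fs i j t) = 0" for c :: "nat \<Rightarrow> complex"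
  proof -
    have "(\<Sum>i<2. c i * fs i j t) = (c 0 * A + c 1 * A') * of_real (cos (k * t)) + (c 0 * B j + c 1 * B' j) * of_real (sin (k * t))" for j t
      by (simp add: numeral_2_eq_2 fs_def edge_fun_def algebra_simps)
    then have z: "c 0 * A + c 1 * A' = 0 \<and> c 0 * B j + c 1 * B' j = 0" if "j < N" for j
      using c that edge_fun_zero_iff[of "l j" k "c 0 * A + c 1 * A'" "c 0 * B j + c 1 * B' j"] l k
      by (auto simp: posorth_def)
    then have "c 0 = 0 \<and> c 1 = 0" using ind[of "c 0" "c 1"] N by blast
    then show ?thesis by (auto simp: numeral_2_eq_2 less_Suc_eq)
  qed
  ultimately show "2 \<in> indep_sols N l (k\<^sup>2)" unfolding indep_sols_def by blast
qed

lemma simple_ev_iff: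
  assumes "l \<in> posorth N" "k > 0" "N > 0" "is_eigenvalue N l (k\<^sup>2)"
  shows "simple_ev N l (k\<^sup>2) \<longleftrightarrow> 2 \<notin> indep_sols N l (k\<^sup>2)"
proof -
  have "1 \<le> eigen_mult N l (k\<^sup>2)"
    using eigen_mult_ge[OF assms(1-3)] one_in_indep_sols_iff assms(4) by blast
  moreover have "2 \<in> indep_sols N l (k\<^sup>2) \<longleftrightarrow> 2 \<le> eigen_mult N l (k\<^sup>2)"
    using eigen_mult_ge[OF assms(1-3)] indep_sols_downward[OF eigen_mult_in[OF assms(1-3)]] by blast
  ultimately show ?thesis unfolding simple_ev_def by linarith
qed

subsection \<open>Symmetric and anti-symmetric solutions\<close>

text \<open>Half angles x = k l / 2 are used throughout. Shifting them by pi/2 exchanges the symmetric (s = 1) and the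
  anti-symmetric (s = -1) case.\<close>

definition cs :: "complex \<Rightarrow> real \<Rightarrow> real" where "cs s t = (if s = 1 then cos t else sin t)"
definition sn :: "complex \<Rightarrow> real \<Rightarrow> real" where "sn s t = (if s = 1 then sin t else - cos t)"

lemma cs_sn_squares: "(cs s t)\<^sup>2 + (sn s t)\<^sup>2 = 1"
  by (simp add: cs_def sn_def)

lemma sn_nonzero: "cs s t = 0 \<Longrightarrow> sn s t \<noteq> 0"
  using cs_sn_squares[of s t] by auto

text \<open>The edge equation is the midpoint condition: vanishing derivative for s = 1, vanishing
  value for s = -1. The sum is the derivative condition at one vertex; the other vertex follows by
  reflection.\<close>

definition sym_par :: "nat \<Rightarrow> complex \<Rightarrow> (nat \<Rightarrow> real) \<Rightarrow> complex \<Rightarrow> (nat \<Rightarrow> complex) \<Rightarrow> bool" where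
  "sym_par N s x A B \<longleftrightarrow> (\<forall>j<N. B j * of_real (cs s (x j)) = A * of_real (sn s (x j))) \<and> (\<Sum>j<N. B j) = 0"

text \<open>The matrix with rows (cos 2t, sin 2t) and (sin 2t, - cos 2t) takes the coefficients at
  one end of an edge to those at the other. It is the reflection across the line at angle t, and
  (\<open>cs s t\<close>, \<open>sn s t\<close>) spans its eigenline for s.\<close>

lemma reflection_eigen_iff:
  assumes s: "s = 1 \<or> s = -1"
  shows "b * of_real (cs s t) = a * of_real (sn s t) \<longleftrightarrow>
    a * of_real (cos (2 * t)) + b * of_real (sin (2 * t)) = s * a \<and>
    a * of_real (sin (2 * t)) - b * of_real (cos (2 * t)) = s * b" (is "?L \<longleftrightarrow> ?P \<and> ?Q")
proof -
  let ?c = "complex_of_real (cos t)" and ?s = "complex_of_real (sin t)"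
  have one: "?c * ?c + ?s * ?s = 1"
    using sin_cos_squared_add3[of t] by (metis of_real_1 of_real_add of_real_mult)
  have c2: "complex_of_real (cos (2 * t)) = ?c * ?c - ?s * ?s" "complex_of_real (sin (2 * t)) = 2 * ?s * ?c"
    by (simp_all add: cos_double sin_double power2_eq_square)
  from s show ?thesis
  proof
    assume s: "s = 1"
    have P: "?P \<longleftrightarrow> ?s * (b * ?c - a * ?s) = 0"
    proof -
      have "a * of_real (cos (2 * t)) + b * of_real (sin (2 * t)) - s * a = 2 * (?s * (b * ?c - a * ?s)) + a * ((?c * ?c + ?s * ?s) - 1)"
        unfolding c2 s by (simp add: algebra_simps)
      then show ?thesis unfolding one by (metis (no_types, opaque_lifting) add_0_right diff_self eq_iff_diff_eq_0 mult_eq_0_iff mult_zero_right zero_neq_numeral)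
    qed
    have Q: "?Q \<longleftrightarrow> ?c * (b * ?c - a * ?s) = 0"
    proof -
      have "s * b - (a * of_real (sin (2 * t)) - b * of_real (cos (2 * t))) = 2 * (?c * (b * ?c - a * ?s)) - b * ((?c * ?c + ?s * ?s) - 1)"
        unfolding c2 s by (simp add: algebra_simps)
      then show ?thesis unfolding one by (metis (no_types, opaque_lifting) diff_0_right diff_self eq_iff_diff_eq_0 mult_eq_0_iff mult_zero_right zero_neq_numeral)
    qed
    have "?c \<noteq> 0 \<or> ?s \<noteq> 0" using one by auto
    then show ?thesis unfolding P Q using s by (auto simp: cs_def sn_def)
  next
    assume s: "s = -1"
    have P: "?P \<longleftrightarrow> ?c * (b * ?s + a * ?c) = 0"
    proof -
      have "a * of_real (cos (2 * t)) + b * of_real (sin (2 * t)) - s * a = 2 * (?c * (b * ?s + a * ?c)) - a * ((?c * ?c + ?s * ?s) - 1)"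
        unfolding c2 s by (simp add: algebra_simps)
      then show ?thesis unfolding one by (metis (no_types, opaque_lifting) diff_0_right diff_self eq_iff_diff_eq_0 mult_eq_0_iff mult_zero_right zero_neq_numeral)
    qed
    have Q: "?Q \<longleftrightarrow> ?s * (b * ?s + a * ?c) = 0"
    proof -
      have "a * of_real (sin (2 * t)) - b * of_real (cos (2 * t)) - s * b = 2 * (?s * (b * ?s + a * ?c)) - b * ((?c * ?c + ?s * ?s) - 1)"
        unfolding c2 s by (simp add: algebra_simps)
      then show ?thesis unfolding one by (metis (no_types, opaque_lifting) diff_0_right diff_self eq_iff_diff_eq_0 mult_eq_0_iff mult_zero_right zero_neq_numeral)
    qed
    have "?c \<noteq> 0 \<or> ?s \<noteq> 0" using one by auto
    moreover have "?L \<longleftrightarrow> b * ?s + a * ?c = 0" using s by (auto simp: cs_def sn_def add_eq_0_iff)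
    ultimately show ?thesis unfolding P Q by auto
  qed
qed

lemma sym_par_iff:
  assumes s: "s = 1 \<or> s = -1"
  shows "sym_par N s x A B \<longleftrightarrow> sol_par N (\<lambda>j. 2 * x j) A B \<and>
    (\<forall>j<N. A * of_real (cos (2 * x j)) + B j * of_real (sin (2 * x j)) = s * A \<and>
           A * of_real (sin (2 * x j)) - B j * of_real (cos (2 * x j)) = s * B j)" (is "_ \<longleftrightarrow> _ \<and> ?T")
proof -
  have T: "?T \<longleftrightarrow> (\<forall>j<N. B j * of_real (cs s (x j)) = A * of_real (sn s (x j)))"
    using reflection_eigen_iff[OF s] by blast
  have "sol_par N (\<lambda>j. 2 * x j) A B" if t: ?T and "(\<Sum>j<N. B j) = 0"
  proof -
    have "(\<Sum>j<N. A * of_real (sin (2 * x j)) - B j * of_real (cos (2 * x j))) = (\<Sum>j<N. s * B j)"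
      using t by (intro sum.cong) auto
    then show ?thesis unfolding sol_par_def using that by (simp add: sum_distrib_left[symmetric])
  qed
  moreover have "(\<Sum>j<N. B j) = 0" if "sol_par N (\<lambda>j. 2 * x j) A B" using that by (simp add: sol_par_def)
  ultimately show ?thesis unfolding sym_par_def using T by blast
qed

text \<open>(C, D) are the coefficients of f o R, so the claim concerns f + s (f o R), twice the
  part of f of type s.\<close>

lemma sol_par_parts:
  assumes s: "s = 1 \<or> s = -1" and sol: "sol_par N (\<lambda>j. 2 * x j) A B"
    and C: "\<And>j. j < N \<Longrightarrow> C = A * of_real (cos (2 * x j)) + B j * of_real (sin (2 * x j))"
    and D: "\<And>j. D j = A * of_real (sin (2 * x j)) - B j * of_real (cos (2 * x j))"
  shows "sym_par N s x (A + s * C) (\<lambda>j. B j + s * D j)"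
  unfolding sym_par_def
proof (intro conjI allI impI)
  show "(\<Sum>j<N. B j + s * D j) = 0"
    using sol unfolding sol_par_def D by (simp add: sum.distrib sum_distrib_left[symmetric])
next
  fix j assume j: "j < N"
  let ?c = "complex_of_real (cos (2 * x j))" and ?s = "complex_of_real (sin (2 * x j))"
  have one: "?c * ?c + ?s * ?s = 1"
    using sin_cos_squared_add3[of "2 * x j"] by (metis of_real_1 of_real_add of_real_mult)
  have ss: "s * s = 1" using s by auto
  have "(A + s * C) * ?c + (B j + s * D j) * ?s = (A * ?c + B j * ?s) + s * A * (?c * ?c + ?s * ?s)"
    unfolding C[OF j] D by (simp add: algebra_simps)
  also have "\<dots> = (s * s) * C + s * A" unfolding one C[OF j] ss by simp
  finally have 1: "(A + s * C) * ?c + (B j + s * D j) * ?s = s * (A + s * C)" by (simp add: algebra_simps)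
  have "(A + s * C) * ?s - (B j + s * D j) * ?c = (A * ?s - B j * ?c) + s * B j * (?c * ?c + ?s * ?s)"
    unfolding C[OF j] D by (simp add: algebra_simps)
  also have "\<dots> = (s * s) * D j + s * B j" unfolding one D ss by simp
  finally have 2: "(A + s * C) * ?s - (B j + s * D j) * ?c = s * (B j + s * D j)" by (simp add: algebra_simps)
  show "(B j + s * D j) * of_real (cs s (x j)) = (A + s * C) * of_real (sn s (x j))"
    unfolding reflection_eigen_iff[OF s] using 1 2 by blast
qed

text \<open>Applied to the part of type -s, the hypothesis leaves f = s (f o R).\<close>

lemma sol_par_if_parts_vanish:
  assumes s: "s = 1 \<or> s = -1" and N: "N > 0" and sol: "sol_par N (\<lambda>j. 2 * x j) A B"
    and none: "\<And>A' B'. sym_par N (- s) x A' B' \<Longrightarrow> A' = 0 \<and> (\<forall>j<N. B' j = 0)"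
  shows "sym_par N s x A B"
proof -
  define C where "C = A * of_real (cos (2 * x 0)) + B 0 * of_real (sin (2 * x 0))"
  define D where "D = (\<lambda>j. A * of_real (sin (2 * x j)) - B j * of_real (cos (2 * x j)))"
  have C: "C = A * of_real (cos (2 * x j)) + B j * of_real (sin (2 * x j))" if "j < N" for j
    using sol N that unfolding C_def sol_par_def by blast
  have "sym_par N (- s) x (A + - s * C) (\<lambda>j. B j + - s * D j)"
    by (rule sol_par_parts[OF _ sol C]) (use s D_def in auto)
  from none[OF this] have z: "A = s * C" "\<And>j. j < N \<Longrightarrow> B j = s * D j" by auto
  have ss: "s * (s * w) = w" for w using s by auto
  have "C = s * A" "\<And>j. j < N \<Longrightarrow> D j = s * B j"
    using arg_cong[OF z(1), of "\<lambda>w. s * w"] arg_cong[OF z(2), of _ "\<lambda>w. s * w"] by (simp_all add: ss)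
  then show ?thesis unfolding sym_par_iff[OF s] using sol C unfolding D_def by auto
qed

lemma sym_type_iff_sym_par:
  assumes l: "l \<in> posorth N" and k: "k > 0" and s: "s = 1 \<or> s = -1"
    and ag: "agrees N l k f A B" and sol: "sol_par N (\<lambda>j. k * l j) A B"
  shows "sym_type N l s f \<longleftrightarrow> sym_par N s (\<lambda>j. k * l j / 2) A B"
proof -
  have 2: "(\<lambda>j. 2 * (k * l j / 2)) = (\<lambda>j. k * l j)" by simp
  have eq: "(\<forall>t\<in>{0..l j}. f j (l j - t) = s * f j t) \<longleftrightarrow>
      A * of_real (cos (k * l j)) + B j * of_real (sin (k * l j)) = s * A \<and>
      A * of_real (sin (k * l j)) - B j * of_real (cos (k * l j)) = s * B j" if j: "j < N" for j
  proof -
    let ?C = "A * of_real (cos (k * l j)) + B j * of_real (sin (k * l j)) - s * A"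
    let ?D = "A * of_real (sin (k * l j)) - B j * of_real (cos (k * l j)) - s * B j"
    have "f j (l j - t) - s * f j t = ?C * of_real (cos (k * t)) + ?D * of_real (sin (k * t))"
      if "t \<in> {0..l j}" for t
    proof -
      have "l j - t \<in> {0..l j}" using that by auto
      then have "f j (l j - t) = edge_fun k A B j (l j - t)" "f j t = edge_fun k A B j t"
        using ag j that by (auto simp: agrees_def)
      then show ?thesis
        by (simp add: edge_fun_def right_diff_distrib cos_diff sin_diff) (simp add: algebra_simps)
    qed
    then have "(\<forall>t\<in>{0..l j}. f j (l j - t) = s * f j t) \<longleftrightarrow>
      (\<forall>t\<in>{0..l j}. ?C * of_real (cos (k * t)) + ?D * of_real (sin (k * t)) = 0)"
      by (metis eq_iff_diff_eq_0)
    also have "\<dots> \<longleftrightarrow> ?C = 0 \<and> ?D = 0" using edge_fun_zero_iff[of "l j" k ?C ?D] l k j by (auto simp: posorth_def)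
    finally show ?thesis by simp
  qed
  have "(\<forall>j<N. \<forall>t\<in>{0..l j}. f j (l j - t) = s * f j t) \<longleftrightarrow>
     (\<forall>j<N. A * of_real (cos (k * l j)) + B j * of_real (sin (k * l j)) = s * A \<and>
      A * of_real (sin (k * l j)) - B j * of_real (cos (k * l j)) = s * B j)"
    by (rule iff_allI, rule imp_cong[OF refl], rule eq)
  then show ?thesis unfolding sym_type_def sym_par_iff[OF s] 2 using sol by simp
qed

subsection \<open>Secular functions and kernel vectors\<close>

text \<open>The equation sum sn/cs = 0, obtained by inserting B_j = A sn/cs into sum B_j = 0,
  multiplied by all cs so that it has no poles.\<close>

definition secular :: "nat \<Rightarrow> complex \<Rightarrow> (nat \<Rightarrow> real) \<Rightarrow> real" where
  "secular N s x = (\<Sum>j<N. sn s (x j) * (\<Prod>i\<in>{..<N}-{j}. cs s (x i)))"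

definition elim_a :: "nat \<Rightarrow> complex \<Rightarrow> nat \<Rightarrow> (nat \<Rightarrow> real) \<Rightarrow> real" where
  "elim_a N s p x = (\<Prod>i\<in>{..<N}-{p}. cs s (x i))"

definition elim_c :: "nat \<Rightarrow> complex \<Rightarrow> nat \<Rightarrow> (nat \<Rightarrow> real) \<Rightarrow> nat \<Rightarrow> real" where
  "elim_c N s p x j = sn s (x j) * (\<Prod>i\<in>{..<N}-{p}-{j}. cs s (x i))"

definition elim_b :: "nat \<Rightarrow> complex \<Rightarrow> nat \<Rightarrow> (nat \<Rightarrow> real) \<Rightarrow> real" where
  "elim_b N s p x = (\<Sum>j\<in>{..<N}-{p}. elim_c N s p x j)"

text \<open>Together with A = \<open>elim_a\<close> this solves the edge equations off p with
  denominators cleared, the p-th entry being forced by sum B_j = 0. No entry involves the p-th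
  angle.\<close>

definition ker_vec :: "nat \<Rightarrow> complex \<Rightarrow> nat \<Rightarrow> (nat \<Rightarrow> real) \<Rightarrow> nat \<Rightarrow> real" where
  "ker_vec N s p x j = (if j = p then - elim_b N s p x else elim_c N s p x j)"

text \<open>For p < N this is exactly the condition under which the kernel vector for p is
  nonzero.\<close>

definition nondeg :: "nat \<Rightarrow> complex \<Rightarrow> nat \<Rightarrow> (nat \<Rightarrow> real) \<Rightarrow> bool" where
  "nondeg N s p x \<longleftrightarrow> (\<forall>i<N. \<forall>j<N. i \<noteq> p \<longrightarrow> j \<noteq> p \<longrightarrow> i \<noteq> j \<longrightarrow> \<not> (cs s (x i) = 0 \<and> cs s (x j) = 0))"

text \<open>Three edges with cs = 0 carry two independent solutions with A = 0, each living on a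
  pair of edges.\<close>

definition triple_zero :: "nat \<Rightarrow> complex \<Rightarrow> (nat \<Rightarrow> real) \<Rightarrow> bool" where
  "triple_zero N s x \<longleftrightarrow> (\<exists>i<N. \<exists>j<N. \<exists>k<N. i \<noteq> j \<and> i \<noteq> k \<and> j \<noteq> k \<and> cs s (x i) = 0 \<and> cs s (x j) = 0 \<and> cs s (x k) = 0)"

lemma secular_split:
  assumes p: "p < N"
  shows "secular N s x = elim_a N s p x * sn s (x p) + elim_b N s p x * cs s (x p)"
proof -
  have "secular N s x = sn s (x p) * (\<Prod>i\<in>{..<N}-{p}. cs s (x i)) +
      (\<Sum>j\<in>{..<N}-{p}. sn s (x j) * (\<Prod>i\<in>{..<N}-{j}. cs s (x i)))"
    unfolding secular_def using p by (subst sum.remove[of _ p]) auto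
  also have "(\<Sum>j\<in>{..<N}-{p}. sn s (x j) * (\<Prod>i\<in>{..<N}-{j}. cs s (x i))) =
     (\<Sum>j\<in>{..<N}-{p}. elim_c N s p x j * cs s (x p))"
  proof (rule sum.cong[OF refl])
    fix j assume "j \<in> {..<N}-{p}"
    then have "(\<Prod>i\<in>{..<N}-{j}. cs s (x i)) = cs s (x p) * (\<Prod>i\<in>{..<N}-{j}-{p}. cs s (x i))"
      using p by (intro prod.remove) auto
    moreover have "{..<N}-{j}-{p} = {..<N}-{p}-{j}" by auto
    ultimately show "sn s (x j) * (\<Prod>i\<in>{..<N}-{j}. cs s (x i)) = elim_c N s p x j * cs s (x p)"
      by (simp add: elim_c_def)
  qed
  also have "\<dots> = elim_b N s p x * cs s (x p)" by (simp only: elim_b_def sum_distrib_right)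
  finally show ?thesis by (simp only: elim_a_def mult.commute)
qed

lemma elim_c_cs:
  assumes "j < N" "j \<noteq> p"
  shows "elim_c N s p x j * cs s (x j) = elim_a N s p x * sn s (x j)"
proof -
  have "elim_a N s p x = cs s (x j) * (\<Prod>i\<in>{..<N}-{p}-{j}. cs s (x i))"
    unfolding elim_a_def using assms by (intro prod.remove) auto
  then show ?thesis by (simp add: elim_c_def)
qed

lemma elim_c_zero_other:
  assumes "i < N" "i \<noteq> p" "i \<noteq> j" "cs s (x i) = 0"
  shows "elim_c N s p x j = 0"
  unfolding elim_c_def using assms by (auto simp: prod_zero_iff)

lemma elim_c_single:
  assumes "nondeg N s p x" "i < N" "i \<noteq> p" "cs s (x i) = 0"
  shows "elim_c N s p x i \<noteq> 0"
  unfolding elim_c_def using assms sn_nonzero[OF assms(4)] by (auto simp: prod_zero_iff nondeg_def)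

lemma elim_b_single:
  assumes "i < N" "i \<noteq> p" "cs s (x i) = 0"
  shows "elim_b N s p x = elim_c N s p x i"
proof -
  have "elim_b N s p x = elim_c N s p x i + (\<Sum>j\<in>{..<N}-{p}-{i}. elim_c N s p x j)"
    unfolding elim_b_def using assms by (intro sum.remove) auto
  also have "(\<Sum>j\<in>{..<N}-{p}-{i}. elim_c N s p x j) = 0"
    using elim_c_zero_other[of i N p _ s x] assms by (intro sum.neutral) auto
  finally show ?thesis by simp
qed

lemma elim_a_zero_iff: "elim_a N s p x = 0 \<longleftrightarrow> (\<exists>i<N. i \<noteq> p \<and> cs s (x i) = 0)"
  unfolding elim_a_def by auto

lemma nondeg_elim:
  assumes "nondeg N s p x"
  shows "elim_a N s p x \<noteq> 0 \<or> elim_b N s p x \<noteq> 0"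
proof (cases "elim_a N s p x = 0")
  case True
  then obtain i where "i < N" "i \<noteq> p" "cs s (x i) = 0" using elim_a_zero_iff by blast
  then show ?thesis using elim_b_single[of i N p s x] elim_c_single[of N s p x i] assms by simp
qed blast

lemma ker_vec_sym_par:
  assumes p: "p < N" and F: "secular N s x = 0"
  shows "sym_par N s x (of_real (elim_a N s p x)) (\<lambda>j. of_real (ker_vec N s p x j))"
proof -
  have "(\<Sum>j<N. ker_vec N s p x j) = ker_vec N s p x p + (\<Sum>j\<in>{..<N}-{p}. ker_vec N s p x j)"
    using p by (intro sum.remove) auto
  also have "(\<Sum>j\<in>{..<N}-{p}. ker_vec N s p x j) = elim_b N s p x"
    unfolding elim_b_def by (intro sum.cong) (auto simp: ker_vec_def)
  finally have "(\<Sum>j<N. ker_vec N s p x j) = 0" by (simp add: ker_vec_def)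
  moreover have "ker_vec N s p x j * cs s (x j) = elim_a N s p x * sn s (x j)" if "j < N" for j
    using elim_c_cs[OF that, of p s x] F secular_split[OF p, of s x] by (auto simp: ker_vec_def)
  ultimately show ?thesis unfolding sym_par_def
    by (simp del: of_real_mult of_real_sum add: of_real_mult[symmetric] of_real_sum[symmetric])
qed

lemma ker_vec_nonzero:
  assumes "nondeg N s p x" "p < N"
  shows "elim_a N s p x \<noteq> 0 \<or> (\<exists>j<N. ker_vec N s p x j \<noteq> 0)"
  using nondeg_elim[OF assms(1)] assms(2) by (auto simp: ker_vec_def)

text \<open>If \<open>elim_a\<close> is nonzero, every B_j off p is determined by A. Otherwise
  exactly one edge i other than p has cs = 0; then A = 0 and the solution lives on the edges i and p
  only.\<close>

lemma sym_par_unique: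
  assumes nd: "nondeg N s p x" and p: "p < N" and sol: "sym_par N s x A B"
  shows "\<exists>c. A = c * of_real (elim_a N s p x) \<and> (\<forall>j<N. B j = c * of_real (ker_vec N s p x j))"
proof -
  have eq: "B j * of_real (cs s (x j)) = A * of_real (sn s (x j))" if "j < N" for j
    using sol that by (auto simp: sym_par_def)
  have "\<exists>c. A = c * of_real (elim_a N s p x) \<and> (\<forall>j<N. j \<noteq> p \<longrightarrow> B j = c * of_real (elim_c N s p x j))"
  proof (cases "elim_a N s p x = 0")
    case False
    then have nz: "cs s (x j) \<noteq> 0" if "j < N" "j \<noteq> p" for j using elim_a_zero_iff that by blast
    define c where "c = A / of_real (elim_a N s p x)"
    have "B j = c * of_real (elim_c N s p x j)" if "j < N" "j \<noteq> p" for j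
    proof -
      have "c * of_real (elim_c N s p x j) * of_real (cs s (x j)) = c * of_real (elim_a N s p x * sn s (x j))"
        unfolding elim_c_cs[OF that, symmetric] by simp
      also have "\<dots> = B j * of_real (cs s (x j))" unfolding eq[OF that(1)] c_def using False by simp
      finally show ?thesis using nz[OF that] by simp
    qed
    moreover have "A = c * of_real (elim_a N s p x)" unfolding c_def using False by simp
    ultimately show ?thesis by blast
  next
    case True
    then obtain i where i: "i < N" "i \<noteq> p" "cs s (x i) = 0" using elim_a_zero_iff by blast
    have A: "A = 0" using eq[OF i(1)] i(3) sn_nonzero[OF i(3)] by simp
    have nz: "cs s (x j) \<noteq> 0" if "j < N" "j \<noteq> p" "j \<noteq> i" for j
      using nd i that unfolding nondeg_def by blast
    have B0: "B j = 0" if "j < N" "j \<noteq> p" "j \<noteq> i" for j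
      using eq[OF that(1)] nz[OF that] A by simp
    define c where "c = B i / of_real (elim_c N s p x i)"
    have "B j = c * of_real (elim_c N s p x j)" if "j < N" "j \<noteq> p" for j
      using elim_c_single[of N s p x i] nd B0[OF that] elim_c_zero_other[of i N p j s x] i unfolding c_def
      by (cases "j = i") auto
    then show ?thesis using A True by auto
  qed
  then obtain c where c: "A = c * of_real (elim_a N s p x)" "\<And>j. j < N \<Longrightarrow> j \<noteq> p \<Longrightarrow> B j = c * of_real (elim_c N s p x j)"
    by blast
  have "(\<Sum>j<N. B j) = B p + (\<Sum>j\<in>{..<N}-{p}. B j)" using p by (intro sum.remove) auto
  also have "(\<Sum>j\<in>{..<N}-{p}. B j) = c * of_real (elim_b N s p x)"
    unfolding elim_b_def of_real_sum sum_distrib_left using c(2) by (intro sum.cong) auto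
  finally have "B p = - (c * of_real (elim_b N s p x))"
    using sol by (simp add: sym_par_def eq_neg_iff_add_eq_0)
  then show ?thesis using c by (intro exI[of _ c]) (auto simp: ker_vec_def)
qed

text \<open>At most two coordinates have cs = 0; taking p to be one of them leaves at most
  one.\<close>

lemma exists_nondeg:
  assumes "\<not> triple_zero N s x" "N > 0"
  shows "\<exists>p<N. nondeg N s p x"
proof (cases "nondeg N s 0 x")
  case True
  then show ?thesis using assms(2) by blast
next
  case False
  then obtain i where i: "i < N" "cs s (x i) = 0" unfolding nondeg_def by blast
  then have "nondeg N s i x" using assms(1) unfolding nondeg_def triple_zero_def by blast
  then show ?thesis using i by blast
qed

lemma two_zeros_sym_par:
  assumes "i < N" "j < N" "i \<noteq> j" "cs s (x i) = 0" "cs s (x j) = 0"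
  shows "sym_par N s x 0 (\<lambda>m. if m = i then 1 else if m = j then -1 else 0)"
proof -
  have "(\<Sum>m<N. if m = i then 1 else if m = j then -1 else (0::complex)) =
    (\<Sum>m<N. (if m = i then 1 else 0) + (if m = j then -1 else 0))"
    using assms(3) by (intro sum.cong) auto
  also have "\<dots> = 0" using assms(1,2) by (simp add: sum.distrib)
  finally show ?thesis using assms(4,5) by (simp add: sym_par_def)
qed

text \<open>At a triple zero both sides hold, since every product in \<open>secular\<close> has a
  vanishing factor and two of the edges already carry a solution. Elsewhere a nondegenerate p
  exists, and the p-th edge equation for its kernel vector is the secular equation.\<close>

lemma secular_zero_iff:
  assumes N: "N > 0"
  shows "secular N s x = 0 \<longleftrightarrow> (\<exists>A B. sym_par N s x A B \<and> (A \<noteq> 0 \<or> (\<exists>j<N. B j \<noteq> 0)))"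
proof
  assume F: "secular N s x = 0"
  show "\<exists>A B. sym_par N s x A B \<and> (A \<noteq> 0 \<or> (\<exists>j<N. B j \<noteq> 0))"
  proof (cases "triple_zero N s x")
    case True
    then obtain i j where "i < N" "j < N" "i \<noteq> j" "cs s (x i) = 0" "cs s (x j) = 0"
      unfolding triple_zero_def by blast
    from two_zeros_sym_par[OF this] \<open>i < N\<close> show ?thesis
      by (intro exI[of _ 0] exI conjI) (assumption, auto)
  next
    case False
    then obtain p where p: "p < N" "nondeg N s p x" using exists_nondeg N by blast
    show ?thesis using ker_vec_sym_par[OF p(1) F] ker_vec_nonzero[OF p(2,1)]
      by (intro exI conjI) auto
  qed
next
  assume "\<exists>A B. sym_par N s x A B \<and> (A \<noteq> 0 \<or> (\<exists>j<N. B j \<noteq> 0))"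
  then obtain A B where sol: "sym_par N s x A B" and nz: "A \<noteq> 0 \<or> (\<exists>j<N. B j \<noteq> 0)" by blast
  show "secular N s x = 0"
  proof (cases "triple_zero N s x")
    case True
    then obtain i j k where ijk: "i < N" "j < N" "i \<noteq> j" "cs s (x i) = 0" "cs s (x j) = 0"
      unfolding triple_zero_def by blast
    have "(\<Prod>i\<in>{..<N}-{m}. cs s (x i)) = 0" for m
      using ijk by (cases "m = i") (auto simp: prod_zero_iff)
    then show ?thesis unfolding secular_def by (simp only: mult_zero_right sum.neutral_const)
  next
    case False
    then obtain p where p: "p < N" "nondeg N s p x" using exists_nondeg N by blast
    obtain c where c: "A = c * of_real (elim_a N s p x)" "\<And>j. j < N \<Longrightarrow> B j = c * of_real (ker_vec N s p x j)"
      using sym_par_unique[OF p(2,1) sol] by blast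
    have "c \<noteq> 0" using c nz by auto
    have "B p * of_real (cs s (x p)) = A * of_real (sn s (x p))" using sol p(1) by (simp add: sym_par_def)
    then have "c * of_real (ker_vec N s p x p * cs s (x p)) = c * of_real (elim_a N s p x * sn s (x p))"
      using c p(1) by simp
    then have "ker_vec N s p x p * cs s (x p) = elim_a N s p x * sn s (x p)"
      using \<open>c \<noteq> 0\<close> by (metis mult_cancel_left of_real_eq_iff)
    then show ?thesis unfolding secular_split[OF p(1)] by (simp add: ker_vec_def)
  qed
qed

definition multiple_locus :: "nat \<Rightarrow> (nat \<Rightarrow> real) \<Rightarrow> bool" where
  "multiple_locus N x \<longleftrightarrow> (secular N 1 x = 0 \<and> secular N (-1) x = 0) \<or> triple_zero N 1 x \<or> triple_zero N (-1) x"

lemma sym_par_sol_par: "s = 1 \<or> s = -1 \<Longrightarrow> sym_par N s x A B \<Longrightarrow> sol_par N (\<lambda>j. 2 * x j) A B"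
  using sym_par_iff by blast

lemma is_eigenvalue_iff_secular:
  assumes l: "l \<in> posorth N" and k: "k > 0" and N: "N > 0"
  shows "is_eigenvalue N l (k\<^sup>2) \<longleftrightarrow> secular N 1 (\<lambda>j. k * l j / 2) = 0 \<or> secular N (-1) (\<lambda>j. k * l j / 2) = 0"
proof -
  let ?x = "\<lambda>j. k * l j / 2"
  have 2: "(\<lambda>j. 2 * (k * l j / 2)) = (\<lambda>j. k * l j)" by simp
  show ?thesis
  proof
    assume "is_eigenvalue N l (k\<^sup>2)"
    then obtain f where f: "eigenfunction N l (k\<^sup>2) f" unfolding is_eigenvalue_def by blast
    then obtain A B where AB: "agrees N l k f A B" "sol_par N (\<lambda>j. k * l j) A B"
      using mandarin_sol_agrees[OF l k N, of f] unfolding eigenfunction_def by blast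
    have nz: "A \<noteq> 0 \<or> (\<exists>j<N. B j \<noteq> 0)" using eigenfunction_iff_sol_par[OF l k N AB(1)] f by blast
    show "secular N 1 ?x = 0 \<or> secular N (-1) ?x = 0"
    proof (rule ccontr)
      assume "\<not> ?thesis"
      then have no: "A' = 0 \<and> (\<forall>j<N. B' j = 0)" if "sym_par N s ?x A' B'" "s = 1 \<or> s = -1" for A' B' s
        using secular_zero_iff[OF N, of s ?x] that by blast
      have "sym_par N 1 ?x A B"
        using sol_par_if_parts_vanish[of 1 N ?x A B] N AB(2) no[of "-1"] unfolding 2 by auto
      then show False using no[of 1] nz by blast
    qed
  next
    assume "secular N 1 ?x = 0 \<or> secular N (-1) ?x = 0"
    then obtain s :: complex where s: "s = 1 \<or> s = -1" "secular N s ?x = 0" by blast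
    then obtain A B where "sym_par N s ?x A B" "A \<noteq> 0 \<or> (\<exists>j<N. B j \<noteq> 0)"
      using secular_zero_iff[OF N, of s ?x] by blast
    then have "eigenfunction N l (k\<^sup>2) (edge_fun k A B)"
      unfolding eigenfunction_iff_sol_par[OF l k N agrees_edge_fun] using sym_par_sol_par[of s N ?x A B] s(1) 2 by simp
    then show "is_eigenvalue N l (k\<^sup>2)" unfolding is_eigenvalue_def by blast
  qed
qed

text \<open>A double eigenvalue arises either from one solution of each type or from two of the same
  type, and the latter needs a triple zero by uniqueness of the kernel vector.\<close>

lemma two_sols_iff_multiple_locus:
  assumes l: "l \<in> posorth N" and k: "k > 0" and N: "N > 0"
  shows "2 \<in> indep_sols N l (k\<^sup>2) \<longleftrightarrow> multiple_locus N (\<lambda>j. k * l j / 2)"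
proof -
  let ?x = "\<lambda>j. k * l j / 2"
  have 2: "(\<lambda>j. 2 * (k * l j / 2)) = (\<lambda>j. k * l j)" by simp
  show ?thesis
    unfolding two_in_indep_sols_iff[OF l k N]
  proof
    assume "\<exists>A B A' B'. sol_par N (\<lambda>j. k * l j) A B \<and> sol_par N (\<lambda>j. k * l j) A' B' \<and>
     (\<forall>c c'. c * A + c' * A' = 0 \<and> (\<forall>j<N. c * B j + c' * B' j = 0) \<longrightarrow> c = 0 \<and> c' = 0)"
    then obtain A B A' B' where sol: "sol_par N (\<lambda>j. k * l j) A B" "sol_par N (\<lambda>j. k * l j) A' B'"
      and ind: "\<And>c c'. c * A + c' * A' = 0 \<Longrightarrow> (\<forall>j<N. c * B j + c' * B' j = 0) \<Longrightarrow> c = 0 \<and> c' = 0" by blast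
    show "multiple_locus N ?x"
    proof (rule ccontr)
      assume neg: "\<not> multiple_locus N ?x"
      then have "secular N (- 1) ?x \<noteq> 0 \<or> secular N (- (- 1)) ?x \<noteq> 0" unfolding multiple_locus_def by auto
      \<comment> \<open>s is a type whose opposite has no solutions, so every solution is of type
        s.\<close>
      then obtain s :: complex where s: "s = 1 \<or> s = -1" "secular N (- s) ?x \<noteq> 0" by blast
      have no: "A' = 0 \<and> (\<forall>j<N. B' j = 0)" if "sym_par N (- s) ?x A' B'" for A' B'
        using secular_zero_iff[OF N, of "- s" ?x] that s by blast
      have sym: "sym_par N s ?x A B" "sym_par N s ?x A' B'"
        using sol_par_if_parts_vanish[OF s(1) N, of ?x] sol no unfolding 2 by blast+
      have "\<not> triple_zero N s ?x" using neg s(1) unfolding multiple_locus_def by auto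
      then obtain p where p: "p < N" "nondeg N s p ?x" using exists_nondeg N by blast
      obtain c where c: "A = c * of_real (elim_a N s p ?x)" "\<And>j. j < N \<Longrightarrow> B j = c * of_real (ker_vec N s p ?x j)"
        using sym_par_unique[OF p(2,1) sym(1)] by blast
      obtain c' where c': "A' = c' * of_real (elim_a N s p ?x)" "\<And>j. j < N \<Longrightarrow> B' j = c' * of_real (ker_vec N s p ?x j)"
        using sym_par_unique[OF p(2,1) sym(2)] by blast
      have "c' = 0 \<and> - c = 0" by (rule ind) (use c c' in auto)
      then have "1 = (0::complex) \<and> 0 = (0::complex)" by (intro ind) (use c c' in auto)
      then show False by simp
    qed
  next
    assume ml: "multiple_locus N ?x"
    show "\<exists>A B A' B'. sol_par N (\<lambda>j. k * l j) A B \<and> sol_par N (\<lambda>j. k * l j) A' B' \<and>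
     (\<forall>c c'. c * A + c' * A' = 0 \<and> (\<forall>j<N. c * B j + c' * B' j = 0) \<longrightarrow> c = 0 \<and> c' = 0)"
    proof (cases "secular N 1 ?x = 0 \<and> secular N (-1) ?x = 0")
      case True
      then obtain A B A' B' where sym: "sym_par N 1 ?x A B" "A \<noteq> 0 \<or> (\<exists>j<N. B j \<noteq> 0)"
        "sym_par N (-1) ?x A' B'" "A' \<noteq> 0 \<or> (\<exists>j<N. B' j \<noteq> 0)"
        using secular_zero_iff[OF N, of 1 ?x] secular_zero_iff[OF N, of "-1" ?x] by blast
      have "c = 0 \<and> c' = 0" if c: "c * A + c' * A' = 0" "\<forall>j<N. c * B j + c' * B' j = 0" for c c'
      proof -
        have r: "A * of_real (cos (k * l j)) + B j * of_real (sin (k * l j)) = A"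
           "A * of_real (sin (k * l j)) - B j * of_real (cos (k * l j)) = B j"
           "A' * of_real (cos (k * l j)) + B' j * of_real (sin (k * l j)) = - A'"
           "A' * of_real (sin (k * l j)) - B' j * of_real (cos (k * l j)) = - B' j" if "j < N" for j
          using sym(1,3) that unfolding sym_par_iff[OF disjI1[OF refl]] sym_par_iff[OF disjI2[OF refl]] 2 by auto
        \<comment> \<open>Applying the reflection to the linear relation changes the sign of the
          anti-symmetric term only.\<close>
        have d: "c * A - c' * A' = 0" "c * B j - c' * B' j = 0" if "j < N" for j
        proof -
          let ?C = "complex_of_real (cos (k * l j))" and ?S = "complex_of_real (sin (k * l j))"
          have "c * A - c' * A' = c * (A * ?C + B j * ?S) + c' * (A' * ?C + B' j * ?S)"
            unfolding r[OF that] by simp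
          also have "\<dots> = (c * A + c' * A') * ?C + (c * B j + c' * B' j) * ?S" by (simp add: algebra_simps)
          finally show "c * A - c' * A' = 0" using c that by simp
          have "c * B j - c' * B' j = c * (A * ?S - B j * ?C) + c' * (A' * ?S - B' j * ?C)"
            unfolding r[OF that] by simp
          also have "\<dots> = (c * A + c' * A') * ?S - (c * B j + c' * B' j) * ?C" by (simp add: algebra_simps)
          finally show "c * B j - c' * B' j = 0" using c that by simp
        qed
        have z: "u = 0 \<and> v = 0" if "u + v = 0" "u - v = 0" for u v :: complex
        proof -
          have "(u + v) + (u - v) = 0" unfolding that by simp
          then have "u = 0" by simp
          then show ?thesis using that by simp
        qed
        have A: "c * A = 0 \<and> c' * A' = 0" using z c(1) d(1)[OF N] by blast
        have B: "c * B j = 0 \<and> c' * B' j = 0" if "j < N" for j using z c(2) d(2) that by blast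
        show ?thesis using A B sym(2,4) by auto
      qed
      then show ?thesis using sym_par_sol_par[OF _ sym(1)] sym_par_sol_par[OF _ sym(3)] unfolding 2 by blast
    next
      case False
      then obtain s where s: "s = 1 \<or> s = -1" and "triple_zero N s ?x"
        using ml unfolding multiple_locus_def by blast
      then obtain i j m where ijm: "i < N" "j < N" "m < N" "i \<noteq> j" "i \<noteq> m" "j \<noteq> m"
         "cs s (?x i) = 0" "cs s (?x j) = 0" "cs s (?x m) = 0" unfolding triple_zero_def by blast
      let ?B = "\<lambda>q. if q = i then 1 else if q = j then -1 else (0::complex)"
      let ?B' = "\<lambda>q. if q = i then 1 else if q = m then -1 else (0::complex)"
      have "sol_par N (\<lambda>j. k * l j) 0 ?B" "sol_par N (\<lambda>j. k * l j) 0 ?B'"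
        using sym_par_sol_par[OF s two_zeros_sym_par[of i N j s ?x]] sym_par_sol_par[OF s two_zeros_sym_par[of i N m s ?x]] ijm
        unfolding 2 by blast+
      moreover have "c = 0 \<and> c' = 0" if "\<forall>q<N. c * ?B q + c' * ?B' q = 0" for c c'
        using that[rule_format, OF ijm(2)] that[rule_format, OF ijm(3)] ijm by auto
      ultimately show ?thesis by blast
    qed
  qed
qed

section \<open>The exceptional locus\<close>

definition exp_vec :: "nat \<Rightarrow> (nat \<Rightarrow> real) \<Rightarrow> nat \<Rightarrow> complex" where
  "exp_vec N x = (\<lambda>j. if j < N then exp (\<i> * of_real (2 * x j)) else 0)"

text \<open>For a function of type s the coefficients at the far ends are C_j = s A and D_j = s B_j,
  so (A, B) determines the full trace.\<close>

definition trace_vec :: "nat \<Rightarrow> complex \<Rightarrow> complex \<Rightarrow> (nat \<Rightarrow> complex) \<Rightarrow> nat \<Rightarrow> complex" where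
  "trace_vec N s A B = (\<lambda>i. if i < 4 * N then
       (if i mod 4 = 0 then A else if i mod 4 = 1 then B (i div 4)
        else if i mod 4 = 2 then s * A else s * B (i div 4)) else 0)"

lemma expikl_eq: "expikl N l k = exp_vec N (\<lambda>j. k * l j / 2)"
proof -
  have "2 * (k * l j / 2) = k * l j" for j by simp
  then show ?thesis by (simp only: expikl_def exp_vec_def)
qed

lemma trace_vec_cong: "(\<And>j. j < N \<Longrightarrow> B j = B' j) \<Longrightarrow> trace_vec N s A B = trace_vec N s A B'"
  by (auto simp: trace_vec_def fun_eq_iff)

lemma trace_vec_scale: "trace_vec N s (u * A) (\<lambda>j. u * B j) = (\<lambda>i. u * trace_vec N s A B i)"
  by (auto simp: trace_vec_def fun_eq_iff)

lemma trk_eq_trace_vec: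
  assumes l: "l \<in> posorth N" and k: "k > 0" and s: "s = 1 \<or> s = -1"
    and ag: "agrees N l k f A B" and sym: "sym_par N s (\<lambda>j. k * l j / 2) A B"
  shows "trk N l k f = trace_vec N s A B"
proof -
  have 2: "(\<lambda>j. 2 * (k * l j / 2)) = (\<lambda>j. k * l j)" by simp
  have "f j 0 = A" "edge_deriv l f j 0 / of_real k = B j" "f j (l j) = s * A"
    "- edge_deriv l f j (l j) / of_real k = s * B j" if j: "j < N" for j
  proof -
    have lj: "0 \<in> {0..l j}" "l j \<in> {0..l j}" using l j by (auto simp: posorth_def less_imp_le)
    have r: "A * of_real (cos (k * l j)) + B j * of_real (sin (k * l j)) = s * A"
        "A * of_real (sin (k * l j)) - B j * of_real (cos (k * l j)) = s * B j"
      using sym j unfolding sym_par_iff[OF s] 2 by auto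
    show "f j 0 = A" using ag j lj by (simp add: agrees_def edge_fun_def)
    show "f j (l j) = s * A" using ag j lj r by (simp add: agrees_def edge_fun_def)
    show "edge_deriv l f j 0 / of_real k = B j"
      using agrees_edge_deriv[OF l ag j lj(1)] k by simp
    show "- edge_deriv l f j (l j) / of_real k = s * B j"
      using agrees_edge_deriv[OF l ag j lj(2)] k r(2) by simp
  qed
  moreover have "i div 4 < N" if "i < 4 * N" for i using that by (simp add: less_mult_imp_div_less mult.commute)
  ultimately show ?thesis by (auto simp: trk_def trace_vec_def fun_eq_iff Let_def)
qed

lemma poly_eval_scale:
  assumes "homog_poly N c d"
  shows "poly_eval N c z (\<lambda>i. u * w i) = u ^ d * poly_eval N c z w"
  unfolding poly_eval_def sum_distrib_left
proof (rule sum.cong[OF refl])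
  fix m assume m: "m \<in> {m. c m \<noteq> 0}"
  have "(\<Sum>i<4 * N. snd m i) = d" using assms m unfolding homog_poly_def by (cases m) auto
  then have "(\<Prod>i<4 * N. (u * w i) ^ snd m i) = u ^ d * (\<Prod>i<4 * N. w i ^ snd m i)"
    by (simp add: power_mult_distrib prod.distrib power_sum[symmetric])
  then show "c m * (\<Prod>i<N. z i ^ fst m i) * (\<Prod>i<4 * N. (u * w i) ^ snd m i) =
    u ^ d * (c m * (\<Prod>i<N. z i ^ fst m i) * (\<Prod>i<4 * N. w i ^ snd m i))"
    by simp
qed

definition ker_trace :: "nat \<Rightarrow> complex \<Rightarrow> nat \<Rightarrow> (nat \<Rightarrow> real) \<Rightarrow> nat \<Rightarrow> complex" where
  "ker_trace N s p x = trace_vec N s (of_real (elim_a N s p x)) (\<lambda>j. of_real (ker_vec N s p x j))"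

definition ker_value :: "nat \<Rightarrow> ((nat \<Rightarrow> nat) \<times> (nat \<Rightarrow> nat) \<Rightarrow> complex) \<Rightarrow> complex \<Rightarrow> nat \<Rightarrow> (nat \<Rightarrow> real) \<Rightarrow> complex" where
  "ker_value N c s p x = poly_eval N c (exp_vec N x) (ker_trace N s p x)"

text \<open>Asking for all p at once avoids choosing a nondegenerate index and keeps the locus a
  finite union of analytic systems. Off the triple zeros every kernel vector is a multiple of the
  eigenfunction of type s, so the condition says that q vanishes on it.\<close>

definition bad_locus :: "nat \<Rightarrow> ((nat \<Rightarrow> nat) \<times> (nat \<Rightarrow> nat) \<Rightarrow> complex) \<Rightarrow> complex \<Rightarrow> (nat \<Rightarrow> real) \<Rightarrow> bool" where
  "bad_locus N c s x \<longleftrightarrow> multiple_locus N x \<or> (secular N s x = 0 \<and> (\<forall>p<N. ker_value N c s p x = 0))"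

lemma sym_par_proportional:
  assumes "\<not> triple_zero N s x" "N > 0" "sym_par N s x A B" "A \<noteq> 0 \<or> (\<exists>j<N. B j \<noteq> 0)" "sym_par N s x A' B'"
  shows "\<exists>u. A' = u * A \<and> (\<forall>j<N. B' j = u * B j)"
proof -
  obtain p where p: "p < N" "nondeg N s p x" using exists_nondeg assms(1,2) by blast
  obtain c where c: "A = c * of_real (elim_a N s p x)" "\<And>j. j < N \<Longrightarrow> B j = c * of_real (ker_vec N s p x j)"
    using sym_par_unique[OF p(2,1) assms(3)] by blast
  obtain c' where c': "A' = c' * of_real (elim_a N s p x)" "\<And>j. j < N \<Longrightarrow> B' j = c' * of_real (ker_vec N s p x j)"
    using sym_par_unique[OF p(2,1) assms(5)] by blast
  have "c \<noteq> 0" using c assms(4) by auto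
  then show ?thesis using c c' by (intro exI[of _ "c' / c"]) auto
qed

lemma poly_eval_proportional:
  assumes h: "homog_poly N c d" and "\<not> triple_zero N s x" "N > 0" "sym_par N s x A B"
    "A \<noteq> 0 \<or> (\<exists>j<N. B j \<noteq> 0)" "sym_par N s x A' B'"
  shows "\<exists>u. poly_eval N c z (trace_vec N s A' B') = u * poly_eval N c z (trace_vec N s A B)"
proof -
  obtain u where u: "A' = u * A" "\<And>j. j < N \<Longrightarrow> B' j = u * B j"
    using sym_par_proportional[OF assms(2-)] by blast
  have "trace_vec N s A' B' = trace_vec N s (u * A) (\<lambda>j. u * B j)"
    unfolding u(1) by (rule trace_vec_cong) (rule u(2))
  then show ?thesis unfolding trace_vec_scale using poly_eval_scale[OF h] by auto
qed

text \<open>Here eigenfunctions leave the argument and only equations in half angles remain. For a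
  simple eigenvalue the eigenfunctions of type s are proportional, so homogeneity lets kernel
  vectors stand for f.\<close>

lemma not_prop_q_iff_bad_locus:
  assumes l: "l \<in> posorth N" and k: "k > 0" and N: "N > 0" and s: "s = 1 \<or> s = -1" and h: "homog_poly N c d"
  shows "(\<exists>f. eigenfunction N l (k\<^sup>2) f \<and> \<not> prop_q N c s l k f) \<longleftrightarrow> bad_locus N c s (\<lambda>j. k * l j / 2)"
proof -
  let ?x = "\<lambda>j. k * l j / 2"
  have 2: "(\<lambda>j. 2 * (k * l j / 2)) = (\<lambda>j. k * l j)" by simp
  show ?thesis
  proof
    assume "\<exists>f. eigenfunction N l (k\<^sup>2) f \<and> \<not> prop_q N c s l k f"
    then obtain f where f: "eigenfunction N l (k\<^sup>2) f" "\<not> prop_q N c s l k f" by blast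
    have ev: "is_eigenvalue N l (k\<^sup>2)" using f(1) unfolding is_eigenvalue_def by blast
    show "bad_locus N c s ?x"
    proof (cases "multiple_locus N ?x")
      case False
      have simple: "simple_ev N l (k\<^sup>2)"
        unfolding simple_ev_iff[OF l k N ev] two_sols_iff_multiple_locus[OF l k N] by (rule False)
      with f(2) have sym: "sym_type N l s f" and q: "poly_eval N c (expikl N l k) (trk N l k f) = 0"
        unfolding prop_q_def by auto
      obtain A B where AB: "agrees N l k f A B" "sol_par N (\<lambda>j. k * l j) A B"
        using mandarin_sol_agrees[OF l k N, of f] f(1) unfolding eigenfunction_def by blast
      have nz: "A \<noteq> 0 \<or> (\<exists>j<N. B j \<noteq> 0)" using eigenfunction_iff_sol_par[OF l k N AB(1)] f(1) by blast
      have sp: "sym_par N s ?x A B" using sym_type_iff_sym_par[OF l k s AB] sym by blast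
      have F: "secular N s ?x = 0" using secular_zero_iff[OF N, of s ?x] sp nz by blast
      have nt: "\<not> triple_zero N s ?x" using False s unfolding multiple_locus_def by auto
      have "ker_value N c s p ?x = 0" if "p < N" for p
        using poly_eval_proportional[OF h nt N sp nz ker_vec_sym_par[OF that F], of "exp_vec N ?x"] q
        unfolding ker_value_def ker_trace_def expikl_eq trk_eq_trace_vec[OF l k s AB(1) sp] by auto
      then show ?thesis unfolding bad_locus_def using F by blast
    qed (simp add: bad_locus_def)
  next
    assume bad: "bad_locus N c s ?x"
    show "\<exists>f. eigenfunction N l (k\<^sup>2) f \<and> \<not> prop_q N c s l k f"
    proof (cases "multiple_locus N ?x")
      case True
      then have two: "2 \<in> indep_sols N l (k\<^sup>2)" using two_sols_iff_multiple_locus[OF l k N] by blast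
      then have "1 \<in> indep_sols N l (k\<^sup>2)" by (rule indep_sols_downward) simp
      then have ev: "is_eigenvalue N l (k\<^sup>2)" using one_in_indep_sols_iff by blast
      then obtain f where "eigenfunction N l (k\<^sup>2) f" unfolding is_eigenvalue_def by blast
      moreover have "\<not> simple_ev N l (k\<^sup>2)" using simple_ev_iff[OF l k N ev] two by blast
      ultimately show ?thesis unfolding prop_q_def by blast
    next
      case False
      then have F: "secular N s ?x = 0" and q: "\<And>p. p < N \<Longrightarrow> ker_value N c s p ?x = 0"
        using bad unfolding bad_locus_def by auto
      have nt: "\<not> triple_zero N s ?x" using False s unfolding multiple_locus_def by auto
      then obtain p where p: "p < N" "nondeg N s p ?x" using exists_nondeg N by blast
      let ?A = "complex_of_real (elim_a N s p ?x)" and ?B = "\<lambda>j. complex_of_real (ker_vec N s p ?x j)"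
      have sp: "sym_par N s ?x ?A ?B" by (rule ker_vec_sym_par[OF p(1) F])
      have sol: "sol_par N (\<lambda>j. k * l j) ?A ?B" using sym_par_sol_par[OF s sp] unfolding 2 .
      have "?A \<noteq> 0 \<or> (\<exists>j<N. ?B j \<noteq> 0)" using ker_vec_nonzero[OF p(2,1)] by simp
      then have "eigenfunction N l (k\<^sup>2) (edge_fun k ?A ?B)"
        unfolding eigenfunction_iff_sol_par[OF l k N agrees_edge_fun] using sol by blast
      moreover have "sym_type N l s (edge_fun k ?A ?B)"
        using sym_type_iff_sym_par[OF l k s agrees_edge_fun sol] sp by blast
      moreover have "poly_eval N c (expikl N l k) (trk N l k (edge_fun k ?A ?B)) = 0"
        using q[OF p(1)] unfolding expikl_eq trk_eq_trace_vec[OF l k s agrees_edge_fun sp] ker_value_def ker_trace_def .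
      ultimately show ?thesis unfolding prop_q_def by blast
    qed
  qed
qed

text \<open>Simplicity excludes triple zeros and hence provides a nondegenerate p. Since f is a
  multiple of that kernel vector, q cannot vanish on the latter.\<close>

lemma witness_ker_value:
  assumes l: "l \<in> posorth N" and k: "k > 0" and N: "N > 0" and s: "s = 1 \<or> s = -1" and h: "homog_poly N c d"
    and f: "eigenfunction N l (k\<^sup>2) f" and simple: "simple_ev N l (k\<^sup>2)" and sym: "sym_type N l s f"
    and q: "poly_eval N c (expikl N l k) (trk N l k f) \<noteq> 0"
  shows "\<exists>p<N. \<exists>x. nondeg N s p x \<and> secular N s x = 0 \<and> ker_value N c s p x \<noteq> 0"
proof -
  let ?x = "\<lambda>j. k * l j / 2"
  have ev: "is_eigenvalue N l (k\<^sup>2)" using f unfolding is_eigenvalue_def by blast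
  obtain A B where AB: "agrees N l k f A B" "sol_par N (\<lambda>j. k * l j) A B"
    using mandarin_sol_agrees[OF l k N, of f] f unfolding eigenfunction_def by blast
  have nz: "A \<noteq> 0 \<or> (\<exists>j<N. B j \<noteq> 0)" using eigenfunction_iff_sol_par[OF l k N AB(1)] f by blast
  have sp: "sym_par N s ?x A B" using sym_type_iff_sym_par[OF l k s AB] sym by blast
  have F: "secular N s ?x = 0" using secular_zero_iff[OF N, of s ?x] sp nz by blast
  have "\<not> multiple_locus N ?x"
    using simple unfolding simple_ev_iff[OF l k N ev] two_sols_iff_multiple_locus[OF l k N] .
  then have nt: "\<not> triple_zero N s ?x" using s unfolding multiple_locus_def by auto
  then obtain p where p: "p < N" "nondeg N s p ?x" using exists_nondeg N by blast
  have "complex_of_real (elim_a N s p ?x) \<noteq> 0 \<or> (\<exists>j<N. complex_of_real (ker_vec N s p ?x j) \<noteq> 0)"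
    using ker_vec_nonzero[OF p(2,1)] by simp
  from poly_eval_proportional[OF h nt N ker_vec_sym_par[OF p(1) F] this sp, of "exp_vec N ?x"] q
  have "ker_value N c s p ?x \<noteq> 0"
    unfolding ker_value_def ker_trace_def expikl_eq trk_eq_trace_vec[OF l k s AB(1) sp] by auto
  then show ?thesis using p F by blast
qed

subsection \<open>Elimination of one edge\<close>

text \<open>On the secular variety the p-th exponential is s (a - i b) / (a + i b) with a, b independent of the p-th
  coordinate; the power of a + i b clears denominators.\<close>

definition elim_poly :: "nat \<Rightarrow> ((nat \<Rightarrow> nat) \<times> (nat \<Rightarrow> nat) \<Rightarrow> complex) \<Rightarrow> complex \<Rightarrow> nat \<Rightarrow> (nat \<Rightarrow> real) \<Rightarrow> complex" where
  "elim_poly N c s p x = (\<Sum>m\<in>{m. c m \<noteq> 0}. c m * (\<Prod>i\<in>{..<N}-{p}. exp_vec N x i ^ fst m i) *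
     ((s * (of_real (elim_a N s p x) - \<i> * of_real (elim_b N s p x))) ^ fst m p *
      (of_real (elim_a N s p x) + \<i> * of_real (elim_b N s p x)) ^ ((\<Sum>m\<in>{m. c m \<noteq> 0}. fst m p) - fst m p)) *
     (\<Prod>i<4 * N. ker_trace N s p x i ^ snd m i))"

lemma exp_on_secular:
  assumes s: "s = 1 \<or> s = -1" and p: "p < N" and F: "secular N s x = 0"
  shows "exp_vec N x p * (of_real (elim_a N s p x) + \<i> * of_real (elim_b N s p x)) =
     s * (of_real (elim_a N s p x) - \<i> * of_real (elim_b N s p x))"
proof -
  define a b C S where "a = elim_a N s p x" "b = elim_b N s p x" "C = cs s (x p)" "S = sn s (x p)"
  \<comment> \<open>For s = -1 the number \<open>cs\<close> + i \<open>sn\<close> is - i e^(i x),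
    which produces the sign s after squaring.\<close>
  have E: "exp_vec N x p = s * (of_real C + \<i> * of_real S)\<^sup>2"
  proof -
    have "exp_vec N x p = (exp (\<i> * of_real (x p)))\<^sup>2"
      using p by (simp add: exp_vec_def power2_eq_square exp_add[symmetric] mult.left_commute)
    also have "exp (\<i> * of_real (x p)) = of_real (cos (x p)) + \<i> * of_real (sin (x p))"
      by (simp add: exp_Euler cos_of_real sin_of_real)
    finally show ?thesis using s unfolding a_b_C_S_def
      by (auto simp: cs_def sn_def power2_eq_square algebra_simps)
  qed
  have lin: "a * S = - (b * C)" using F secular_split[OF p, of s x] unfolding a_b_C_S_def by linarith
  have one: "C * C + S * S = 1" using cs_sn_squares[of s "x p"] unfolding a_b_C_S_def by (simp add: power2_eq_square)
  have re: "C * (a * C - b * S) = a"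
  proof -
    have "C * (a * C - b * S) = a * (C * C) + (- (b * C)) * S" by (simp add: algebra_simps)
    also have "\<dots> = a * (C * C + S * S)" unfolding lin[symmetric] by (simp add: algebra_simps)
    finally show ?thesis unfolding one by simp
  qed
  have im: "S * (a * C - b * S) = - b"
  proof -
    have "S * (a * C - b * S) = (a * S) * C - b * (S * S)" by (simp add: algebra_simps)
    also have "\<dots> = - b * (C * C + S * S)" unfolding lin by (simp add: algebra_simps)
    finally show ?thesis unfolding one by simp
  qed
  have "(of_real C + \<i> * of_real S)\<^sup>2 * (of_real a + \<i> * of_real b) =
     (of_real C + \<i> * of_real S) * (of_real (a * C - b * S) + \<i> * of_real (a * S + b * C))"
    by (simp add: power2_eq_square algebra_simps)
  also have "\<dots> = of_real (C * (a * C - b * S)) + \<i> * of_real (S * (a * C - b * S))"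
    unfolding lin by (simp add: algebra_simps)
  also have "\<dots> = of_real a - \<i> * of_real b" unfolding re im by simp
  finally show ?thesis unfolding E a_b_C_S_def(1,2)[symmetric] by (simp add: mult.assoc)
qed

lemma elim_poly_eq:
  assumes s: "s = 1 \<or> s = -1" and p: "p < N" and F: "secular N s x = 0" and h: "homog_poly N c d"
  shows "elim_poly N c s p x =
    (of_real (elim_a N s p x) + \<i> * of_real (elim_b N s p x)) ^ (\<Sum>m\<in>{m. c m \<noteq> 0}. fst m p) * ker_value N c s p x"
  unfolding elim_poly_def ker_value_def poly_eval_def sum_distrib_left
proof (rule sum.cong[OF refl])
  fix m assume m: "m \<in> {m. c m \<noteq> 0}"
  \<comment> \<open>The sum of all exponents of the p-th variable is a convenient common upper bound
    for them.\<close>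
  let ?D = "\<Sum>m\<in>{m. c m \<noteq> 0}. fst m p"
  let ?w = "of_real (elim_a N s p x) + \<i> * of_real (elim_b N s p x)"
  have le: "fst m p \<le> ?D"
    using m h by (intro member_le_sum) (auto simp: homog_poly_def)
  have "(s * (of_real (elim_a N s p x) - \<i> * of_real (elim_b N s p x))) ^ fst m p * ?w ^ (?D - fst m p) =
      exp_vec N x p ^ fst m p * (?w ^ fst m p * ?w ^ (?D - fst m p))"
    unfolding exp_on_secular[OF s p F, symmetric] by (simp add: power_mult_distrib mult.assoc)
  also have "\<dots> = exp_vec N x p ^ fst m p * ?w ^ ?D" using le by (simp add: power_add[symmetric])
  finally have e: "(s * (of_real (elim_a N s p x) - \<i> * of_real (elim_b N s p x))) ^ fst m p * ?w ^ (?D - fst m p) =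
      exp_vec N x p ^ fst m p * ?w ^ ?D" .
  have "(\<Prod>i<N. exp_vec N x i ^ fst m i) = exp_vec N x p ^ fst m p * (\<Prod>i\<in>{..<N}-{p}. exp_vec N x i ^ fst m i)"
    using p by (intro prod.remove) auto
  then show "c m * (\<Prod>i\<in>{..<N}-{p}. exp_vec N x i ^ fst m i) *
     ((s * (of_real (elim_a N s p x) - \<i> * of_real (elim_b N s p x))) ^ fst m p * ?w ^ (?D - fst m p)) *
     (\<Prod>i<4 * N. ker_trace N s p x i ^ snd m i) =
     ?w ^ ?D * (c m * (\<Prod>i<N. exp_vec N x i ^ fst m i) * (\<Prod>i<4 * N. ker_trace N s p x i ^ snd m i))"
    unfolding e by (simp add: mult.assoc mult.left_commute)
qed

lemma elim_weight_nonzero: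
  assumes "nondeg N s p x"
  shows "complex_of_real (elim_a N s p x) + \<i> * of_real (elim_b N s p x) \<noteq> 0"
  using nondeg_elim[OF assms] by (simp add: complex_eq_iff)

text \<open>Both secular equations are linear in the sine and cosine of the p-th angle; this is
  minus the determinant of that system, so a common solution forces it to vanish.\<close>

definition resultant :: "nat \<Rightarrow> nat \<Rightarrow> (nat \<Rightarrow> real) \<Rightarrow> real" where
  "resultant N p x = elim_a N 1 p x * elim_a N (-1) p x + elim_b N 1 p x * elim_b N (-1) p x"

lemma resultant_zero:
  assumes p: "p < N" and "secular N 1 x = 0" "secular N (-1) x = 0"
  shows "resultant N p x = 0"
proof -
  define a b a' b' C S where "a = elim_a N 1 p x" "b = elim_b N 1 p x" "a' = elim_a N (-1) p x" "b' = elim_b N (-1) p x"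
    "C = cos (x p)" "S = sin (x p)"
  note d = this
  have 1: "a * S + b * C = 0" using assms(2) secular_split[OF p, of 1 x] unfolding d by (simp add: cs_def sn_def)
  have 2: "b' * S - a' * C = 0" using assms(3) secular_split[OF p, of "-1" x] unfolding d by (simp add: cs_def sn_def)
  have "(a * a' + b * b') * S = a' * (a * S + b * C) + b * (b' * S - a' * C)" by (simp add: algebra_simps)
  moreover have "(a * a' + b * b') * C = b' * (a * S + b * C) - a * (b' * S - a' * C)" by (simp add: algebra_simps)
  ultimately have "(a * a' + b * b') * S = 0" "(a * a' + b * b') * C = 0" unfolding 1 2 by auto
  moreover have "S \<noteq> 0 \<or> C \<noteq> 0" unfolding d by (metis sin_zero_abs_cos_one abs_0 zero_neq_one)
  ultimately show ?thesis unfolding resultant_def d[symmetric] by auto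
qed

text \<open>With r = sqrt 2 / 2 the value at this point is r^(2 (N - 1)) (1 - (N - 1)^2). For N = 2
  the resultant vanishes identically.\<close>

lemma resultant_nonzero:
  assumes N: "3 \<le> N" and p: "p < N"
  shows "resultant N p (\<lambda>_. pi / 4) \<noteq> 0"
proof -
  define r :: real where "r = sqrt 2 / 2"
  have r: "r > 0" by (simp add: r_def)
  have card1: "card ({..<N} - {p}) = N - 1" using p by simp
  have card2: "card ({..<N} - {p} - {j}) = N - 2" if "j \<in> {..<N} - {p}" for j
    using that p by (simp add: card_Diff_singleton)
  have csn: "cs 1 (pi/4) = r" "cs (-1) (pi/4) = r" "sn 1 (pi/4) = r" "sn (-1) (pi/4) = - r"
    by (simp_all add: cs_def sn_def r_def cos_45 sin_45)
  have a: "elim_a N 1 p (\<lambda>_. pi / 4) = r ^ (N - 1)" "elim_a N (-1) p (\<lambda>_. pi / 4) = r ^ (N - 1)"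
    by (simp_all add: elim_a_def csn card1)
  have rr: "r * r ^ (N - 2) = r ^ (N - 1)" using N by (simp add: power_Suc[symmetric] Suc_diff_le numeral_2_eq_2 Suc_diff_Suc del: power_Suc)
  have "elim_b N 1 p (\<lambda>_. pi / 4) = (\<Sum>j\<in>{..<N}-{p}. r * r ^ (N - 2))"
    unfolding elim_b_def elim_c_def by (rule sum.cong[OF refl]) (simp only: csn prod_constant card2)
  then have b1: "elim_b N 1 p (\<lambda>_. pi / 4) = real (N - 1) * r ^ (N - 1)" by (simp add: card1 rr)
  have "elim_b N (-1) p (\<lambda>_. pi / 4) = (\<Sum>j\<in>{..<N}-{p}. - (r * r ^ (N - 2)))"
    unfolding elim_b_def elim_c_def
    by (rule sum.cong[OF refl]) (simp only: csn prod_constant card2 mult_minus_left)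
  then have b2: "elim_b N (-1) p (\<lambda>_. pi / 4) = - (real (N - 1) * r ^ (N - 1))" by (simp add: card1 rr)
  have "resultant N p (\<lambda>_. pi / 4) = (r ^ (N - 1))\<^sup>2 * (1 - (real (N - 1))\<^sup>2)"
    unfolding resultant_def a b1 b2 by (simp add: power2_eq_square algebra_simps)
  moreover have "(real (N - 1))\<^sup>2 > 1"
  proof -
    have "real (N - 1) \<ge> 2" using N by simp
    then have "(real (N - 1))\<^sup>2 \<ge> 2\<^sup>2" by (intro power_mono) auto
    then show ?thesis by simp
  qed
  ultimately show ?thesis using r by simp
qed

text \<open>The function Z: one factor detects q = 0 on the kernel vector, the other a coincidence
  of a symmetric with an anti-symmetric eigenvalue.\<close>

definition bad_poly :: "nat \<Rightarrow> ((nat \<Rightarrow> nat) \<times> (nat \<Rightarrow> nat) \<Rightarrow> complex) \<Rightarrow> complex \<Rightarrow> nat \<Rightarrow> (nat \<Rightarrow> real) \<Rightarrow> complex" where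
  "bad_poly N c s p x = elim_poly N c s p x * of_real (resultant N p x)"

lemma nondeg_not_triple_zero: "nondeg N s p x \<Longrightarrow> \<not> triple_zero N s x"
  unfolding nondeg_def triple_zero_def by metis

text \<open>Nondegeneracy excludes triple zeros, so a multiple eigenvalue makes both secular
  functions vanish and with them the resultant. A simple one must be bad through q, which kills the
  other factor.\<close>

lemma bad_locus_nondeg:
  assumes s: "s = 1 \<or> s = -1" and p: "p < N" and h: "homog_poly N c d"
    and bad: "bad_locus N c s x" and nd: "nondeg N 1 p x" "nondeg N (-1) p x"
  shows "bad_poly N c s p x = 0 \<and> (secular N 1 x = 0 \<or> secular N (-1) x = 0)"
proof (cases "multiple_locus N x")
  case True
  then have "secular N 1 x = 0" "secular N (-1) x = 0"
    using nd nondeg_not_triple_zero unfolding multiple_locus_def by blast+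
  then show ?thesis using resultant_zero[OF p] by (simp add: bad_poly_def)
next
  case False
  then have F: "secular N s x = 0" "ker_value N c s p x = 0" using bad p unfolding bad_locus_def by auto
  then have "elim_poly N c s p x = 0" unfolding elim_poly_eq[OF s p F(1) h] by simp
  then show ?thesis using F s by (auto simp: bad_poly_def)
qed

section \<open>Independence of the elimination data from the p-th angle\<close>

lemma trig_poly_cs: "j \<in> J \<Longrightarrow> trig_poly J (\<lambda>x. of_real (cs s (x j)))"
  unfolding cs_def by (cases "s = 1") (auto intro: trig_poly_cos trig_poly_sin)

lemma trig_poly_sn: "j \<in> J \<Longrightarrow> trig_poly J (\<lambda>x. of_real (sn s (x j)))"
  unfolding sn_def by (cases "s = 1") (auto intro: trig_poly_cos trig_poly_sin trig_poly_uminus)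

lemma trig_poly_secular: "trig_poly {..<N} (\<lambda>x. of_real (secular N s x))"
  unfolding secular_def of_real_sum of_real_mult of_real_prod
  by (intro trig_poly_intros trig_poly_cs trig_poly_sn) auto

lemma trig_poly_elim_a: "trig_poly ({..<N}-{p}) (\<lambda>x. of_real (elim_a N s p x))"
  unfolding elim_a_def of_real_prod by (intro trig_poly_intros trig_poly_cs)

lemma trig_poly_elim_c: "j < N \<Longrightarrow> j \<noteq> p \<Longrightarrow> trig_poly ({..<N}-{p}) (\<lambda>x. of_real (elim_c N s p x j))"
  unfolding elim_c_def of_real_prod of_real_mult by (intro trig_poly_intros trig_poly_cs trig_poly_sn) auto

lemma trig_poly_elim_b: "trig_poly ({..<N}-{p}) (\<lambda>x. of_real (elim_b N s p x))"
  unfolding elim_b_def of_real_sum by (intro trig_poly_intros trig_poly_elim_c) auto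

lemma trig_poly_ker_vec: "j < N \<Longrightarrow> trig_poly ({..<N}-{p}) (\<lambda>x. of_real (ker_vec N s p x j))"
  unfolding ker_vec_def
  by (cases "j = p") (auto intro: trig_poly_elim_c trig_poly_elim_b trig_poly_uminus)

lemma trig_poly_exp_vec: "(j < N \<Longrightarrow> j \<in> J) \<Longrightarrow> trig_poly J (\<lambda>x. exp_vec N x j)"
proof (cases "j < N")
  case True
  assume "j < N \<Longrightarrow> j \<in> J"
  then have "trig_poly J (\<lambda>x. exp (\<i> * of_real (x j)) * exp (\<i> * of_real (x j)))"
    using True by (intro trig_poly_mult trig_poly_exp) auto
  then show ?thesis using True by (simp add: exp_vec_def exp_add[symmetric] mult.left_commute)
qed (simp add: exp_vec_def trig_poly_const)

lemma trig_poly_ker_trace: "trig_poly ({..<N}-{p}) (\<lambda>x. ker_trace N s p x i)"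
proof (cases "i < 4 * N")
  case True
  then have "i div 4 < N" by (simp add: less_mult_imp_div_less mult.commute)
  then show ?thesis using True unfolding ker_trace_def trace_vec_def
    by (cases "i mod 4 = 0"; cases "i mod 4 = 1"; cases "i mod 4 = 2")
      (auto intro: trig_poly_elim_a trig_poly_ker_vec trig_poly_mult trig_poly_const)
qed (simp add: ker_trace_def trace_vec_def trig_poly_const)

lemma trig_poly_ker_value: "trig_poly {..<N} (\<lambda>x. ker_value N c s p x)"
  unfolding ker_value_def poly_eval_def
  by (intro trig_poly_intros trig_poly_exp_vec trig_poly_mono[OF trig_poly_ker_trace]) auto

lemma trig_poly_bad_poly: "trig_poly ({..<N}-{p}) (\<lambda>x. bad_poly N c s p x)"
  unfolding bad_poly_def elim_poly_def resultant_def of_real_add of_real_mult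
  by (intro trig_poly_intros trig_poly_exp_vec trig_poly_ker_trace trig_poly_elim_a trig_poly_elim_b) auto

text \<open>The two factors are nonzero at different points: at the witness, where nondegeneracy
  keeps the weight a + i b away from 0, and at the point with all angles pi/4.\<close>

lemma bad_poly_nonzero:
  assumes s: "s = 1 \<or> s = -1" and N: "3 \<le> N" and h: "homog_poly N c d" and p: "p < N"
    and w: "nondeg N s p x" "secular N s x = 0" "ker_value N c s p x \<noteq> 0"
  shows "\<exists>y. bad_poly N c s p y \<noteq> 0"
proof -
  have 1: "elim_poly N c s p x \<noteq> 0"
    unfolding elim_poly_eq[OF s p w(2) h] using elim_weight_nonzero[OF w(1)] w(3) by simp
  have 2: "trig_poly ({..<N}-{p}) (\<lambda>x. elim_poly N c s p x)"
    unfolding elim_poly_def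
    by (intro trig_poly_intros trig_poly_exp_vec trig_poly_ker_trace trig_poly_elim_a trig_poly_elim_b) auto
  have 3: "trig_poly ({..<N}-{p}) (\<lambda>x. of_real (resultant N p x))"
    unfolding resultant_def of_real_add of_real_mult
    by (intro trig_poly_intros trig_poly_elim_a trig_poly_elim_b)
  have 4: "complex_of_real (resultant N p (\<lambda>_. pi / 4)) \<noteq> 0" using resultant_nonzero[OF N p] by simp
  show ?thesis unfolding bad_poly_def by (rule trig_poly_mult_nonzero[OF 2 3 1 4])
qed

section \<open>Closed subanalytic pieces of the exceptional set\<close>

abbreviation multi_indices :: "nat \<Rightarrow> (nat \<Rightarrow> nat) set" where
  "multi_indices n \<equiv> {\<alpha>. \<forall>i\<ge>n. \<alpha> i = 0}"

text \<open>Convergence everywhere about every centre. Only polynomials, sines and cosines of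
  coordinates occur, and this form spares tracking radii through products.\<close>

definition entire_on_rn :: "nat \<Rightarrow> ((nat \<Rightarrow> real) \<Rightarrow> real) \<Rightarrow> bool" where
  "entire_on_rn n g \<longleftrightarrow> (\<forall>x. \<exists>c. \<forall>y.
     ((\<lambda>\<alpha>. c \<alpha> * (\<Prod>i<n. (y i - x i) ^ (\<alpha> i))) has_sum g y) (multi_indices n))"

lemma n_open_rn: "n_open n (rn n)"
  by (auto simp: n_open_def nball_def intro!: exI[of _ 1])

lemma entire_real_analytic: "entire_on_rn n g \<Longrightarrow> real_analytic_on_n n (rn n) g"
  unfolding real_analytic_on_n_def
proof (intro conjI n_open_rn ballI)
  fix x assume "entire_on_rn n g"
  then obtain c where c: "\<And>y. ((\<lambda>\<alpha>. c \<alpha> * (\<Prod>i<n. (y i - x i) ^ (\<alpha> i))) has_sum g y) (multi_indices n)"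
    unfolding entire_on_rn_def by blast
  have "nball n x 1 \<subseteq> rn n" by (auto simp: nball_def)
  then show "\<exists>r>0. nball n x r \<subseteq> rn n \<and> (\<exists>c. \<forall>y\<in>nball n x r.
      ((\<lambda>\<alpha>. c \<alpha> * (\<Prod>i<n. (y i - x i) ^ (\<alpha> i))) has_sum g y) (multi_indices n))"
    using c by (intro exI[of _ 1] conjI exI[of _ c] ballI) auto
qed

lemma has_sum_product_real:
  fixes f :: "'a \<Rightarrow> real" and g :: "'b \<Rightarrow> real"
  assumes f: "(f has_sum a) A" and g: "(g has_sum b) B"
  shows "((\<lambda>(x, y). f x * g y) has_sum (a * b)) (A \<times> B)"
proof (rule has_sum_SigmaI)
  show "((\<lambda>y. case (x, y) of (x, y) \<Rightarrow> f x * g y) has_sum f x * b) B" for x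
    using has_sum_cmult_right[OF g] by simp
  show "((\<lambda>x. f x * b) has_sum a * b) A" by (rule has_sum_cmult_left[OF f])
  have fs: "(\<lambda>x. norm (f x)) summable_on A"
    using has_sum_imp_summable[OF f] summable_on_iff_abs_summable_on_real by blast
  have gs: "(\<lambda>x. norm (g x)) summable_on B"
    using has_sum_imp_summable[OF g] summable_on_iff_abs_summable_on_real by blast
  have "(\<lambda>(x, y). norm (f x) * norm (g y)) summable_on A \<times> B"
  proof (rule summable_on_SigmaI)
    show "((\<lambda>y. case (x, y) of (x, y) \<Rightarrow> norm (f x) * norm (g y)) has_sum norm (f x) * infsum (\<lambda>x. norm (g x)) B) B" for x
      using has_sum_cmult_right[OF has_sum_infsum[OF gs]] by simp
    show "(\<lambda>x. norm (f x) * infsum (\<lambda>x. norm (g x)) B) summable_on A"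
      using summable_on_cmult_left[OF fs] by simp
  qed auto
  then show "(\<lambda>(x, y). f x * g y) summable_on A \<times> B"
    unfolding summable_on_iff_abs_summable_on_real[of "\<lambda>(x, y). f x * g y"]
    by (simp add: case_prod_unfold abs_mult)
qed

lemma entire_add:
  assumes "entire_on_rn n g" "entire_on_rn n h"
  shows "entire_on_rn n (\<lambda>y. g y + h y)"
  unfolding entire_on_rn_def
proof
  fix x
  obtain c d where
    "\<And>y. ((\<lambda>\<alpha>. c \<alpha> * (\<Prod>i<n. (y i - x i) ^ (\<alpha> i))) has_sum g y) (multi_indices n)"
    "\<And>y. ((\<lambda>\<alpha>. d \<alpha> * (\<Prod>i<n. (y i - x i) ^ (\<alpha> i))) has_sum h y) (multi_indices n)"
    using assms unfolding entire_on_rn_def by blast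
  from has_sum_add[OF this]
  have "((\<lambda>\<alpha>. (c \<alpha> + d \<alpha>) * (\<Prod>i<n. (y i - x i) ^ (\<alpha> i))) has_sum (g y + h y)) (multi_indices n)" for y
    by (simp add: distrib_right)
  then show "\<exists>c. \<forall>y. ((\<lambda>\<alpha>. c \<alpha> * (\<Prod>i<n. (y i - x i) ^ (\<alpha> i))) has_sum (g y + h y)) (multi_indices n)"
    by (intro exI[of _ "\<lambda>\<alpha>. c \<alpha> + d \<alpha>"] allI)
qed

lemma finite_multi_indices_le: "finite {\<alpha>\<in>multi_indices n. \<forall>i. \<alpha> i \<le> \<gamma> i}"
proof (rule finite_subset[OF _ finite_set_of_finite_funs[of "{..<n}" "{..(\<Sum>i<n. \<gamma> i)}" 0]])
  show "{\<alpha>\<in>multi_indices n. \<forall>i. \<alpha> i \<le> \<gamma> i} \<subseteq>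
    {f. \<forall>x. (x \<in> {..<n} \<longrightarrow> f x \<in> {..(\<Sum>i<n. \<gamma> i)}) \<and> (x \<notin> {..<n} \<longrightarrow> f x = 0)}"
  proof (intro subsetI CollectI allI conjI impI)
    fix \<alpha> i assume a: "\<alpha> \<in> {\<alpha>\<in>multi_indices n. \<forall>i. \<alpha> i \<le> \<gamma> i}" and i: "i \<in> {..<n}"
    have "\<gamma> i \<le> (\<Sum>i<n. \<gamma> i)" using i by (intro member_le_sum) auto
    then show "\<alpha> i \<in> {..(\<Sum>i<n. \<gamma> i)}" using a by (auto intro: order_trans)
  qed auto
qed auto

text \<open>Cauchy product: pairs (\<alpha>, \<beta>) are regrouped by their sum \<gamma>, with
  \<alpha> running through the finite set of multi-indices below \<gamma>. Absolute convergence
  permits the regrouping.\<close>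

lemma entire_mult:
  assumes "entire_on_rn n g" "entire_on_rn n h"
  shows "entire_on_rn n (\<lambda>y. g y * h y)"
  unfolding entire_on_rn_def
proof
  fix x
  obtain c d where
    c: "\<And>y. ((\<lambda>\<alpha>. c \<alpha> * (\<Prod>i<n. (y i - x i) ^ (\<alpha> i))) has_sum g y) (multi_indices n)" and
    d: "\<And>y. ((\<lambda>\<alpha>. d \<alpha> * (\<Prod>i<n. (y i - x i) ^ (\<alpha> i))) has_sum h y) (multi_indices n)"
    using assms unfolding entire_on_rn_def by blast
  define L where "L = (\<lambda>\<gamma>. {\<alpha>\<in>multi_indices n. \<forall>i. \<alpha> i \<le> \<gamma> i})"
  define e where "e = (\<lambda>\<gamma>. \<Sum>\<alpha>\<in>L \<gamma>. c \<alpha> * d (\<lambda>i. \<gamma> i - \<alpha> i))"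
  have "((\<lambda>\<gamma>. e \<gamma> * (\<Prod>i<n. (y i - x i) ^ (\<gamma> i))) has_sum (g y * h y)) (multi_indices n)" for y
  proof (rule has_sum_SigmaD)
    let ?m = "\<lambda>\<alpha>. \<Prod>i<n. (y i - x i) ^ (\<alpha> i)"
    let ?f = "\<lambda>p. (c (snd p) * d (\<lambda>i. fst p i - snd p i)) * ?m (fst p)"
    have "((\<lambda>(\<alpha>, \<beta>). (c \<alpha> * ?m \<alpha>) * (d \<beta> * ?m \<beta>)) has_sum (g y * h y)) (multi_indices n \<times> multi_indices n)"
      by (rule has_sum_product_real[OF c d])
    also have "?this \<longleftrightarrow> (?f has_sum (g y * h y)) (Sigma (multi_indices n) L)"
    proof (rule has_sum_reindex_bij_witness[where j = "\<lambda>(\<alpha>, \<beta>). (\<lambda>i. \<alpha> i + \<beta> i, \<alpha>)" and i = "\<lambda>(\<gamma>, \<alpha>). (\<alpha>, \<lambda>i. \<gamma> i - \<alpha> i)"])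
      fix p assume "p \<in> multi_indices n \<times> multi_indices n"
      then obtain \<alpha> \<beta> where p: "p = (\<alpha>, \<beta>)" "\<alpha> \<in> multi_indices n" "\<beta> \<in> multi_indices n" by blast
      show "(case case p of (\<alpha>, \<beta>) \<Rightarrow> (\<lambda>i. \<alpha> i + \<beta> i, \<alpha>) of (\<gamma>, \<alpha>) \<Rightarrow> (\<alpha>, \<lambda>i. \<gamma> i - \<alpha> i)) = p"
        using p by auto
      show "(case p of (\<alpha>, \<beta>) \<Rightarrow> (\<lambda>i. \<alpha> i + \<beta> i, \<alpha>)) \<in> Sigma (multi_indices n) L"
        using p by (auto simp: L_def)
      show "?f (case p of (\<alpha>, \<beta>) \<Rightarrow> (\<lambda>i. \<alpha> i + \<beta> i, \<alpha>)) = (case p of (\<alpha>, \<beta>) \<Rightarrow> (c \<alpha> * ?m \<alpha>) * (d \<beta> * ?m \<beta>))"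
        using p by (simp add: power_add prod.distrib)
    next
      fix p assume "p \<in> Sigma (multi_indices n) L"
      then obtain \<gamma> \<alpha> where p: "p = (\<gamma>, \<alpha>)" "\<gamma> \<in> multi_indices n" "\<alpha> \<in> multi_indices n" "\<forall>i. \<alpha> i \<le> \<gamma> i"
        unfolding L_def by blast
      show "(case case p of (\<gamma>, \<alpha>) \<Rightarrow> (\<alpha>, \<lambda>i. \<gamma> i - \<alpha> i) of (\<alpha>, \<beta>) \<Rightarrow> (\<lambda>i. \<alpha> i + \<beta> i, \<alpha>)) = p"
        using p by auto
      show "(case p of (\<gamma>, \<alpha>) \<Rightarrow> (\<alpha>, \<lambda>i. \<gamma> i - \<alpha> i)) \<in> multi_indices n \<times> multi_indices n"
        using p by auto
    qed simp
    finally show "(?f has_sum (g y * h y)) (Sigma (multi_indices n) L)" .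
    fix \<gamma> assume "\<gamma> \<in> multi_indices n"
    have "finite (L \<gamma>)" unfolding L_def by (rule finite_multi_indices_le)
    then show "((\<lambda>\<alpha>. ?f (\<gamma>, \<alpha>)) has_sum e \<gamma> * ?m \<gamma>) (L \<gamma>)"
      by (intro has_sum_finiteI) (auto simp: e_def sum_distrib_right)
  qed
  then show "\<exists>c. \<forall>y. ((\<lambda>\<alpha>. c \<alpha> * (\<Prod>i<n. (y i - x i) ^ (\<alpha> i))) has_sum (g y * h y)) (multi_indices n)"
    by (intro exI[of _ e] allI)
qed

lemma entire_single:
  assumes h: "\<And>t. \<exists>a. \<forall>u. ((\<lambda>m. a m * u ^ m) has_sum h (t + u)) (UNIV :: nat set)" and j: "j < n"
  shows "entire_on_rn n (\<lambda>y. h (y j))"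
  unfolding entire_on_rn_def
proof
  fix x :: "nat \<Rightarrow> real"
  obtain a where a: "\<And>u. ((\<lambda>m. a m * u ^ m) has_sum h (x j + u)) (UNIV :: nat set)" using h by blast
  \<comment> \<open>The multi-index with entry m at position j and 0 elsewhere; the series of h is
    spread over these indices only.\<close>
  define \<epsilon> where "\<epsilon> = (\<lambda>m::nat. \<lambda>i. if i = j then m else 0)"
  define c where "c = (\<lambda>\<alpha>. if \<alpha> \<in> range \<epsilon> then a (\<alpha> j) else 0)"
  have inj: "inj \<epsilon>" by (rule injI) (auto simp: \<epsilon>_def dest!: fun_cong[of _ _ j])
  have "((\<lambda>\<alpha>. c \<alpha> * (\<Prod>i<n. (y i - x i) ^ (\<alpha> i))) has_sum h (y j)) (multi_indices n)" for y
  proof -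
    let ?f = "\<lambda>\<alpha>. c \<alpha> * (\<Prod>i<n. (y i - x i) ^ (\<alpha> i))"
    have m: "(\<Prod>i<n. (y i - x i) ^ (\<epsilon> m i)) = (y j - x j) ^ m" for m
    proof -
      have "(\<Prod>i<n. (y i - x i) ^ (\<epsilon> m i)) = (\<Prod>i<n. if i = j then (y j - x j) ^ m else 1)"
        by (intro prod.cong) (auto simp: \<epsilon>_def)
      then show ?thesis using j by simp
    qed
    have "(?f \<circ> \<epsilon>) = (\<lambda>m. a m * (y j - x j) ^ m)"
      unfolding comp_def m by (simp add: c_def \<epsilon>_def)
    then have "((?f \<circ> \<epsilon>) has_sum h (y j)) UNIV" using a[of "y j - x j"] by simp
    then have "(?f has_sum h (y j)) (range \<epsilon>)" using has_sum_reindex[OF inj] by blast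
    also have "?this \<longleftrightarrow> (?f has_sum h (y j)) (multi_indices n)"
      by (rule has_sum_cong_neutral) (use j in \<open>auto simp: c_def \<epsilon>_def\<close>)
    finally show ?thesis .
  qed
  then show "\<exists>c. \<forall>y. ((\<lambda>\<alpha>. c \<alpha> * (\<Prod>i<n. (y i - x i) ^ (\<alpha> i))) has_sum h (y j)) (multi_indices n)"
    by (intro exI[of _ c] allI)
qed

lemma entire_const: "0 < n \<Longrightarrow> entire_on_rn n (\<lambda>y. k)"
  by (rule entire_single[of "\<lambda>_. k" 0])
    (auto intro!: exI[of _ "\<lambda>m. if m = 0 then k else 0"] has_sum_finite_neutralI[of "{0}"] split: if_splits)

lemma entire_coord: "j < n \<Longrightarrow> entire_on_rn n (\<lambda>y. y j)"
proof (rule entire_single[of "\<lambda>t. t"])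
  fix t :: real
  have "((\<lambda>m. (if m = 0 then t else if m = 1 then 1 else 0) * u ^ m) has_sum t + u) UNIV" for u
    by (rule has_sum_finite_neutralI[of "{0,1}"]) auto
  then show "\<exists>a. \<forall>u. ((\<lambda>m. a m * u ^ m) has_sum t + u) UNIV"
    by (intro exI[of _ "\<lambda>m. if m = 0 then t else if m = 1 then 1 else 0"] allI)
qed

lemma cos_has_sum: "((\<lambda>m. cos_coeff m * u ^ m) has_sum cos u) UNIV" for u :: real
  using norm_summable_imp_has_sum[OF summable_norm_cos cos_converges, of u] by simp

lemma sin_has_sum: "((\<lambda>m. sin_coeff m * u ^ m) has_sum sin u) UNIV" for u :: real
  using norm_summable_imp_has_sum[OF summable_norm_sin sin_converges, of u] by simp

lemma entire_cos: "j < n \<Longrightarrow> entire_on_rn n (\<lambda>y. cos (y j))"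
proof (rule entire_single[of cos])
  fix t :: real
  have "((\<lambda>m. cos t * (cos_coeff m * u ^ m) + (- sin t) * (sin_coeff m * u ^ m)) has_sum cos t * cos u + (- sin t) * sin u) UNIV" for u
    by (intro has_sum_add has_sum_cmult_right cos_has_sum sin_has_sum)
  then have "((\<lambda>m. (cos t * cos_coeff m + (- sin t) * sin_coeff m) * u ^ m) has_sum cos t * cos u + (- sin t) * sin u) UNIV" for u
    by (simp only: distrib_right mult.assoc)
  moreover have "cos (t + u) = cos t * cos u + (- sin t) * sin u" for u by (simp add: cos_add)
  ultimately have "((\<lambda>m. (cos t * cos_coeff m + (- sin t) * sin_coeff m) * u ^ m) has_sum cos (t + u)) UNIV" for u
    by (simp only:)
  then show "\<exists>a. \<forall>u. ((\<lambda>m. a m * u ^ m) has_sum cos (t + u)) UNIV"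
    by (intro exI[of _ "\<lambda>m. cos t * cos_coeff m + (- sin t) * sin_coeff m"] allI)
qed

lemma entire_sin: "j < n \<Longrightarrow> entire_on_rn n (\<lambda>y. sin (y j))"
proof (rule entire_single[of sin])
  fix t :: real
  have "((\<lambda>m. sin t * (cos_coeff m * u ^ m) + cos t * (sin_coeff m * u ^ m)) has_sum sin t * cos u + cos t * sin u) UNIV" for u
    by (intro has_sum_add has_sum_cmult_right cos_has_sum sin_has_sum)
  then have "((\<lambda>m. (sin t * cos_coeff m + cos t * sin_coeff m) * u ^ m) has_sum sin t * cos u + cos t * sin u) UNIV" for u
    by (simp only: distrib_right mult.assoc)
  then have "((\<lambda>m. (sin t * cos_coeff m + cos t * sin_coeff m) * u ^ m) has_sum sin (t + u)) UNIV" for u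
    by (simp only: sin_add)
  then show "\<exists>a. \<forall>u. ((\<lambda>m. a m * u ^ m) has_sum sin (t + u)) UNIV"
    by (intro exI[of _ "\<lambda>m. sin t * cos_coeff m + cos t * sin_coeff m"] allI)
qed

lemma entire_uminus: "0 < n \<Longrightarrow> entire_on_rn n g \<Longrightarrow> entire_on_rn n (\<lambda>y. - g y)"
  using entire_mult[OF entire_const[of n "-1"]] by simp

lemma entire_diff: "0 < n \<Longrightarrow> entire_on_rn n g \<Longrightarrow> entire_on_rn n h \<Longrightarrow> entire_on_rn n (\<lambda>y. g y - h y)"
  using entire_add[OF _ entire_uminus] by simp

text \<open>The offset M lets the angles occupy a block of coordinates of a larger space.\<close>

lemma entire_trig_poly:
  assumes "trig_poly J g" "\<And>j. j \<in> J \<Longrightarrow> M + j < n" "0 < n"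
  shows "entire_on_rn n (\<lambda>y. Re (g (\<lambda>j. y (M + j)))) \<and> entire_on_rn n (\<lambda>y. Im (g (\<lambda>j. y (M + j))))"
  using assms(1)
proof (induction rule: trig_poly.induct)
  case (trig_poly_const c)
  show ?case using entire_const[OF assms(3)] by simp
next
  case (trig_poly_exp j)
  then show ?case using entire_cos[OF assms(2)] entire_sin[OF assms(2)] by (simp add: Re_exp Im_exp)
next
  case (trig_poly_exp_minus j)
  then show ?case using entire_cos[OF assms(2)] entire_uminus[OF assms(3) entire_sin[OF assms(2)]]
    by (simp add: Re_exp Im_exp)
next
  case (trig_poly_add g h)
  then show ?case by (simp add: entire_add)
next
  case (trig_poly_mult g h)
  then show ?case by (simp add: entire_add entire_mult entire_diff[OF assms(3)])
qed

lemma semianalytic_zero_set: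
  assumes "finite E" "\<And>g. g \<in> E \<Longrightarrow> entire_on_rn n g"
  shows "semianalytic n {y\<in>rn n. \<forall>g\<in>E. g y = 0}"
  unfolding semianalytic_def
proof (intro conjI ballI)
  fix x assume "x \<in> rn n"
  then show "\<exists>U. n_open n U \<and> x \<in> U \<and>
        (\<exists>(p::nat) (E' :: nat \<Rightarrow> ((nat \<Rightarrow> real) \<Rightarrow> real) set) (P :: nat \<Rightarrow> ((nat \<Rightarrow> real) \<Rightarrow> real) set).
           (\<forall>i<p. finite (E' i) \<and> finite (P i) \<and> (\<forall>g\<in>E' i \<union> P i. real_analytic_on_n n U g)) \<and>
           {y\<in>rn n. \<forall>g\<in>E. g y = 0} \<inter> U = (\<Union>i<p. {y\<in>U. (\<forall>g\<in>E' i. g y = 0) \<and> (\<forall>g\<in>P i. 0 < g y)}))"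
    using assms
    by (intro exI[of _ "rn n"] conjI n_open_rn exI[of _ 1] exI[of _ "\<lambda>_. E"] exI[of _ "\<lambda>_. {}"])
      (auto intro: entire_real_analytic)
qed auto

section \<open>Compactness in the product topology\<close>

lemma compact_box: "compact {y :: 'i \<Rightarrow> real. \<forall>i. y i \<in> {a i..b i}}"
proof -
  have "compactin (product_topology (\<lambda>i. euclidean) UNIV) (PiE UNIV (\<lambda>i. {a i..b i}))"
    unfolding compactin_PiE by (simp add: compactin_euclidean_iff)
  then show ?thesis
    unfolding euclidean_product_topology compactin_euclidean_iff by (simp add: PiE_UNIV_domain Pi_def)
qed

text \<open>Bridge from the product topology on sequences, where compactness is available, to the
  Euclidean balls of \<open>n_open\<close>: points taken from shrinking balls converge in each
  coordinate.\<close>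

lemma n_closed_if_closed:
  assumes "closed A" "A \<subseteq> rn n"
  shows "n_closed n A"
  unfolding n_closed_def n_open_def
proof (intro conjI ballI assms(2))
  fix x assume x: "x \<in> rn n - A"
  show "\<exists>r>0. nball n x r \<subseteq> rn n - A"
  proof (rule ccontr)
    assume "\<not> ?thesis"
    then have "\<exists>y. y \<in> nball n x (1 / real (Suc m)) \<and> y \<in> A" for m
      by (metis (no_types, lifting) Diff_iff divide_pos_pos mem_Collect_eq nball_def of_nat_0_less_iff subsetI zero_less_Suc zero_less_one)
    then obtain y where y: "\<And>m. y m \<in> nball n x (1 / real (Suc m))" "\<And>m. y m \<in> A" by metis
    have "(\<lambda>m. y m i) \<longlonglongrightarrow> x i" for i
    proof (cases "i < n")
      case True
      have "\<bar>y m i - x i\<bar> \<le> 1 / real (Suc m)" for m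
      proof -
        have "(y m i - x i)^2 \<le> (\<Sum>i<n. (y m i - x i)^2)" using True by (intro member_le_sum) auto
        also have "\<dots> < (1 / real (Suc m))^2" using y(1)[of m] by (simp add: nball_def)
        finally show ?thesis by (intro power2_le_imp_le[of "\<bar>y m i - x i\<bar>"]) auto
      qed
      then have "(\<lambda>m. y m i - x i) \<longlonglongrightarrow> 0"
        by (intro Lim_null_comparison[OF _ LIMSEQ_inverse_real_of_nat]) (auto simp: inverse_eq_divide)
      then show ?thesis by (simp add: LIM_zero_iff)
    next
      case False
      then have "y m i = x i" for m using y(1)[of m] x by (auto simp: nball_def rn_def)
      then show ?thesis by simp
    qed
    then have "limitin (product_topology (\<lambda>i. euclidean) UNIV) y x sequentially"
      by (simp add: limitin_componentwise)
    then have "y \<longlonglongrightarrow> x" unfolding euclidean_product_topology by simp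
    then have "x \<in> A" using closed_sequentially[OF assms(1)] y(2) by blast
    then show False using x by blast
  qed
qed auto

text \<open>The lower bound 1/r keeps lengths and k away from 0. Each piece is thus closed in the
  whole space, not merely relative to the open orthant.\<close>

definition param_piece :: "nat \<Rightarrow> real \<Rightarrow> ((nat \<Rightarrow> real) \<Rightarrow> complex) set \<Rightarrow> (nat \<Rightarrow> real) set" where
  "param_piece N r G = {l\<in>rn N. (\<forall>j<N. l j \<in> {1/r..r}) \<and> (\<exists>k\<in>{1/r..r}. \<forall>g\<in>G. g (\<lambda>j. k * l j / 2) = 0)}"

text \<open>The coordinates 0..N-1 hold l, N..2N-1 the half angles k l / 2, coordinate 3 N holds k; the remaining ones
  are slack variables turning the closed inequalities into equations.\<close>

definition lift_eqs :: "nat \<Rightarrow> real \<Rightarrow> ((nat \<Rightarrow> real) \<Rightarrow> complex) set \<Rightarrow> ((nat \<Rightarrow> real) \<Rightarrow> real) set" where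
  "lift_eqs N r G =
     (\<lambda>j y. 2 * y (N + j) - y (3 * N) * y j) ` {..<N} \<union>
     (\<lambda>j y. (y j - 1/r) * (r - y j) - y (2 * N + j) * y (2 * N + j)) ` {..<N} \<union>
     {\<lambda>y. (y (3 * N) - 1/r) * (r - y (3 * N)) - y (3 * N + 1) * y (3 * N + 1)} \<union>
     (\<lambda>g y. Re (g (\<lambda>j. y (N + j)))) ` G \<union> (\<lambda>g y. Im (g (\<lambda>j. y (N + j)))) ` G"

definition lift_set :: "nat \<Rightarrow> real \<Rightarrow> ((nat \<Rightarrow> real) \<Rightarrow> complex) set \<Rightarrow> (nat \<Rightarrow> real) set" where
  "lift_set N r G = {y\<in>rn (3 * N + 2). \<forall>e\<in>lift_eqs N r G. e y = 0}"

text \<open>Since 1/r \<le> r, the product is negative outside the interval, so demanding that it be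
  a square encodes both inequalities in one equation. The bound on u keeps the lifted set
  bounded.\<close>

lemma slack_interval:
  assumes "(t - 1/r) * (r - t) = u * u" "r \<ge> (1::real)"
  shows "t \<in> {1/r..r} \<and> \<bar>u\<bar> \<le> r"
proof -
  have inv: "1/r \<le> r" "0 < 1/r" using assms(2) by (auto simp: field_simps intro: order_trans)
  have nn: "(t - 1/r) * (r - t) \<ge> 0" unfolding assms(1) by simp
  have t: "1/r \<le> t" "t \<le> r"
  proof -
    show "1/r \<le> t"
    proof (rule ccontr)
      assume "\<not> 1/r \<le> t"
      then have "(t - 1/r) * (r - t) < 0" using inv by (intro mult_neg_pos) auto
      then show False using nn by simp
    qed
    show "t \<le> r"
    proof (rule ccontr)
      assume "\<not> t \<le> r"
      then have "(t - 1/r) * (r - t) < 0" using inv by (intro mult_pos_neg) auto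
      then show False using nn by simp
    qed
  qed
  have "0 < t" using t(1) inv(2) by linarith
  have "u * u \<le> r * r" unfolding assms(1)[symmetric]
    by (intro mult_mono) (use t inv \<open>0 < t\<close> assms(2) in linarith)+
  then have "\<bar>u\<bar> \<le> r" using assms(2) by (metis abs_le_square_iff abs_of_nonneg order_trans power2_eq_square zero_le_one)
  then show ?thesis using t by simp
qed

lemma slack_exists:
  assumes "t \<in> {1/r..r::real}"
  shows "\<exists>u. (t - 1/r) * (r - t) = u * u"
  using assms by (intro exI[of _ "sqrt ((t - 1/r) * (r - t))"]) auto

lemma lift_setD:
  assumes y: "y \<in> lift_set N r G" and r: "r \<ge> 1"
  shows "j < N \<Longrightarrow> y j \<in> {1/r..r}" "j < N \<Longrightarrow> \<bar>y (2 * N + j)\<bar> \<le> r" "y (3 * N) \<in> {1/r..r}" "\<bar>y (3 * N + 1)\<bar> \<le> r"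
    "j < N \<Longrightarrow> y (N + j) = y (3 * N) * y j / 2" "g \<in> G \<Longrightarrow> g (\<lambda>j. y (N + j)) = 0"
proof -
  have e: "e y = 0" if "e \<in> lift_eqs N r G" for e using y that by (auto simp: lift_set_def)
  show "y (N + j) = y (3 * N) * y j / 2" if "j < N"
    using e[of "\<lambda>y. 2 * y (N + j) - y (3 * N) * y j"] that by (auto simp: lift_eqs_def)
  have "(y j - 1/r) * (r - y j) - y (2 * N + j) * y (2 * N + j) = 0" if "j < N"
    by (rule e) (use that in \<open>auto simp: lift_eqs_def\<close>)
  then show "y j \<in> {1/r..r}" "\<bar>y (2 * N + j)\<bar> \<le> r" if "j < N"
    using slack_interval[OF _ r, of "y j" "y (2 * N + j)"] that by auto
  have "(y (3 * N) - 1/r) * (r - y (3 * N)) - y (3 * N + 1) * y (3 * N + 1) = 0"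
    by (rule e) (auto simp: lift_eqs_def)
  then show "y (3 * N) \<in> {1/r..r}" "\<bar>y (3 * N + 1)\<bar> \<le> r"
    using slack_interval[OF _ r, of "y (3 * N)" "y (3 * N + 1)"] by auto
  show "g (\<lambda>j. y (N + j)) = 0" if "g \<in> G"
  proof -
    have "Re (g (\<lambda>j. y (N + j))) = 0" by (rule e) (use that in \<open>auto simp: lift_eqs_def\<close>)
    moreover have "Im (g (\<lambda>j. y (N + j))) = 0" by (rule e) (use that in \<open>auto simp: lift_eqs_def\<close>)
    ultimately show ?thesis by (simp add: complex_eq_iff)
  qed
qed

lemma lift_set_bound:
  assumes y: "y \<in> lift_set N r G" and r: "r \<ge> 1"
  shows "\<bar>y i\<bar> \<le> r * r"
proof -
  have rr: "r \<le> r * r" using r by simp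
  have inv: "0 < 1/r" using r by simp
  have pos: "\<bar>t\<bar> \<le> r" if "t \<in> {1/r..r}" for t
  proof -
    have "1/r \<le> t" "t \<le> r" using that by auto
    then show ?thesis using inv by linarith
  qed
  consider "i < N" | "N \<le> i" "i < 2 * N" | "2 * N \<le> i" "i < 3 * N" | "i = 3 * N" | "i = 3 * N + 1" | "i \<ge> 3 * N + 2"
    by linarith
  then show ?thesis
  proof cases
    case 1
    then show ?thesis using pos[OF lift_setD(1)[OF y r]] rr by force
  next
    case 2
    define j where "j = i - N"
    have j: "j < N" "i = N + j" using 2 by (auto simp: j_def)
    have "\<bar>y (3 * N) * y j\<bar> \<le> r * r"
      unfolding abs_mult using pos[OF lift_setD(3)[OF y r]] pos[OF lift_setD(1)[OF y r j(1)]] r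
      by (intro mult_mono) auto
    then show ?thesis unfolding j(2) lift_setD(5)[OF y r j(1)] by linarith
  next
    case 3
    define j where "j = i - 2 * N"
    have j: "j < N" "i = 2 * N + j" using 3 by (auto simp: j_def)
    then show ?thesis using lift_setD(2)[OF y r j(1)] rr by simp
  next
    case 4
    then show ?thesis using pos[OF lift_setD(3)[OF y r]] rr by simp
  next
    case 5
    then show ?thesis using lift_setD(4)[OF y r] rr by simp
  next
    case 6
    then show ?thesis using y r by (simp add: lift_set_def rn_def)
  qed
qed

lemma proj_lift_set:
  assumes r: "r \<ge> 1" and G: "\<forall>g\<in>G. trig_poly {..<N} g"
  shows "proj_n N ` lift_set N r G = param_piece N r G"
proof (intro equalityI subsetI)
  fix l assume "l \<in> proj_n N ` lift_set N r G"
  then obtain y where y: "y \<in> lift_set N r G" and l: "l = proj_n N y" by blast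
  have "g (\<lambda>j. y (3 * N) * l j / 2) = 0" if "g \<in> G" for g
  proof -
    have "g (\<lambda>j. y (3 * N) * l j / 2) = g (\<lambda>j. y (N + j))"
      by (rule trig_poly_cong_on[OF bspec[OF G that]]) (use lift_setD(5)[OF y r] in \<open>auto simp: l proj_n_def\<close>)
    then show ?thesis using lift_setD(6)[OF y r that] by simp
  qed
  then show "l \<in> param_piece N r G"
    using lift_setD(1,3)[OF y r] unfolding param_piece_def
    by (auto simp: l rn_def proj_n_def intro!: bexI[of _ "y (3 * N)"])
next
  fix l assume "l \<in> param_piece N r G"
  then obtain k where l: "l \<in> rn N" "\<And>j. j < N \<Longrightarrow> l j \<in> {1/r..r}" and k: "k \<in> {1/r..r}"
    and g: "\<And>g. g \<in> G \<Longrightarrow> g (\<lambda>j. k * l j / 2) = 0" unfolding param_piece_def by blast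
  have "\<forall>j. \<exists>u. j < N \<longrightarrow> (l j - 1/r) * (r - l j) = u * u" using slack_exists l(2) by blast
  from choice[OF this] obtain u where u: "\<And>j. j < N \<Longrightarrow> (l j - 1/r) * (r - l j) = u j * u j" by blast
  obtain w where w: "(k - 1/r) * (r - k) = w * w" using slack_exists[OF k] by blast
  define y where "y = (\<lambda>i. if i < N then l i else if i < 2 * N then k * l (i - N) / 2 else if i < 3 * N then u (i - 2 * N)
     else if i = 3 * N then k else if i = 3 * N + 1 then w else 0)"
  have y1: "y j = l j" "y (N + j) = k * l j / 2" "y (2 * N + j) = u j" if "j < N" for j
    using that by (auto simp: y_def)
  have y2: "y (3 * N) = k" "y (3 * N + 1) = w" by (auto simp: y_def)
  have g': "g (\<lambda>j. y (N + j)) = 0" if "g \<in> G" for g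
  proof -
    have "g (\<lambda>j. k * l j / 2) = g (\<lambda>j. y (N + j))"
      by (rule trig_poly_cong_on[OF bspec[OF G that]]) (use y1 in auto)
    then show ?thesis using g[OF that] by simp
  qed
  have "y \<in> lift_set N r G"
    unfolding lift_set_def
  proof (intro CollectI conjI ballI)
    show "y \<in> rn (3 * N + 2)" by (auto simp: y_def rn_def)
    fix e assume "e \<in> lift_eqs N r G"
    then consider j where "j < N" "e = (\<lambda>y. 2 * y (N + j) - y (3 * N) * y j)"
      | j where "j < N" "e = (\<lambda>y. (y j - 1/r) * (r - y j) - y (2 * N + j) * y (2 * N + j))"
      | "e = (\<lambda>y. (y (3 * N) - 1/r) * (r - y (3 * N)) - y (3 * N + 1) * y (3 * N + 1))"
      | g where "g \<in> G" "e = (\<lambda>y. Re (g (\<lambda>j. y (N + j))))"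
      | g where "g \<in> G" "e = (\<lambda>y. Im (g (\<lambda>j. y (N + j))))"
      unfolding lift_eqs_def by blast
    then show "e y = 0"
    proof cases
      case 1
      then show ?thesis using y1[OF 1(1)] y2 by simp
    next
      case 2
      then show ?thesis using y1[OF 2(1)] u[OF 2(1)] by simp
    next
      case 3
      then show ?thesis using y2 w by (simp del: One_nat_def add_2_eq_Suc')
    next
      case (4 g)
      then show ?thesis using g'[OF 4(1)] by simp
    next
      case (5 g)
      then show ?thesis using g'[OF 5(1)] by simp
    qed
  qed
  moreover have "l = proj_n N y"
    using l(1) by (auto simp: proj_n_def y1 rn_def fun_eq_iff)
  ultimately show "l \<in> proj_n N ` lift_set N r G" by blast
qed

lemma lift_eqs_entire:
  assumes "e \<in> lift_eqs N r G" "\<forall>g\<in>G. trig_poly {..<N} g"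
  shows "entire_on_rn (3 * N + 2) e"
  using assms(1) unfolding lift_eqs_def
  by (auto intro!: entire_diff entire_mult entire_coord entire_const
      conjunct1[OF entire_trig_poly[OF bspec[OF assms(2)]]] conjunct2[OF entire_trig_poly[OF bspec[OF assms(2)]]])

lemma lift_eqs_continuous:
  assumes "e \<in> lift_eqs N r G" "\<forall>g\<in>G. trig_poly {..<N} g"
  shows "continuous_on UNIV e"
proof -
  have "continuous_on UNIV (\<lambda>y :: nat \<Rightarrow> real. g (\<lambda>j. y (N + j)))" if "g \<in> G" for g
    by (rule continuous_on_compose2[OF trig_poly_continuous[OF bspec[OF assms(2) that]]])
      (auto intro!: continuous_intros)
  then show ?thesis using assms(1) unfolding lift_eqs_def by (auto intro!: continuous_intros)
qed

lemma compact_lift_set: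
  assumes r: "r \<ge> 1" and G: "\<forall>g\<in>G. trig_poly {..<N} g"
  shows "compact (lift_set N r G)"
proof -
  let ?K = "{y :: nat \<Rightarrow> real. \<forall>i. y i \<in> {- (r * r)..r * r}}"
  have "lift_set N r G = ?K \<inter> ((\<Inter>i\<in>{3 * N + 2..}. {y. y i = 0}) \<inter> (\<Inter>e\<in>lift_eqs N r G. {y. e y = 0}))"
    using lift_set_bound[OF _ r, of _ N G] by (auto simp: lift_set_def rn_def abs_le_iff minus_le_iff)
  moreover have "closed ((\<Inter>i\<in>{3 * N + 2..}. {y :: nat \<Rightarrow> real. y i = 0}) \<inter> (\<Inter>e\<in>lift_eqs N r G. {y. e y = 0}))"
    using lift_eqs_continuous[OF _ G]
    by (intro closed_Int closed_INT ballI closed_Collect_eq) (auto intro!: continuous_intros)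
  ultimately show ?thesis using compact_Int_closed[OF compact_box] by simp
qed

lemma closed_param_piece:
  assumes r: "r \<ge> 1" and G: "\<forall>g\<in>G. trig_poly {..<N} g"
  shows "n_closed N (param_piece N r G)"
proof (rule n_closed_if_closed)
  have "continuous_on S (\<lambda>y. proj_n N y i)" for S i
    by (cases "i < N") (auto simp: proj_n_def intro!: continuous_on_subset[OF continuous_on_product_coordinates])
  then have "continuous_on (lift_set N r G) (proj_n N)"
    by (intro continuous_on_coordinatewise_then_product)
  then show "closed (param_piece N r G)"
    unfolding proj_lift_set[OF assms, symmetric]
    using compact_lift_set[OF assms] by (intro compact_imp_closed compact_continuous_image)
qed (auto simp: param_piece_def)

text \<open>The lifted set is bounded as a whole, so the entire space can serve as the neighbourhood
  of every point.\<close>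

lemma subanalytic_param_piece:
  assumes r: "r \<ge> 1" and G: "\<forall>g\<in>G. trig_poly {..<N} g" and fin: "finite G"
  shows "subanalytic N (param_piece N r G)"
  unfolding subanalytic_def
proof (intro conjI ballI)
  show "param_piece N r G \<subseteq> rn N" by (auto simp: param_piece_def)
  fix x assume x: "x \<in> rn N"
  have dim: "N + (2 * N + 2) = 3 * N + 2" by simp
  have "semianalytic (N + (2 * N + 2)) (lift_set N r G)"
    unfolding dim lift_set_def
    by (rule semianalytic_zero_set) (use fin lift_eqs_entire[OF _ G] in \<open>auto simp: lift_eqs_def\<close>)
  moreover have "n_bounded (N + (2 * N + 2)) (lift_set N r G)"
    unfolding dim n_bounded_def
  proof (intro conjI exI ballI)
    show "lift_set N r G \<subseteq> rn (3 * N + 2)" by (auto simp: lift_set_def)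
    fix y assume y: "y \<in> lift_set N r G"
    have "(\<Sum>i<3 * N + 2. (y i)\<^sup>2) \<le> (\<Sum>i<3 * N + 2. (r * r)\<^sup>2)"
      using lift_set_bound[OF y r] by (intro sum_mono) (metis power2_abs power_mono abs_ge_zero)
    then show "(\<Sum>i<3 * N + 2. (y i)\<^sup>2) \<le> (\<Sum>i<3 * N + 2. (r * r)\<^sup>2)" .
  qed
  moreover have "param_piece N r G \<inter> rn N = proj_n N ` lift_set N r G"
    unfolding proj_lift_set[OF r G] by (auto simp: param_piece_def)
  ultimately show "\<exists>U. n_open N U \<and> x \<in> U \<and>
        (\<exists>m B. semianalytic (N + m) B \<and> n_bounded (N + m) B \<and> param_piece N r G \<inter> U = proj_n N ` B)"
    using x n_open_rn by blast
qed

section \<open>Rationally independent lengths\<close>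

text \<open>Relative to an index set, because the strong part needs independence only of the lengths
  other than the p-th.\<close>

definition int_indep :: "(nat \<Rightarrow> real) \<Rightarrow> nat set \<Rightarrow> bool" where
  "int_indep l J \<longleftrightarrow> (\<forall>h :: nat \<Rightarrow> int. (\<Sum>j\<in>J. of_int (h j) * l j) = 0 \<longrightarrow> (\<forall>j\<in>J. h j = 0))"

lemma int_indep_subset:
  assumes "int_indep l J" "J' \<subseteq> J" "finite J"
  shows "int_indep l J'"
  unfolding int_indep_def
proof (intro allI impI ballI)
  fix h :: "nat \<Rightarrow> int" and j assume h: "(\<Sum>j\<in>J'. of_int (h j) * l j) = 0" and j: "j \<in> J'"
  have "(\<Sum>j\<in>J. of_int (if j \<in> J' then h j else 0) * l j) = (\<Sum>j\<in>J'. of_int (h j) * l j)"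
    using assms(2,3) by (intro sum.mono_neutral_cong_right) auto
  with assms(1)[unfolded int_indep_def, rule_format, of "\<lambda>j. if j \<in> J' then h j else 0" j] h j assms(2)
  show "h j = 0" by auto
qed

lemma int_indep_nonzero:
  assumes "int_indep l J" "finite J" "i \<in> J"
  shows "l i \<noteq> 0"
proof
  assume "l i = 0"
  then have "(\<Sum>j\<in>J. of_int (if j = i then 1 else 0) * l j) = 0" by (intro sum.neutral) auto
  with assms(1)[unfolded int_indep_def, rule_format, of "\<lambda>j. if j = i then 1 else 0" i] assms(3)
  show False by simp
qed

lemma int_indep_pair:
  assumes "int_indep l J" "finite J" "i \<in> J" "j \<in> J" "i \<noteq> j" "of_int a * l i = of_int b * l j"
  shows "b = 0"
proof -
  let ?h = "\<lambda>q. if q = i then a else if q = j then - b else 0"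
  have "(\<Sum>q\<in>J. of_int (?h q) * l q) =
     (\<Sum>q\<in>J. (if q = i then of_int a * l i else 0) - (if q = j then of_int b * l j else 0))"
    using assms(5) by (intro sum.cong) auto
  also have "\<dots> = 0" using assms(2-4,6) by (simp add: sum_subtractf)
  finally have "\<forall>q\<in>J. ?h q = 0" using assms(1)[unfolded int_indep_def, rule_format, of ?h] by blast
  from bspec[OF this assms(4)] assms(5) show ?thesis by simp
qed

lemma int_indep_inj: "int_indep l J \<Longrightarrow> finite J \<Longrightarrow> inj_on l J"
  using int_indep_pair[of l J _ _ 1 1] by (intro inj_onI) force

text \<open>\<open>Kronecker_thm_1\<close> after enumerating J and rescaling time and targets by 2
  pi.\<close>

lemma Kronecker_simultaneous:
  assumes ind: "int_indep l J" and J: "finite J" and e: "\<epsilon> > 0"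
  shows "\<exists>t. \<exists>h :: nat \<Rightarrow> int. \<forall>j\<in>J. \<bar>t * l j - 2 * pi * of_int (h j) - y j\<bar> < \<epsilon>"
proof -
  obtain f where f: "bij_betw f {..<card J} J" using ex_bij_betw_nat_finite[OF J] by (auto simp: lessThan_atLeast0)
  define n where "n = card J"
  interpret M: Modules.module "(\<lambda>r. (*) (real_of_int r))"
    by (simp add: Modules.module.intro distrib_left mult.commute)
  have inj: "inj_on (\<lambda>i. l (f i)) {..<n}"
    using comp_inj_on[OF bij_betw_imp_inj_on[OF f], of l] int_indep_inj[OF ind J]
    by (simp add: bij_betw_imp_surj_on[OF f] n_def comp_def)
  have "M.independent ((\<lambda>i. l (f i)) ` {..<n})"
    unfolding M.independent_explicit_module
  proof (intro allI impI)
    fix T :: "real set" and u :: "real \<Rightarrow> int" and x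
    assume T: "finite T" "T \<subseteq> (\<lambda>i. l (f i)) ` {..<n}" "(\<Sum>v\<in>T. real_of_int (u v) * v) = 0" and xT: "x \<in> T"
    define g where "g = (\<lambda>v. if v \<in> T then u v else 0)"
    have x: "x \<in> (\<lambda>i. l (f i)) ` {..<n}" using xT T(2) by blast
    have "(\<Sum>x\<in>(\<lambda>i. l (f i)) ` {..<n}. real_of_int (g x) * x) = (\<Sum>v\<in>T. real_of_int (u v) * v)"
      using T(2) by (intro sum.mono_neutral_cong_right) (auto simp: g_def)
    with T(3) have s: "(\<Sum>x\<in>(\<lambda>i. l (f i)) ` {..<n}. real_of_int (g x) * x) = 0" by simp
    have "(\<Sum>x\<in>(\<lambda>i. l (f i)) ` {..<n}. real_of_int (g x) * x) = (\<Sum>i<n. real_of_int (g (l (f i))) * l (f i))"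
      by (simp add: sum.reindex[OF inj])
    also have "\<dots> = (\<Sum>j\<in>J. real_of_int (g (l j)) * l j)"
      using sum.reindex_bij_betw[OF f, of "\<lambda>j. real_of_int (g (l j)) * l j"] by (simp add: n_def)
    finally have "\<forall>j\<in>J. g (l j) = 0"
      using s ind[unfolded int_indep_def, rule_format, of "\<lambda>j. g (l j)"] by auto
    then have "g x = 0" using x bij_betw_imp_surj_on[OF f] by (auto simp: n_def)
    then show "u x = 0" using xT by (simp add: g_def)
  qed
  then obtain t h where th: "\<And>i. i < n \<Longrightarrow> \<bar>t * l (f i) - of_int (h i) - y (f i) / (2 * pi)\<bar> < \<epsilon> / (2 * pi)"
    using Kronecker_thm_1[of "\<lambda>i. l (f i)" n "\<epsilon> / (2 * pi)" "\<lambda>i. y (f i) / (2 * pi)"] inj e by auto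
  have "\<bar>(2 * pi * t) * l j - 2 * pi * of_int (h (inv_into {..<n} f j)) - y j\<bar> < \<epsilon>" if "j \<in> J" for j
  proof -
    define i where "i = inv_into {..<n} f j"
    have i: "i < n" "f i = j"
      using inv_into_into[of j f "{..<n}"] f_inv_into_f[of j f "{..<n}"] bij_betw_imp_surj_on[OF f] that
      unfolding i_def n_def by auto
    have "(2 * pi * t) * l j - 2 * pi * of_int (h i) - y j = 2 * pi * (t * l (f i) - of_int (h i) - y (f i) / (2 * pi))"
      using i(2) by (simp add: algebra_simps)
    then have "\<bar>(2 * pi * t) * l j - 2 * pi * of_int (h i) - y j\<bar> = 2 * pi * \<bar>t * l (f i) - of_int (h i) - y (f i) / (2 * pi)\<bar>"
      by (simp add: abs_mult)
    also have "\<dots> < 2 * pi * (\<epsilon> / (2 * pi))" using th[OF i(1)] by (intro mult_strict_left_mono) auto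
    finally show ?thesis unfolding i_def by simp
  qed
  then show ?thesis
    by (intro exI[of _ "2 * pi * t"] exI[of _ "\<lambda>j. h (inv_into {..<n} f j)"] ballI)
qed

text \<open>The orbit with velocity l/2 comes arbitrarily close to y on the torus, and the Lipschitz
  bound keeps g nonzero near y.\<close>

lemma trig_poly_orbit_nonzero:
  assumes g: "trig_poly J g" and J: "finite J" and ind: "int_indep l J" and y: "g y \<noteq> 0"
  shows "\<exists>t. g (\<lambda>j. x j + t * (l j / 2)) \<noteq> 0"
proof -
  obtain K L where L: "0 \<le> L" "\<And>x y. cmod (g x - g y) \<le> L * (\<Sum>j\<in>J. \<bar>x j - y j\<bar>)"
    using trig_poly_Lipschitz[OF g J] by blast
  define \<epsilon> where "\<epsilon> = cmod (g y) / (L * real (card J) + 1)"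
  have den: "L * real (card J) + 1 > 0" using L(1) by (simp add: add_nonneg_pos)
  have e: "\<epsilon> > 0" unfolding \<epsilon>_def using y den by simp
  obtain t h where th: "\<And>j. j \<in> J \<Longrightarrow> \<bar>t * l j - 2 * pi * of_int (h j) - (y j - x j)\<bar> < \<epsilon>"
    using Kronecker_simultaneous[OF ind J e, of "\<lambda>j. y j - x j"] by blast
  \<comment> \<open>Time 2 t, because the coordinates move with velocity l/2.\<close>
  let ?w = "\<lambda>j. x j + 2 * t * (l j / 2)"
  let ?w' = "\<lambda>j. ?w j + 2 * pi * of_int (- h j)"
  have "g ?w' = g ?w" by (rule trig_poly_periodic[OF g])
  moreover have "cmod (g ?w' - g y) < cmod (g y)"
  proof -
    have "cmod (g ?w' - g y) \<le> L * (\<Sum>j\<in>J. \<bar>?w' j - y j\<bar>)" by (rule L(2))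
    also have "\<dots> \<le> L * (\<Sum>j\<in>J. \<epsilon>)"
    proof (intro mult_left_mono sum_mono L(1))
      fix j assume "j \<in> J"
      from th[OF this] show "\<bar>?w' j - y j\<bar> \<le> \<epsilon>" by (simp add: algebra_simps)
    qed
    also have "\<dots> = (L * real (card J)) * \<epsilon>" by simp
    also have "\<dots> < (L * real (card J) + 1) * \<epsilon>" using e by simp
    also have "\<dots> = cmod (g y)" unfolding \<epsilon>_def using den by simp
    finally show ?thesis .
  qed
  ultimately have "g ?w \<noteq> 0" by auto
  then show ?thesis by blast
qed

text \<open>A zero of cs forces k l_j to be an integer multiple of pi; two such zeros would give an
  integer relation between two of the lengths.\<close>

lemma nondeg_int_indep:
  assumes ind: "int_indep l ({..<N}-{p})" and k: "k > 0" and s: "s = 1 \<or> s = -1"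
  shows "nondeg N s p (\<lambda>j. k * l j / 2)"
  unfolding nondeg_def
proof (intro allI impI notI)
  fix i j assume ij: "i < N" "j < N" "i \<noteq> p" "j \<noteq> p" "i \<noteq> j"
    and z: "cs s (k * l i / 2) = 0 \<and> cs s (k * l j / 2) = 0"
  have ex: "\<exists>m::int. t = of_int m * (pi / 2)" if "cs s t = 0" for t
  proof (cases "s = 1")
    case True
    then show ?thesis using that cos_zero_iff_int[of t] by (auto simp: cs_def)
  next
    case False
    then have "sin t = 0" using that by (simp add: cs_def)
    then obtain m :: int where "t = of_int m * pi" unfolding sin_zero_iff_int2 by blast
    then show ?thesis by (intro exI[of _ "2 * m"]) simp
  qed
  obtain a where a: "k * l i / 2 = of_int a * (pi / 2)" using ex z by blast
  obtain b where b: "k * l j / 2 = of_int b * (pi / 2)" using ex z by blast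
  have "k * (of_int b * l i) = k * (of_int a * l j)"
  proof -
    have "k * (of_int b * l i) = of_int b * (k * l i)" by simp
    also have "k * l i = of_int a * pi" using a by simp
    also have "of_int b * (of_int a * pi) = of_int a * (of_int b * pi)" by simp
    also have "of_int b * pi = k * l j" using b by simp
    finally show ?thesis by simp
  qed
  then have "of_int b * l i = of_int a * l j" using k by simp
  from int_indep_pair[OF ind _ _ _ ij(5) this] ij have "a = 0" by auto
  then have "l i = 0" using a k by simp
  then show False using int_indep_nonzero[OF ind, of i] ij by auto
qed

text \<open>Lengths are chosen one at a time: only countably many values of the next one satisfy an
  integer relation with the previous ones.\<close>

lemma exists_int_indep_near:
  assumes "\<epsilon> > 0"
  shows "\<exists>l. (\<forall>j<n. \<bar>l j - x j\<bar> < \<epsilon>) \<and> int_indep l {..<n}"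
proof (induction n)
  case 0
  show ?case by (simp add: int_indep_def)
next
  case (Suc n)
  then obtain l where l: "\<forall>j<n. \<bar>l j - x j\<bar> < \<epsilon>" "int_indep l {..<n}" by blast
  \<comment> \<open>All values of the new length forced by some relation. Coefficients are stored in
    a list so that the parameter type is countable.\<close>
  define C where "C = (\<lambda>(hs :: int list, m :: int). - (\<Sum>j<n. of_int (hs ! j) * l j) / of_int m) ` UNIV"
  have "countable C" unfolding C_def by simp
  moreover have "uncountable {x n - \<epsilon><..<x n + \<epsilon>}" using assms by (simp add: uncountable_open_interval)
  ultimately have "\<not> {x n - \<epsilon><..<x n + \<epsilon>} \<subseteq> C" using countable_subset by blast
  then obtain v where v: "v \<in> {x n - \<epsilon><..<x n + \<epsilon>}" "v \<notin> C" by blast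
  let ?l = "l(n := v)"
  have "\<forall>j\<in>{..<Suc n}. h j = 0" if h: "(\<Sum>j<Suc n. of_int (h j) * ?l j) = 0" for h :: "nat \<Rightarrow> int"
  proof -
    have s: "(\<Sum>j<n. of_int (h j) * l j) + of_int (h n) * v = 0" using h by simp
    have "h n = 0"
    proof (rule ccontr)
      assume "h n \<noteq> 0"
      then have "v = - (\<Sum>j<n. of_int (h j) * l j) / of_int (h n)" using s by (simp add: field_simps)
      also have "\<dots> = - (\<Sum>j<n. of_int (map h [0..<n] ! j) * l j) / of_int (h n)" by simp
      finally have "v \<in> C" unfolding C_def by (intro image_eqI[of _ _ "(map h [0..<n], h n)"]) auto
      then show False using v by blast
    qed
    moreover have "\<forall>j\<in>{..<n}. h j = 0" using s l(2) \<open>h n = 0\<close> unfolding int_indep_def by simp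
    ultimately show ?thesis by (auto simp: less_Suc_eq)
  qed
  then have "int_indep ?l {..<Suc n}" unfolding int_indep_def by blast
  moreover have "\<forall>j<Suc n. \<bar>?l j - x j\<bar> < \<epsilon>" using l(1) v(1) by (auto simp: less_Suc_eq abs_less_iff)
  ultimately show ?case by blast
qed

section \<open>Strong genericity\<close>

lemma elim_a_cong: "(\<And>i. i < N \<Longrightarrow> i \<noteq> p \<Longrightarrow> x i = y i) \<Longrightarrow> elim_a N s p x = elim_a N s p y"
  unfolding elim_a_def by (intro prod.cong) auto

lemma elim_b_cong: "(\<And>i. i < N \<Longrightarrow> i \<noteq> p \<Longrightarrow> x i = y i) \<Longrightarrow> elim_b N s p x = elim_b N s p y"
  unfolding elim_b_def elim_c_def by (intro sum.cong arg_cong2[where f = "(*)"] prod.cong) auto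

lemma exists_angle:
  assumes "s = 1 \<or> s = -1" "a \<noteq> 0 \<or> b \<noteq> 0"
  shows "\<exists>t. a * sn s t + b * cs s t \<noteq> 0"
proof (cases "b = 0")
  case True
  then show ?thesis using assms
    by (intro exI[of _ "if s = 1 then pi / 2 else 0"]) (auto simp: sn_def cs_def)
next
  case False
  then show ?thesis using assms
    by (intro exI[of _ "if s = 1 then 0 else pi / 2"]) (auto simp: sn_def cs_def)
qed

lemma secular_line_nonzero:
  assumes s: "s = 1 \<or> s = -1" and p: "p < N" and nd: "nondeg N s p x" and k: "k \<noteq> 0"
  shows "\<exists>t. secular N s (\<lambda>j. x j + t * (if j = p then k else 0)) \<noteq> 0"
proof -
  obtain \<phi> where \<phi>: "elim_a N s p x * sn s \<phi> + elim_b N s p x * cs s \<phi> \<noteq> 0"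
    using exists_angle[OF s nondeg_elim[OF nd]] by blast
  define t where "t = (\<phi> - x p) / k"
  let ?y = "\<lambda>j. x j + t * (if j = p then k else 0)"
  have "?y p = \<phi>" using k by (simp add: t_def)
  moreover have "elim_a N s p ?y = elim_a N s p x" "elim_b N s p ?y = elim_b N s p x"
    by (auto intro!: elim_a_cong elim_b_cong)
  ultimately have "secular N s ?y \<noteq> 0" unfolding secular_split[OF p] using \<phi> by simp
  then show ?thesis by blast
qed

definition bad_lengths :: "nat \<Rightarrow> ((nat \<Rightarrow> nat) \<times> (nat \<Rightarrow> nat) \<Rightarrow> complex) \<Rightarrow> complex \<Rightarrow> (nat \<Rightarrow> real) set" where
  "bad_lengths N c s = {l\<in>posorth N. \<exists>k>0. bad_locus N c s (\<lambda>j. k * l j / 2)}"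

lemma bad_lengths_no_ball:
  assumes s: "s = 1 \<or> s = -1" and p: "p < N" and h: "homog_poly N c d"
    and nz: "bad_poly N c s p y \<noteq> 0" and r: "r > 0"
  shows "\<not> nball N x r \<subseteq> bad_lengths N c s"
proof
  assume sub: "nball N x r \<subseteq> bad_lengths N c s"
  \<comment> \<open>N squares smaller than \<epsilon>^2 sum to less than r^2 / N, which is at most
    r^2.\<close>
  define \<epsilon> where "\<epsilon> = r / real N"
  have N: "N > 0" using p by simp
  have e: "\<epsilon> > 0" using r N by (simp add: \<epsilon>_def)
  obtain l where l: "\<forall>j<N. \<bar>l j - x j\<bar> < \<epsilon>" "int_indep l {..<N}"
    using exists_int_indep_near[OF e] by blast
  \<comment> \<open>Only the p-th length varies along this segment of the ball.\<close>
  define lv where "lv = (\<lambda>v j. if j = p then v else if j < N then l j else (0::real))"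
  have ball: "lv v \<in> nball N x r" if v: "v \<in> {x p - \<epsilon><..<x p + \<epsilon>}" for v
  proof -
    have lt: "\<bar>lv v j - x j\<bar> < \<epsilon>" if "j < N" for j using l(1) that v by (auto simp: lv_def abs_less_iff)
    have "(lv v j - x j)^2 < \<epsilon>^2" if "j < N" for j
      using power_strict_mono[OF lt[OF that], of 2] by simp
    then have "(\<Sum>i<N. (lv v i - x i)^2) < (\<Sum>i<N. \<epsilon>^2)"
      using N by (intro sum_strict_mono) auto
    also have "\<dots> = r^2 / real N" using N by (simp add: \<epsilon>_def power2_eq_square)
    also have "\<dots> \<le> r^2" using N by (simp add: divide_le_eq mult_le_cancel_left1)
    finally show ?thesis using p by (auto simp: nball_def rn_def lv_def)
  qed
  have indl: "int_indep l ({..<N}-{p})" by (rule int_indep_subset[OF l(2)]) auto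
  have ind: "int_indep (lv v) ({..<N}-{p})" for v
  proof -
    have "(\<Sum>j\<in>{..<N}-{p}. of_int (h j) * lv v j) = (\<Sum>j\<in>{..<N}-{p}. of_int (h j) * l j)" for h :: "nat \<Rightarrow> int"
      by (intro sum.cong) (auto simp: lv_def)
    then show ?thesis using indl unfolding int_indep_def by simp
  qed
  \<comment> \<open>As Z does not see the p-th length, this countable set of candidates for k is the
    same for every v.\<close>
  define K where "K = {k. bad_poly N c s p (\<lambda>j. 0 + k * (l j / 2)) = 0}"
  have K: "countable K"
  proof -
    obtain t where "bad_poly N c s p (\<lambda>j. 0 + t * (l j / 2)) \<noteq> 0"
      using trig_poly_orbit_nonzero[OF trig_poly_bad_poly _ indl nz, of "\<lambda>_. 0"] by auto
    from trig_poly_zeros_countable[where x = "\<lambda>_. 0" and v = "\<lambda>j. l j / 2", OF trig_poly_bad_poly this]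
    show ?thesis unfolding K_def .
  qed
  define V where "V = (\<lambda>k \<sigma>. {v. secular N \<sigma> (\<lambda>j. k * lv v j / 2) = 0})"
  have V: "countable (V k \<sigma>)" if k: "k > 0" and \<sigma>: "\<sigma> = 1 \<or> \<sigma> = -1" for k \<sigma>
  proof -
    let ?x = "\<lambda>j. k * lv 0 j / 2"
    let ?v = "\<lambda>j. if j = p then k / 2 else 0"
    have eq: "(\<lambda>j. k * lv v j / 2) = (\<lambda>j. ?x j + v * ?v j)" for v
      by (auto simp: lv_def fun_eq_iff)
    obtain t where "secular N \<sigma> (\<lambda>j. ?x j + t * ?v j) \<noteq> 0"
      using secular_line_nonzero[OF \<sigma> p nondeg_int_indep[OF ind k \<sigma>], of "k / 2" 0] k by auto
    then have "complex_of_real (secular N \<sigma> (\<lambda>j. ?x j + t * ?v j)) \<noteq> 0" by simp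
    from trig_poly_zeros_countable[where x = ?x and v = ?v, OF trig_poly_secular this]
    show ?thesis unfolding V_def eq by simp
  qed
  have "{x p - \<epsilon><..<x p + \<epsilon>} \<subseteq> (\<Union>k\<in>K \<inter> {0<..}. V k 1 \<union> V k (-1))"
  proof
    fix v assume "v \<in> {x p - \<epsilon><..<x p + \<epsilon>}"
    then have "lv v \<in> bad_lengths N c s" using ball sub by blast
    then obtain k where k: "k > 0" "bad_locus N c s (\<lambda>j. k * lv v j / 2)" unfolding bad_lengths_def by blast
    from bad_locus_nondeg[OF s p h k(2) nondeg_int_indep[OF ind k(1)] nondeg_int_indep[OF ind k(1)]]
    have b: "bad_poly N c s p (\<lambda>j. k * lv v j / 2) = 0"
      "secular N 1 (\<lambda>j. k * lv v j / 2) = 0 \<or> secular N (-1) (\<lambda>j. k * lv v j / 2) = 0" by auto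
    have "bad_poly N c s p (\<lambda>j. 0 + k * (l j / 2)) = bad_poly N c s p (\<lambda>j. k * lv v j / 2)"
      by (rule trig_poly_cong_on[OF trig_poly_bad_poly]) (auto simp: lv_def)
    then have "k \<in> K" using b(1) by (simp add: K_def)
    then show "v \<in> (\<Union>k\<in>K \<inter> {0<..}. V k 1 \<union> V k (-1))" using b(2) k(1) by (auto simp: V_def)
  qed
  moreover have "countable (\<Union>k\<in>K \<inter> {0<..}. V k 1 \<union> V k (-1))"
    using K V by (intro countable_UN) auto
  ultimately have "countable {x p - \<epsilon><..<x p + \<epsilon>}" by (rule countable_subset)
  then show False using uncountable_open_interval[of "x p - \<epsilon>" "x p + \<epsilon>"] e by simp
qed

text \<open>Splits the bad locus into finitely many pure systems of equations, as the closed pieces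
  require; triple zeros are listed by type and by indices.\<close>

definition bad_families :: "nat \<Rightarrow> ((nat \<Rightarrow> nat) \<times> (nat \<Rightarrow> nat) \<Rightarrow> complex) \<Rightarrow> complex \<Rightarrow> ((nat \<Rightarrow> real) \<Rightarrow> complex) set set" where
  "bad_families N c s =
     {{\<lambda>x. of_real (secular N 1 x), \<lambda>x. of_real (secular N (-1) x)},
      insert (\<lambda>x. of_real (secular N s x)) ((\<lambda>p. ker_value N c s p) ` {..<N})} \<union>
     (\<lambda>(\<sigma>, i, j, k). {\<lambda>x. of_real (cs \<sigma> (x i)), \<lambda>x. of_real (cs \<sigma> (x j)), \<lambda>x. of_real (cs \<sigma> (x k))}) `
       ({1, -1} \<times> {(i, j, k). i < N \<and> j < N \<and> k < N \<and> i \<noteq> j \<and> i \<noteq> k \<and> j \<noteq> k})"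

lemma finite_bad_families: "finite (bad_families N c s)"
proof -
  have "{(i, j, k). i < N \<and> j < N \<and> k < N \<and> i \<noteq> j \<and> i \<noteq> k \<and> j \<noteq> k} \<subseteq> {..<N} \<times> {..<N} \<times> {..<N}" by auto
  then have "finite {(i, j, k). i < N \<and> j < N \<and> k < N \<and> i \<noteq> j \<and> i \<noteq> k \<and> j \<noteq> k}"
    by (rule finite_subset) simp
  then show ?thesis unfolding bad_families_def by simp
qed

lemma bad_families_trig_poly: "G \<in> bad_families N c s \<Longrightarrow> finite G \<and> (\<forall>g\<in>G. trig_poly {..<N} g)"
  unfolding bad_families_def
  by (auto intro: trig_poly_secular trig_poly_ker_value trig_poly_cs)

lemma bad_locus_iff_families: "bad_locus N c s x \<longleftrightarrow> (\<exists>G\<in>bad_families N c s. \<forall>g\<in>G. g x = 0)"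
proof -
  have "(\<exists>G\<in>bad_families N c s. \<forall>g\<in>G. g x = 0) \<longleftrightarrow>
    ((secular N 1 x = 0 \<and> secular N (-1) x = 0) \<or> (secular N s x = 0 \<and> (\<forall>p<N. ker_value N c s p x = 0))) \<or>
    (\<exists>\<sigma>\<in>{1,-1}. triple_zero N \<sigma> x)"
    unfolding bad_families_def bex_Un
    by (intro arg_cong2[where f = "(\<or>)"]) (auto simp: triple_zero_def)
  then show ?thesis unfolding bad_locus_def multiple_locus_def by auto
qed

lemma strongly_generic_prop_q:
  assumes s: "s = 1 \<or> s = -1" and p: "p < N" and h: "homog_poly N c d" and nz: "bad_poly N c s p y \<noteq> 0"
  shows "strongly_generic N (prop_q N c s)"
proof -
  have N: "N > 0" using p by simp
  define \<A> where "\<A> = (\<lambda>(m, G). param_piece N (real (Suc m)) G) ` (UNIV \<times> bad_families N c s)"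
  have cnt: "countable \<A>" unfolding \<A>_def
    by (intro countable_image countable_SIGMA) (auto simp: finite_bad_families countable_finite)
  have ne: "\<A> \<noteq> {}" unfolding \<A>_def bad_families_def by auto
  have pieces: "A \<subseteq> bad_lengths N c s \<and> n_closed N A \<and> subanalytic N A" if A: "A \<in> \<A>" for A
  proof -
    obtain m G where mG: "A = param_piece N (real (Suc m)) G" "G \<in> bad_families N c s"
      using A unfolding \<A>_def by auto
    have G: "finite G" "\<forall>g\<in>G. trig_poly {..<N} g" using bad_families_trig_poly[OF mG(2)] by auto
    have r: "real (Suc m) \<ge> 1" by simp
    have "l \<in> bad_lengths N c s" if "l \<in> A" for l
    proof -
      have pos: "t > 0" if "t \<in> {1 / real (Suc m)..real (Suc m)}" for t
      proof -
        have "0 < 1 / real (Suc m)" by simp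
        moreover have "1 / real (Suc m) \<le> t" using that by simp
        ultimately show ?thesis by linarith
      qed
      from \<open>l \<in> A\<close> obtain k where k: "l \<in> rn N" "\<And>j. j < N \<Longrightarrow> l j \<in> {1 / real (Suc m)..real (Suc m)}"
        "k \<in> {1 / real (Suc m)..real (Suc m)}" "\<forall>g\<in>G. g (\<lambda>j. k * l j / 2) = 0"
        unfolding mG(1) param_piece_def by blast
      have "l \<in> posorth N" using k(1,2) pos unfolding posorth_def rn_def by blast
      moreover have "bad_locus N c s (\<lambda>j. k * l j / 2)" using k(4) mG(2) unfolding bad_locus_iff_families by blast
      ultimately show ?thesis unfolding bad_lengths_def using pos[OF k(3)] by blast
    qed
    then show ?thesis
      using closed_param_piece[OF r G(2)] subanalytic_param_piece[OF r G(2,1)] unfolding mG(1) by blast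
  qed
  have "posorth N - good_lengths N (prop_q N c s) = bad_lengths N c s"
    unfolding good_lengths_def bad_lengths_def using not_prop_q_iff_bad_locus[OF _ _ N s h] by blast
  also have "\<dots> = \<Union>\<A>"
  proof (intro equalityI subsetI)
    fix l assume "l \<in> bad_lengths N c s"
    then obtain k G where l: "l \<in> posorth N" and k: "k > 0" and G: "G \<in> bad_families N c s" "\<forall>g\<in>G. g (\<lambda>j. k * l j / 2) = 0"
      unfolding bad_lengths_def bad_locus_iff_families by blast
    \<comment> \<open>One number that dominates k, all lengths and all their reciprocals.\<close>
    define M where "M = k + 1 / k + (\<Sum>j<N. l j + 1 / l j)"
    obtain m where m: "M \<le> real m" using real_arch_simple by blast
    have lp: "l j > 0" if "j < N" for j using l that by (auto simp: posorth_def)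
    have sm: "l j + 1 / l j \<le> (\<Sum>j<N. l j + 1 / l j)" if "j < N" for j
      using lp that by (intro member_le_sum) (auto simp: less_imp_le add_nonneg_nonneg)
    have nn: "0 \<le> (\<Sum>j<N. l j + 1 / l j)" using lp by (intro sum_nonneg) (auto simp: less_imp_le add_nonneg_nonneg)
    have int: "t \<in> {1 / real (Suc m)..real (Suc m)}" if t: "t > 0" "t + 1 / t \<le> real m" for t
    proof -
      have "1 / t > 0" using t by simp
      moreover have "real m \<le> real (Suc m)" by simp
      ultimately have "t \<le> real (Suc m)" "1 / t \<le> real (Suc m)" using t by linarith+
      then show ?thesis using t by (auto simp: field_simps)
    qed
    have "k \<in> {1 / real (Suc m)..real (Suc m)}" using m nn k by (intro int) (auto simp: M_def)
    moreover have "l j \<in> {1 / real (Suc m)..real (Suc m)}" if "j < N" for j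
    proof (rule int[OF lp[OF that]])
      have "k + 1 / k > 0" using k by (simp add: add_pos_pos)
      then show "l j + 1 / l j \<le> real m" using m sm[OF that] unfolding M_def by linarith
    qed
    moreover have "l \<in> rn N" using l by (auto simp: posorth_def rn_def)
    ultimately have "l \<in> param_piece N (real (Suc m)) G" unfolding param_piece_def using G(2) by blast
    then show "l \<in> \<Union>\<A>" unfolding \<A>_def using G(1) by blast
  qed (use pieces in blast)
  also have "\<Union>\<A> = (\<Union>i. from_nat_into \<A> i)" using range_from_nat_into[OF ne cnt] by simp
  finally have eq: "posorth N - good_lengths N (prop_q N c s) = (\<Union>i. from_nat_into \<A> i)" .
  have "n_closed N (from_nat_into \<A> i) \<and> subanalytic N (from_nat_into \<A> i) \<and> dim_le_pred N (from_nat_into \<A> i)" for i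
    using pieces[OF from_nat_into[OF ne, of i]] bad_lengths_no_ball[OF s p h nz] unfolding dim_le_pred_def by blast
  then show ?thesis unfolding strongly_generic_def using eq by blast
qed

section \<open>Density of exceptional windows\<close>

lemma two_pi_shift_into_box:
  "\<exists>h :: nat \<Rightarrow> int. \<forall>j. x j + 2 * pi * of_int (h j) \<in> {0..2 * pi}"
proof (intro exI[of _ "\<lambda>j. - \<lfloor>x j / (2 * pi)\<rfloor>"] allI)
  fix j
  define f where "f = real_of_int \<lfloor>x j / (2 * pi)\<rfloor>"
  have "f \<le> x j / (2 * pi)" "x j / (2 * pi) < f + 1" unfolding f_def by linarith+
  then have "f * (2 * pi) \<le> x j" "x j < (f + 1) * (2 * pi)"
    by (simp_all add: pos_le_divide_eq pos_divide_less_eq del: divide_less_eq_numeral1 le_divide_eq_numeral1)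
  then have "x j - 2 * pi * f \<in> {0..2 * pi}" by (simp add: algebra_simps)
  then show "x j + 2 * pi * of_int (- \<lfloor>x j / (2 * pi)\<rfloor>) \<in> {0..2 * pi}" by (simp add: f_def)
qed

text \<open>Bounded overlap of translates survives a small perturbation, by compactness of the torus.\<close>

lemma overlap_margin:
  fixes H :: "(nat \<Rightarrow> real) \<Rightarrow> real" and v :: "'i \<Rightarrow> nat \<Rightarrow> real" and \<kappa> :: real
  assumes cont: "continuous_on UNIV H" and nonneg: "\<And>x. H x \<ge> 0"
    and per: "\<And>x h :: nat \<Rightarrow> int. H (\<lambda>j. x j + 2 * pi * of_int (h j)) = H x"
    and I: "finite I"
    and ov: "\<And>x. real (card {i\<in>I. \<exists>t\<in>{0..2}. H (\<lambda>j. x j + t * u j - v i j) = 0}) \<le> \<kappa>"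
  shows "\<exists>\<delta>>0. \<forall>x t. \<forall>I'\<subseteq>I. (\<forall>i\<in>I'. t i \<in> {0..2}) \<and> (\<Sum>i\<in>I'. H (\<lambda>j. x j + t i * u j - v i j)) < \<delta> \<longrightarrow> real (card I') \<le> \<kappa>"
proof -
  \<comment> \<open>For a subset that is too large the sum has no zero with times in [0, 2], so its
    minimum over a compact box of base points and times is positive.\<close>
  have one: "\<exists>\<delta>>0. \<forall>x t. (\<forall>i\<in>I'. t i \<in> {0..2}) \<and> (\<Sum>i\<in>I'. H (\<lambda>j. x j + t i * u j - v i j)) < \<delta> \<longrightarrow> real (card I') \<le> \<kappa>"
    if I': "I' \<subseteq> I" for I'
  proof (cases "real (card I') \<le> \<kappa>")
    case False
    define \<Phi> where "\<Phi> = (\<lambda>(x, t). \<Sum>i\<in>I'. H (\<lambda>j. x j + t i * u j - v i j))"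
    define K :: "((nat \<Rightarrow> real) \<times> ('i \<Rightarrow> real)) set" where
      "K = {x. \<forall>j. x j \<in> {0..2 * pi}} \<times> {t. \<forall>i. t i \<in> {0..2}}"
    have fin: "finite I'" using I' I finite_subset by blast
    have K: "compact K" unfolding K_def by (intro compact_Times compact_box)
    have "continuous_on UNIV (\<lambda>p :: (nat \<Rightarrow> real) \<times> ('i \<Rightarrow> real). H (\<lambda>j. fst p j + snd p i * u j - v i j))" for i
    proof (rule continuous_on_compose2[OF cont])
      have c1: "continuous_on UNIV (\<lambda>p :: (nat \<Rightarrow> real) \<times> ('i \<Rightarrow> real). fst p j)" for j
        by (rule continuous_on_compose2[OF continuous_on_product_coordinates continuous_on_fst]) (auto intro: continuous_on_id)
      have c2: "continuous_on UNIV (\<lambda>p :: (nat \<Rightarrow> real) \<times> ('i \<Rightarrow> real). snd p i)"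
        by (rule continuous_on_compose2[OF continuous_on_product_coordinates continuous_on_snd]) (auto intro: continuous_on_id)
      show "continuous_on UNIV (\<lambda>p :: (nat \<Rightarrow> real) \<times> ('i \<Rightarrow> real). \<lambda>j. fst p j + snd p i * u j - v i j)"
        by (intro continuous_on_coordinatewise_then_product continuous_intros c1 c2)
    qed auto
    then have "continuous_on UNIV \<Phi>" unfolding \<Phi>_def case_prod_unfold by (intro continuous_on_sum)
    then have "continuous_on K \<Phi>" by (rule continuous_on_subset) simp
    moreover have "((\<lambda>_. 0), (\<lambda>_. 0)) \<in> K" unfolding K_def by simp
    ultimately obtain q where q: "q \<in> K" "\<And>q'. q' \<in> K \<Longrightarrow> \<Phi> q \<le> \<Phi> q'"
      using continuous_attains_inf[OF K, of \<Phi>] by blast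
    have "\<Phi> q > 0"
    proof (rule ccontr)
      assume neg: "\<not> \<Phi> q > 0"
      obtain x t where xt: "q = (x, t)" by (cases q)
      have "(\<Sum>i\<in>I'. H (\<lambda>j. x j + t i * u j - v i j)) = 0"
        using neg nonneg unfolding \<Phi>_def xt by (simp add: sum_nonneg antisym not_less)
      then have "\<forall>i\<in>I'. H (\<lambda>j. x j + t i * u j - v i j) = 0"
        using fin nonneg by (simp add: sum_nonneg_eq_0_iff)
      moreover have "t i \<in> {0..2}" for i using q(1) unfolding K_def xt by blast
      ultimately have "I' \<subseteq> {i\<in>I. \<exists>t\<in>{0..2}. H (\<lambda>j. x j + t * u j - v i j) = 0}" using I' by blast
      then have "card I' \<le> card {i\<in>I. \<exists>t\<in>{0..2}. H (\<lambda>j. x j + t * u j - v i j) = 0}"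
        using I by (intro card_mono) auto
      then show False using ov[of x] False by linarith
    qed
    moreover have "\<Phi> q \<le> (\<Sum>i\<in>I'. H (\<lambda>j. x j + t i * u j - v i j))" if t: "\<forall>i\<in>I'. t i \<in> {0..2}" for x t
    proof -
      obtain h :: "nat \<Rightarrow> int" where h: "\<forall>j. x j + 2 * pi * of_int (h j) \<in> {0..2 * pi}"
        using two_pi_shift_into_box by blast
      define x' where "x' = (\<lambda>j. x j + 2 * pi * of_int (h j))"
      \<comment> \<open>Times outside I' do not affect the sum; setting them to 0 puts the point
        into the box.\<close>
      define t' where "t' = (\<lambda>i. if i \<in> I' then t i else 0)"
      have "(x', t') \<in> K" unfolding K_def using h t by (auto simp: x'_def t'_def)
      from q(2)[OF this] have "\<Phi> q \<le> (\<Sum>i\<in>I'. H (\<lambda>j. x' j + t' i * u j - v i j))" by (simp add: \<Phi>_def)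
      also have "\<dots> = (\<Sum>i\<in>I'. H (\<lambda>j. x j + t i * u j - v i j))"
      proof (rule sum.cong[OF refl])
        fix i assume "i \<in> I'"
        then have "(\<lambda>j. x' j + t' i * u j - v i j) = (\<lambda>j. (x j + t i * u j - v i j) + 2 * pi * of_int (h j))"
          by (auto simp: x'_def t'_def fun_eq_iff)
        then show "H (\<lambda>j. x' j + t' i * u j - v i j) = H (\<lambda>j. x j + t i * u j - v i j)"
          using per[of "\<lambda>j. x j + t i * u j - v i j" h] by simp
      qed
      finally show ?thesis .
    qed
    ultimately show ?thesis by (meson leD)
  qed (auto intro: exI[of _ 1])
  define ok where "ok = (\<lambda>I' \<delta>. \<forall>x t. (\<forall>i\<in>I'. t i \<in> {0..2}) \<and> (\<Sum>i\<in>I'. H (\<lambda>j. x j + t i * u j - v i j)) < \<delta> \<longrightarrow> real (card I') \<le> \<kappa>)"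
  have "\<forall>I'. \<exists>\<delta>. I' \<subseteq> I \<longrightarrow> \<delta> > 0 \<and> ok I' \<delta>" using one unfolding ok_def by blast
  from choice[OF this] obtain \<delta> where \<delta>: "\<And>I'. I' \<subseteq> I \<Longrightarrow> \<delta> I' > 0" "\<And>I'. I' \<subseteq> I \<Longrightarrow> ok I' (\<delta> I')"
    by blast
  \<comment> \<open>There are only finitely many subsets of I, so the smallest margin is
    positive.\<close>
  define \<delta>0 where "\<delta>0 = Min (\<delta> ` Pow I)"
  have finP: "finite (\<delta> ` Pow I)" "\<delta> ` Pow I \<noteq> {}" using I by auto
  have "\<delta>0 > 0" unfolding \<delta>0_def using finP \<delta>(1) by (subst Min_gr_iff) auto
  moreover have "\<delta>0 \<le> \<delta> I'" if "I' \<subseteq> I" for I' unfolding \<delta>0_def using finP that by (intro Min_le) auto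
  then have "ok I' \<delta>0" if "I' \<subseteq> I" for I'
    using \<delta>(2)[OF that] that unfolding ok_def by (meson order_less_le_trans)
  ultimately show ?thesis unfolding ok_def by (intro exI[of _ \<delta>0] conjI allI impI) blast+
qed

text \<open>Double counting of the pairs (i, z) with z - n i in \<open>Wn\<close>: every i
  contributes card Wn of them and every z at most \<kappa>, while z stays in an interval of T + 2 d
  + 1 integers.\<close>

lemma count_by_translates:
  fixes n :: "'i \<Rightarrow> int" and Wn :: "nat set" and \<kappa> :: real
  assumes I: "finite I" and W: "\<And>m. m \<in> Wn \<Longrightarrow> m < T"
    and D: "\<And>i. i \<in> I \<Longrightarrow> \<bar>n i\<bar> \<le> d" and d: "d \<ge> 0"
    and ov: "\<And>z :: int. real (card {i\<in>I. z - n i \<in> int ` Wn}) \<le> \<kappa>"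
  shows "real (card I) * real (card Wn) \<le> (real T + 2 * of_int d + 1) * \<kappa>"
proof -
  let ?M = "{- d..int T + d}"
  have inj: "card Wn \<le> card {z\<in>?M. z - n i \<in> int ` Wn}" if i: "i \<in> I" for i
  proof (rule card_inj_on_le[where f = "\<lambda>m. int m + n i"])
    show "inj_on (\<lambda>m. int m + n i) Wn" by (auto intro: inj_onI)
    show "(\<lambda>m. int m + n i) ` Wn \<subseteq> {z\<in>?M. z - n i \<in> int ` Wn}"
      using D[OF i] W by (force simp: abs_le_iff)
    show "finite {z\<in>?M. z - n i \<in> int ` Wn}" by (rule finite_subset[of _ ?M]) blast+
  qed
  have "real (card I) * real (card Wn) = (\<Sum>i\<in>I. real (card Wn))" by simp
  also have "\<dots> \<le> (\<Sum>i\<in>I. real (card {z\<in>?M. z - n i \<in> int ` Wn}))" using inj by (intro sum_mono) simp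
  also have "\<dots> = (\<Sum>i\<in>I. \<Sum>z\<in>?M. if z - n i \<in> int ` Wn then 1 else 0)"
    by (intro sum.cong) (auto simp: sum.If_cases Int_def)
  also have "\<dots> = (\<Sum>z\<in>?M. \<Sum>i\<in>I. if z - n i \<in> int ` Wn then 1 else 0)" by (rule sum.swap)
  also have "\<dots> = (\<Sum>z\<in>?M. real (card {i\<in>I. z - n i \<in> int ` Wn}))"
    using I by (intro sum.cong) (auto simp: sum.If_cases Int_def)
  also have "\<dots> \<le> (\<Sum>z\<in>?M. \<kappa>)" by (intro sum_mono ov)
  also have "\<dots> = (real T + 2 * of_int d + 1) * \<kappa>" using d by (simp add: algebra_simps)
  finally show ?thesis .
qed

text \<open>If r translates of the swept set overlap at most M-fold, then so do r time shifts of the set of exceptional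
  windows, whose density is therefore at most M / r.\<close>

lemma window_density_zero:
  fixes H :: "(nat \<Rightarrow> real) \<Rightarrow> real"
  assumes ind: "int_indep l {..<N}"
    and cont: "continuous_on UNIV H" and nonneg: "\<And>x. H x \<ge> 0"
    and per: "\<And>x h :: nat \<Rightarrow> int. H (\<lambda>j. x j + 2 * pi * of_int (h j)) = H x"
    and lip: "L \<ge> 0" "\<And>x y. \<bar>H x - H y\<bar> \<le> L * (\<Sum>j<N. \<bar>x j - y j\<bar>)"
    and ov: "\<And>\<epsilon>. \<epsilon> > 0 \<Longrightarrow> \<exists>(I :: (nat \<times> nat) set) v. finite I \<and> I \<noteq> {} \<and>
       (\<forall>x. real (card {i\<in>I. \<exists>t\<in>{0..2}. H (\<lambda>j. x j + t * (l j / 2) - v i j) = 0}) \<le> \<epsilon> * real (card I))"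
    and W: "W = {m :: nat. \<exists>t\<in>{0..1}. H (\<lambda>j. (real m + t) * (l j / 2)) = 0}"
    and e: "\<epsilon> > 0"
  shows "\<exists>C. \<forall>T. real (card {m\<in>W. m < T}) \<le> \<epsilon> * real T + C"
proof -
  obtain I :: "(nat \<times> nat) set" and v where I: "finite I" "I \<noteq> {}" and
    ovI: "\<And>x. real (card {i\<in>I. \<exists>t\<in>{0..2}. H (\<lambda>j. x j + t * (l j / 2) - v i j) = 0}) \<le> \<epsilon> * real (card I)"
    using ov[OF e] by blast
  have cI: "card I > 0" using I by (simp add: card_gt_0_iff)
  obtain \<delta> where \<delta>: "\<delta> > 0" "\<forall>x t. \<forall>I'\<subseteq>I. (\<forall>i\<in>I'. t i \<in> {0..2}) \<and>
     (\<Sum>i\<in>I'. H (\<lambda>j. x j + t i * (l j / 2) - v i j)) < \<delta> \<longrightarrow> real (card I') \<le> \<epsilon> * real (card I)"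
    using overlap_margin[where u = "\<lambda>j. l j / 2" and v = v, OF cont nonneg per I(1) ovI] by (elim exE conjE) (rule that)
  \<comment> \<open>Chosen so that the Lipschitz errors, summed over all of I, stay below the margin
    \<delta>; the 1 keeps the denominator positive.\<close>
  define \<eta> where "\<eta> = \<delta> / (L * real N * real (card I) + 1)"
  have den: "L * real N * real (card I) + 1 > 0" using lip(1) by (simp add: add_nonneg_pos)
  have \<eta>: "\<eta> > 0" unfolding \<eta>_def using \<delta>(1) den by simp
  have \<eta>\<delta>: "real (card I) * (L * (real N * \<eta>)) < \<delta>"
  proof -
    have "real (card I) * (L * (real N * \<eta>)) < (L * real N * real (card I) + 1) * \<eta>"
      using \<eta> by (simp add: algebra_simps)
    also have "\<dots> = \<delta>" unfolding \<eta>_def using den by simp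
    finally show ?thesis .
  qed
  have "\<forall>i. \<exists>t. \<exists>h :: nat \<Rightarrow> int. \<forall>j\<in>{..<N}. \<bar>t * l j - 2 * pi * of_int (h j) - v i j\<bar> < \<eta>"
    using Kronecker_simultaneous[OF ind _ \<eta>] by blast
  from choice[OF this] obtain \<tau> where "\<forall>i. \<exists>h :: nat \<Rightarrow> int. \<forall>j\<in>{..<N}. \<bar>\<tau> i * l j - 2 * pi * of_int (h j) - v i j\<bar> < \<eta>"
    by blast
  from choice[OF this] obtain h :: "nat \<times> nat \<Rightarrow> nat \<Rightarrow> int" where
    \<tau>: "\<And>i j. j < N \<Longrightarrow> \<bar>\<tau> i * l j - 2 * pi * of_int (h i j) - v i j\<bar> < \<eta>" by blast
  \<comment> \<open>Shifts are rounded to integers so that windows are moved by whole numbers of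
    windows. The fractional part, less than 1, is added to the time inside the window, which is why
    sweeps use [0, 2] and not [0, 1].\<close>
  define n where "n = (\<lambda>i. \<lfloor>2 * \<tau> i\<rfloor>)"
  have ovW: "real (card {i\<in>I. z - n i \<in> int ` W}) \<le> \<epsilon> * real (card I)" for z :: int
  proof -
    \<comment> \<open>All these windows being exceptional puts the single point z l/2 close to the
      translates indexed by I', and the margin bounds their number.\<close>
    define I' where "I' = {i\<in>I. z - n i \<in> int ` W}"
    have "\<forall>i. \<exists>t. i \<in> I' \<longrightarrow> t \<in> {0..1} \<and> H (\<lambda>j. (of_int (z - n i) + t) * (l j / 2)) = 0"
    proof
      fix i
      show "\<exists>t. i \<in> I' \<longrightarrow> t \<in> {0..1} \<and> H (\<lambda>j. (of_int (z - n i) + t) * (l j / 2)) = 0"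
      proof (cases "i \<in> I'")
        case True
        then obtain m where m: "m \<in> W" "z - n i = int m" unfolding I'_def by blast
        then obtain t where "t \<in> {0..1}" "H (\<lambda>j. (real m + t) * (l j / 2)) = 0" unfolding W by blast
        then show ?thesis using m(2) by (intro exI[of _ t]) simp
      qed simp
    qed
    from choice[OF this] obtain t where t: "\<And>i. i \<in> I' \<Longrightarrow> t i \<in> {0..1}"
      "\<And>i. i \<in> I' \<Longrightarrow> H (\<lambda>j. (of_int (z - n i) + t i) * (l j / 2)) = 0" by blast
    define t' where "t' = (\<lambda>i. 2 * \<tau> i - of_int (n i) + t i)"
    have t': "t' i \<in> {0..2}" if "i \<in> I'" for i
      using t(1)[OF that] unfolding t'_def n_def by simp linarith
    have small: "H (\<lambda>j. of_int z * (l j / 2) + t' i * (l j / 2) - v i j) \<le> L * (real N * \<eta>)" if i: "i \<in> I'" for i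
    proof -
      let ?Q = "\<lambda>j. of_int z * (l j / 2) + t' i * (l j / 2) - v i j"
      let ?P = "\<lambda>j. (of_int (z - n i) + t i) * (l j / 2)"
      let ?P' = "\<lambda>j. ?P j + 2 * pi * of_int (h i j)"
      have "H ?P' = 0" using t(2)[OF i] per[of ?P "h i"] by simp
      then have "H ?Q = \<bar>H ?Q - H ?P'\<bar>" using nonneg[of ?Q] by simp
      also have "\<dots> \<le> L * (\<Sum>j<N. \<bar>?Q j - ?P' j\<bar>)" by (rule lip(2))
      also have "\<dots> \<le> L * (\<Sum>j<N. \<eta>)"
      proof (intro mult_left_mono sum_mono lip(1))
        fix j assume "j \<in> {..<N}"
        then have "\<bar>\<tau> i * l j - 2 * pi * of_int (h i j) - v i j\<bar> < \<eta>" using \<tau> by simp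
        moreover have "?Q j - ?P' j = \<tau> i * l j - 2 * pi * of_int (h i j) - v i j"
          unfolding t'_def by (simp add: algebra_simps)
        ultimately show "\<bar>?Q j - ?P' j\<bar> \<le> \<eta>" by simp
      qed
      finally show ?thesis by simp
    qed
    have sub: "I' \<subseteq> I" unfolding I'_def by blast
    have "(\<Sum>i\<in>I'. H (\<lambda>j. of_int z * (l j / 2) + t' i * (l j / 2) - v i j)) \<le> (\<Sum>i\<in>I'. L * (real N * \<eta>))"
      by (intro sum_mono small)
    also have "\<dots> = real (card I') * (L * (real N * \<eta>))" by simp
    also have "\<dots> \<le> real (card I) * (L * (real N * \<eta>))"
      using card_mono[OF I(1) sub] lip(1) \<eta> by (intro mult_right_mono) auto
    also have "\<dots> < \<delta>" by (rule \<eta>\<delta>)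
    finally have lt: "(\<Sum>i\<in>I'. H (\<lambda>j. of_int z * (l j / 2) + t' i * (l j / 2) - v i j)) < \<delta>" .
    have "\<forall>i\<in>I'. t' i \<in> {0..2}" using t' by blast
    with spec[OF spec[OF spec[OF \<delta>(2), of "\<lambda>j. of_int z * (l j / 2)"], of t'], of I'] sub lt
    have "real (card I') \<le> \<epsilon> * real (card I)" by simp
    then show ?thesis unfolding I'_def .
  qed
  define d where "d = (\<Sum>i\<in>I. \<bar>n i\<bar>)"
  have d: "\<bar>n i\<bar> \<le> d" if "i \<in> I" for i unfolding d_def using I(1) that by (intro member_le_sum) auto
  have d0: "d \<ge> 0" unfolding d_def by (intro sum_nonneg) auto
  show ?thesis
  \<comment> \<open>The constant pays for the windows pushed over the ends of the range by the
    shifts.\<close>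
  proof (intro exI[of _ "\<epsilon> * (2 * of_int d + 1)"] allI)
    fix T
    have "real (card {i\<in>I. z - n i \<in> int ` {m\<in>W. m < T}}) \<le> \<epsilon> * real (card I)" for z
    proof -
      have "card {i\<in>I. z - n i \<in> int ` {m\<in>W. m < T}} \<le> card {i\<in>I. z - n i \<in> int ` W}"
        using I(1) by (intro card_mono) auto
      then show ?thesis using ovW[of z] by linarith
    qed
    from count_by_translates[OF I(1) _ d d0 this, of T]
    have "real (card I) * real (card {m\<in>W. m < T}) \<le> (real T + 2 * of_int d + 1) * (\<epsilon> * real (card I))" by simp
    then have "real (card I) * real (card {m\<in>W. m < T}) \<le> real (card I) * (\<epsilon> * real T + \<epsilon> * (2 * of_int d + 1))"
      by (simp add: algebra_simps)
    then show "real (card {m\<in>W. m < T}) \<le> \<epsilon> * real T + \<epsilon> * (2 * of_int d + 1)"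
      using cI by simp
  qed
qed

subsection \<open>Translates of the exceptional locus\<close>

text \<open>In the p-th angle the secular function is a sn + b cs with (a, b) nonzero. Distinct
  zeros differ by at least pi, whereas any two of the shifts pi i / n differ by less.\<close>

lemma secular_few_translates:
  assumes s: "s = 1 \<or> s = -1" and p: "p < N" and nd: "nondeg N s p x" and n: "n > 0"
  shows "card {i. i < n \<and> secular N s (\<lambda>j. x j - (if j = p then pi * real i / real n else 0)) = 0} \<le> 1"
proof (rule card_le_Suc0_iff_eq[THEN iffD2, simplified, of _, folded One_nat_def])
  let ?S = "{i. i < n \<and> secular N s (\<lambda>j. x j - (if j = p then pi * real i / real n else 0)) = 0}"
  show "finite ?S" by simp
  let ?a = "elim_a N s p x" and ?b = "elim_b N s p x"
  have sec: "secular N s (\<lambda>j. x j - (if j = p then \<theta> else 0)) = ?a * sn s (x p - \<theta>) + ?b * cs s (x p - \<theta>)" for \<theta>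
  proof -
    let ?y = "\<lambda>j. x j - (if j = p then \<theta> else 0)"
    have "elim_a N s p ?y = ?a" "elim_b N s p ?y = ?b" by (auto intro!: elim_a_cong elim_b_cong)
    then show ?thesis unfolding secular_split[OF p] by simp
  qed
  have no: False if "i < i'" "i' < n" "?a * sn s (x p - pi * real i / real n) + ?b * cs s (x p - pi * real i / real n) = 0"
    "?a * sn s (x p - pi * real i' / real n) + ?b * cs s (x p - pi * real i' / real n) = 0" for i i'
  proof -
    define \<alpha> \<beta> where "\<alpha> = x p - pi * real i / real n" "\<beta> = x p - pi * real i' / real n"
    note ab = this
    have 1: "?a * sn s \<alpha> + ?b * cs s \<alpha> = 0" "?a * sn s \<beta> + ?b * cs s \<beta> = 0" using that(3,4) unfolding ab by auto
    have det: "sn s \<alpha> * cs s \<beta> - sn s \<beta> * cs s \<alpha> = sin (\<alpha> - \<beta>)"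
      using s by (auto simp: sn_def cs_def sin_diff)
    have "?a * (sn s \<alpha> * cs s \<beta> - sn s \<beta> * cs s \<alpha>) = cs s \<beta> * (?a * sn s \<alpha> + ?b * cs s \<alpha>) - cs s \<alpha> * (?a * sn s \<beta> + ?b * cs s \<beta>)"
      by (simp add: algebra_simps)
    moreover have "?b * (sn s \<alpha> * cs s \<beta> - sn s \<beta> * cs s \<alpha>) = sn s \<alpha> * (?a * sn s \<beta> + ?b * cs s \<beta>) - sn s \<beta> * (?a * sn s \<alpha> + ?b * cs s \<alpha>)"
      by (simp add: algebra_simps)
    ultimately have "?a * sin (\<alpha> - \<beta>) = 0" "?b * sin (\<alpha> - \<beta>) = 0" unfolding 1 det by auto
    moreover have "sin (\<alpha> - \<beta>) > 0"
    proof (rule sin_gt_zero)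
      have eq: "\<alpha> - \<beta> = pi * ((real i' - real i) / real n)" unfolding ab by (simp add: diff_divide_distrib algebra_simps)
      have q: "0 < (real i' - real i) / real n" "(real i' - real i) / real n < 1" using that(1,2) n by (auto simp: field_simps)
      show "0 < \<alpha> - \<beta>" unfolding eq by (rule mult_pos_pos[OF pi_gt_zero q(1)])
      show "\<alpha> - \<beta> < pi" unfolding eq using mult_strict_left_mono[OF q(2) pi_gt_zero] by (simp only: mult_1_right)
    qed
    ultimately show False using nondeg_elim[OF nd] by auto
  qed
  show "\<forall>i\<in>?S. \<forall>i'\<in>?S. i = i'"
  proof (intro ballI)
    fix i i' assume "i \<in> ?S" "i' \<in> ?S"
    then show "i = i'" unfolding sec using no[of i i'] no[of i' i] by (cases i i' rule: linorder_cases) auto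
  qed
qed

text \<open>The translation direction a l_a / 2 is chosen so that translating by u amounts to running the a-th coordinate
  of the flow for the time - a u; the times at which two coordinates degenerate then determine u.\<close>

lemma degenerate_few_translates:
  assumes l: "\<And>j. j < N \<Longrightarrow> l j \<noteq> 0"
  shows "\<exists>M::nat. \<forall>x n. n > 0 \<longrightarrow>
    card {j. j < n \<and> (\<exists>t\<in>{0..2}. \<exists>s\<in>{1,-1}. \<not> nondeg N s p (\<lambda>a. x a - real j / real n * (real a * l a / 2) + t * (l a / 2)))} \<le> M"
proof -
  \<comment> \<open>The interval [-N, 2] contains every elapsed time t - a j / n with t in [0, 2], a
    < N and j < n.\<close>
  define few where "few = (\<lambda>s a (M::nat). \<forall>x. finite {u\<in>{- real N..2}. cs s (x + u * (l a / 2)) = 0} \<and>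
     card {u\<in>{- real N..2}. cs s (x + u * (l a / 2)) = 0} \<le> M)"
  have ex: "\<exists>M. few s a M" if s: "s \<in> {1, -1}" and a: "a < N" for s :: complex and a
  proof -
    obtain M :: nat where M: "\<forall>x :: nat \<Rightarrow> real. (\<exists>t. complex_of_real (cs s (x a + t * (l a / 2))) \<noteq> 0) \<longrightarrow>
       finite {t\<in>{- real N..2}. complex_of_real (cs s (x a + t * (l a / 2))) = 0} \<and>
       card {t\<in>{- real N..2}. complex_of_real (cs s (x a + t * (l a / 2))) = 0} \<le> M"
      using trig_poly_zeros_bounded[OF trig_poly_cs[of a "{a}" s], of "\<lambda>j. l j / 2" "- real N" 2] by auto
    have "\<exists>t. cs s (x + t * (l a / 2)) \<noteq> 0" for x
    proof -
      obtain \<phi> where \<phi>: "0 * sn s \<phi> + 1 * cs s \<phi> \<noteq> 0" using exists_angle[of s 0 1] s by auto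
      have cancel: "k \<noteq> 0 \<Longrightarrow> x + (\<phi> - x) / k * k = \<phi>" for k by simp
      have "l a / 2 \<noteq> 0" using l[OF a] by simp
      from cancel[OF this] \<phi> have "cs s (x + (\<phi> - x) / (l a / 2) * (l a / 2)) \<noteq> 0" by (simp only: mult_zero_left add_0 mult_1 not_False_eq_True)
      then show ?thesis by blast
    qed
    then have "few s a M" unfolding few_def using spec[OF M, of "\<lambda>_. _"] by simp
    then show ?thesis by blast
  qed
  define M where "M = (\<lambda>q. SOME M. few (fst q) (snd q) M)"
  have M: "finite {u\<in>{- real N..2}. cs s (x + u * (l a / 2)) = 0} \<and>
     card {u\<in>{- real N..2}. cs s (x + u * (l a / 2)) = 0} \<le> M (s, a)" if "s \<in> {1,-1}" "a < N" for s a x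
  proof -
    have "few s a (M (s, a))" unfolding M_def fst_conv snd_conv by (rule someI_ex[OF ex[OF that]])
    then show ?thesis unfolding few_def by (rule spec)
  qed
  define Q where "Q = {1, -1::complex} \<times> {(a, b). a < N \<and> b < N \<and> a \<noteq> b}"
  have finQ: "finite Q"
  proof -
    have "{(a, b). a < N \<and> b < N \<and> a \<noteq> b} \<subseteq> {..<N} \<times> {..<N}" by auto
    then have "finite {(a, b). a < N \<and> b < N \<and> a \<noteq> b}" by (rule finite_subset) simp
    then show ?thesis unfolding Q_def by simp
  qed
  show ?thesis
  proof (intro exI[of _ "\<Sum>(s, a, b)\<in>Q. M (s, a) * M (s, b)"] allI impI)
    fix x :: "nat \<Rightarrow> real" and n :: nat assume n: "n > 0"
    define Z where "Z = (\<lambda>s a. {u\<in>{- real N..2}. cs s (x a + u * (l a / 2)) = 0})"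
    \<comment> \<open>The values of j for which coordinates a and b degenerate at a common time t,
      expressed by their elapsed times.\<close>
    define Dg where "Dg = (\<lambda>(s, a, b). {j. j < n \<and> (\<exists>t\<in>{0..2}.
       t - real a * (real j / real n) \<in> Z s a \<and> t - real b * (real j / real n) \<in> Z s b)})"
    let ?y = "\<lambda>j t a. x a - real j / real n * (real a * l a / 2) + t * (l a / 2)"
    have "{j. j < n \<and> (\<exists>t\<in>{0..2}. \<exists>s\<in>{1,-1}. \<not> nondeg N s p (?y j t))} \<subseteq> (\<Union>q\<in>Q. Dg q)"
    proof
      fix j assume "j \<in> {j. j < n \<and> (\<exists>t\<in>{0..2}. \<exists>s\<in>{1,-1}. \<not> nondeg N s p (?y j t))}"
      then obtain t s where j: "j < n" and t: "t \<in> {0..2}" and s: "s \<in> {1,-1::complex}" and nd: "\<not> nondeg N s p (?y j t)" by blast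
      then obtain a b where ab: "a < N" "b < N" "a \<noteq> b" "cs s (?y j t a) = 0" "cs s (?y j t b) = 0"
        unfolding nondeg_def by blast
      have eq: "?y j t a = x a + (t - real a * (real j / real n)) * (l a / 2)" for a by (simp add: algebra_simps)
      have "t - real a * (real j / real n) \<in> {- real N..2}" if "a < N" for a
      proof -
        have "real j / real n \<le> 1" "0 \<le> real j / real n" using j n by auto
        then have "real a * (real j / real n) \<le> real N * 1" "0 \<le> real a * (real j / real n)"
          using that by (intro mult_mono) auto
        then show ?thesis using t unfolding atLeastAtMost_iff by linarith
      qed
      then have "t - real a * (real j / real n) \<in> Z s a" "t - real b * (real j / real n) \<in> Z s b"
        unfolding Z_def using ab(1,2) ab(4,5)[unfolded eq] by blast+
      then have "j \<in> Dg (s, a, b)" unfolding Dg_def prod.case using j t by blast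
      moreover have "(s, a, b) \<in> Q" unfolding Q_def using s ab by auto
      ultimately show "j \<in> (\<Union>q\<in>Q. Dg q)" by blast
    qed
    moreover have finD: "finite (Dg q)" for q unfolding Dg_def by (cases q) auto
    ultimately have "card {j. j < n \<and> (\<exists>t\<in>{0..2}. \<exists>s\<in>{1,-1}. \<not> nondeg N s p (?y j t))} \<le> card (\<Union>q\<in>Q. Dg q)"
      using finQ by (intro card_mono) auto
    also have "\<dots> \<le> (\<Sum>q\<in>Q. card (Dg q))" by (rule card_UN_le[OF finQ])
    also have "\<dots> \<le> (\<Sum>(s, a, b)\<in>Q. M (s, a) * M (s, b))"
    proof (rule sum_mono)
      fix q assume "q \<in> Q"
      then obtain s a b where q: "q = (s, a, b)" "s \<in> {1,-1}" "a < N" "b < N" "a \<noteq> b" unfolding Q_def by auto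
      have Z: "finite (Z s a)" "card (Z s a) \<le> M (s, a)" "finite (Z s b)" "card (Z s b) \<le> M (s, b)"
        using M[OF q(2,3), of "x a"] M[OF q(2,4), of "x b"] unfolding Z_def by auto
      have "\<forall>j. \<exists>t. j \<in> Dg q \<longrightarrow> t - real a * (real j / real n) \<in> Z s a \<and> t - real b * (real j / real n) \<in> Z s b"
        unfolding Dg_def q(1) by auto
      from choice[OF this] obtain t where t: "\<And>j. j \<in> Dg q \<Longrightarrow> t j - real a * (real j / real n) \<in> Z s a"
        "\<And>j. j \<in> Dg q \<Longrightarrow> t j - real b * (real j / real n) \<in> Z s b" by blast
      have "card (Dg q) \<le> card (Z s a \<times> Z s b)"
      proof (rule card_inj_on_le[where f = "\<lambda>j. (t j - real a * (real j / real n), t j - real b * (real j / real n))"])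
        show "inj_on (\<lambda>j. (t j - real a * (real j / real n), t j - real b * (real j / real n))) (Dg q)"
        proof (rule inj_onI)
          fix j j' assume "(t j - real a * (real j / real n), t j - real b * (real j / real n)) =
             (t j' - real a * (real j' / real n), t j' - real b * (real j' / real n))"
          then have e: "t j - real a * (real j / real n) = t j' - real a * (real j' / real n)"
             "t j - real b * (real j / real n) = t j' - real b * (real j' / real n)" by (simp_all only: prod.inject)
          \<comment> \<open>The unknown t cancels: the difference of the two elapsed times is (b -
            a) j / n, so the pair of zeros determines j.\<close>
          have gen: "(b - a) * r = (t - a * r) - (t - b * r)" for a b r t :: real by (simp add: algebra_simps)
          have "(real b - real a) * (real j / real n) = (t j - real a * (real j / real n)) - (t j - real b * (real j / real n))"
            by (rule gen)
          also have "\<dots> = (t j' - real a * (real j' / real n)) - (t j' - real b * (real j' / real n))" by (simp only: e)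
          also have "\<dots> = (real b - real a) * (real j' / real n)" by (rule gen[symmetric])
          finally show "j = j'" using q(5) n by simp
        qed
        show "(\<lambda>j. (t j - real a * (real j / real n), t j - real b * (real j / real n))) ` Dg q \<subseteq> Z s a \<times> Z s b"
          using t by auto
        show "finite (Z s a \<times> Z s b)" using Z by simp
      qed
      also have "\<dots> \<le> M (s, a) * M (s, b)" unfolding card_cartesian_product using Z by (intro mult_mono) auto
      finally show "card (Dg q) \<le> (case q of (s, a, b) \<Rightarrow> M (s, a) * M (s, b))" using q(1) by simp
    qed
    finally show "card {j. j < n \<and> (\<exists>t\<in>{0..2}. \<exists>s\<in>{1,-1}. \<not> nondeg N s p (?y j t))} \<le> (\<Sum>(s, a, b)\<in>Q. M (s, a) * M (s, b))" .
  qed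
qed

text \<open>At half angles k l / 2 with k > 0 this vanishes exactly when k^2 is an eigenvalue, of
  either type.\<close>

definition sec_prod :: "nat \<Rightarrow> (nat \<Rightarrow> real) \<Rightarrow> complex" where
  "sec_prod N x = of_real (secular N 1 x) * of_real (secular N (-1) x)"

lemma trig_poly_sec_prod: "trig_poly {..<N} (sec_prod N)"
  unfolding sec_prod_def[abs_def] by (intro trig_poly_mult trig_poly_secular)

lemma sec_prod_zero_iff: "sec_prod N x = 0 \<longleftrightarrow> secular N 1 x = 0 \<or> secular N (-1) x = 0"
  by (simp add: sec_prod_def)

lemma sec_prod_nonzero:
  assumes "N > 0"
  shows "\<exists>y. sec_prod N y \<noteq> 0"
proof -
  have "\<exists>y. complex_of_real (secular N s y) \<noteq> 0" if s: "s = 1 \<or> s = -1" for s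
  proof -
    have "nondeg N s 0 (\<lambda>_. pi / 4)"
      by (auto simp: nondeg_def cs_def cos_45 sin_45)
    from secular_line_nonzero[OF s assms this, of 1] show ?thesis by auto
  qed
  then obtain y z where "complex_of_real (secular N 1 y) \<noteq> 0" "complex_of_real (secular N (-1) z) \<noteq> 0" by blast
  from trig_poly_mult_nonzero[OF trig_poly_secular trig_poly_secular this] show ?thesis
    by (simp add: sec_prod_def)
qed

text \<open>A translate has two indices. The index j of the flow-like shift meets a degenerate
  configuration for at most MD values. For any other j, Z vanishes at no more than M1 times, the
  same for all i since i moves only the p-th angle, and each time fixes at most two i. So at most n
  (MD + 2 M1) of the n^2 translates are hit.\<close>

lemma exceptional_few_translates:
  assumes p: "p < N" and nz: "bad_poly N c s p y \<noteq> 0" and ind: "int_indep l {..<N}" and e: "\<epsilon> > 0"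
  shows "\<exists>(I :: (nat \<times> nat) set) v. finite I \<and> I \<noteq> {} \<and>
    (\<forall>x. real (card {q\<in>I. \<exists>t\<in>{0..2}. sec_prod N (\<lambda>j. x j + t * (l j / 2) - v q j) = 0 \<and>
       bad_poly N c s p (\<lambda>j. x j + t * (l j / 2) - v q j) = 0}) \<le> \<epsilon> * real (card I))"
proof -
  let ?J = "{..<N} - {p}"
  have indJ: "int_indep l ?J" by (rule int_indep_subset[OF ind]) auto
  obtain M1 :: nat where M1: "\<And>x. finite {t\<in>{0..2}. bad_poly N c s p (\<lambda>j. x j + t * (l j / 2)) = 0} \<and>
      card {t\<in>{0..2}. bad_poly N c s p (\<lambda>j. x j + t * (l j / 2)) = 0} \<le> M1"
    using trig_poly_zeros_bounded[OF trig_poly_bad_poly, of N c s p "\<lambda>j. l j / 2" 0 2]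
      trig_poly_orbit_nonzero[OF trig_poly_bad_poly _ indJ nz] by auto
  obtain MD :: nat where MD: "\<And>x n. n > 0 \<Longrightarrow>
    card {j. j < n \<and> (\<exists>t\<in>{0..2}. \<exists>s\<in>{1,-1}. \<not> nondeg N s p (\<lambda>a. x a - real j / real n * (real a * l a / 2) + t * (l a / 2)))} \<le> MD"
    using degenerate_few_translates[of N l p] int_indep_nonzero[OF ind] by auto
  \<comment> \<open>Large enough for the fraction (MD + 2 M1) / n to be at most \<epsilon>.\<close>
  define n where "n = nat \<lceil>real (MD + 2 * M1) / \<epsilon>\<rceil> + 1"
  have n: "n > 0" "real (MD + 2 * M1) \<le> \<epsilon> * real n"
  proof -
    show "n > 0" by (simp add: n_def)
    have "real (MD + 2 * M1) / \<epsilon> \<le> real n" unfolding n_def by linarith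
    then show "real (MD + 2 * M1) \<le> \<epsilon> * real n" using e by (simp add: pos_divide_le_eq mult.commute)
  qed
  define v where "v = (\<lambda>q a. (if a = p then pi * real (fst q) / real n else 0) + real (snd q) / real n * (real a * l a / 2))"
  show ?thesis
  proof (intro exI[of _ "{..<n} \<times> {..<n}"] exI[of _ v] conjI allI)
    show "{..<n} \<times> {..<n} \<noteq> {}" using n by auto
    fix x
    define S where "S = {q\<in>{..<n} \<times> {..<n}. \<exists>t\<in>{0..2}. sec_prod N (\<lambda>j. x j + t * (l j / 2) - v q j) = 0 \<and>
       bad_poly N c s p (\<lambda>j. x j + t * (l j / 2) - v q j) = 0}"
    define Y where "Y = (\<lambda>j t a. x a - real j / real n * (real a * l a / 2) + t * (l a / 2))"
    define Dj where "Dj = {j. j < n \<and> (\<exists>t\<in>{0..2}. \<exists>s\<in>{1,-1}. \<not> nondeg N s p (Y j t))}"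
    define Tj where "Tj = (\<lambda>j. {t\<in>{0..2}. bad_poly N c s p (Y j t) = 0})"
    define A where "A = (\<lambda>\<sigma> j t. {i. i < n \<and> secular N \<sigma> (\<lambda>a. Y j t a - (if a = p then pi * real i / real n else 0)) = 0})"
    define Sj where "Sj = (\<lambda>j. {i. (i, j) \<in> S})"
    have Dj: "finite Dj" "card Dj \<le> MD" using MD[OF n(1), of x] unfolding Dj_def Y_def by auto
    have Tj: "finite (Tj j) \<and> card (Tj j) \<le> M1" for j
      using M1[of "\<lambda>a. x a - real j / real n * (real a * l a / 2)"] unfolding Tj_def Y_def by simp
    have finA: "finite (A \<sigma> j t)" for \<sigma> j t unfolding A_def by simp
    have Sjsub: "Sj j \<subseteq> (\<Union>t\<in>Tj j. A 1 j t \<union> A (-1) j t)" for j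
    proof
      fix i assume "i \<in> Sj j"
      then obtain t where ij: "i < n" and t: "t \<in> {0..2}" and z: "sec_prod N (\<lambda>a. x a + t * (l a / 2) - v (i, j) a) = 0"
        "bad_poly N c s p (\<lambda>a. x a + t * (l a / 2) - v (i, j) a) = 0" unfolding Sj_def S_def by auto
      have eq: "(\<lambda>a. x a + t * (l a / 2) - v (i, j) a) = (\<lambda>a. Y j t a - (if a = p then pi * real i / real n else 0))"
        unfolding v_def Y_def by (auto simp: fun_eq_iff)
      have "bad_poly N c s p (\<lambda>a. Y j t a - (if a = p then pi * real i / real n else 0)) = bad_poly N c s p (Y j t)"
        by (rule trig_poly_cong_on[OF trig_poly_bad_poly]) auto
      then have "t \<in> Tj j" using z(2) t unfolding eq Tj_def by simp
      moreover have "i \<in> A 1 j t \<union> A (-1) j t" using z(1) ij unfolding eq sec_prod_zero_iff A_def by auto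
      ultimately show "i \<in> (\<Union>t\<in>Tj j. A 1 j t \<union> A (-1) j t)" by blast
    qed
    have Sj: "finite (Sj j) \<and> card (Sj j) \<le> 2 * M1" if j: "j < n" "j \<notin> Dj" for j
    proof -
      have fin: "finite (\<Union>t\<in>Tj j. A 1 j t \<union> A (-1) j t)" using Tj finA by blast
      have "card (Sj j) \<le> card (\<Union>t\<in>Tj j. A 1 j t \<union> A (-1) j t)" by (rule card_mono[OF fin Sjsub])
      also have "\<dots> \<le> (\<Sum>t\<in>Tj j. card (A 1 j t \<union> A (-1) j t))" using Tj by (intro card_UN_le) blast
      also have "\<dots> \<le> (\<Sum>t\<in>Tj j. 2)"
      proof (rule sum_mono)
        fix t assume "t \<in> Tj j"
        then have "nondeg N 1 p (Y j t)" "nondeg N (-1) p (Y j t)" using j unfolding Dj_def Tj_def by auto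
        then have "card (A 1 j t) \<le> 1" "card (A (-1) j t) \<le> 1"
          using secular_few_translates[OF _ p _ n(1)] unfolding A_def by auto
        then show "card (A 1 j t \<union> A (-1) j t) \<le> 2" using card_Un_le[of "A 1 j t" "A (-1) j t"] by linarith
      qed
      also have "\<dots> \<le> 2 * M1" using Tj[of j] by simp
      finally show ?thesis using finite_subset[OF Sjsub fin] by blast
    qed
    let ?U = "(\<Union>j\<in>{..<n}-Dj. Sj j \<times> {j})"
    have finU: "finite ?U" using Sj by blast
    have "S \<subseteq> {..<n} \<times> Dj \<union> ?U" unfolding Sj_def S_def by auto
    then have "card S \<le> card ({..<n} \<times> Dj \<union> ?U)" using finU Dj(1) by (intro card_mono) auto
    also have "\<dots> \<le> card ({..<n} \<times> Dj) + card ?U" by (rule card_Un_le)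
    also have "card ({..<n} \<times> Dj) \<le> n * MD" using Dj by simp
    also have "card ?U \<le> (\<Sum>j\<in>{..<n}-Dj. card (Sj j \<times> {j}))" by (intro card_UN_le) simp
    also have "\<dots> \<le> (\<Sum>j\<in>{..<n}-Dj. 2 * M1)" using Sj by (intro sum_mono) (simp add: card_cartesian_product)
    also have "\<dots> \<le> n * (2 * M1)"
      using card_mono[of "{..<n}" "{..<n}-Dj"] by simp
    finally have "card S \<le> n * MD + n * (2 * M1)" by simp
    then have "card S \<le> n * (MD + 2 * M1)" by (simp add: algebra_simps)
    then have "real (card S) \<le> real n * real (MD + 2 * M1)" by (metis of_nat_le_iff of_nat_mult)
    also have "\<dots> \<le> real n * (\<epsilon> * real n)" using n by (intro mult_left_mono) auto
    finally show "real (card {q\<in>{..<n} \<times> {..<n}. \<exists>t\<in>{0..2}. sec_prod N (\<lambda>j. x j + t * (l j / 2) - v q j) = 0 \<and>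
       bad_poly N c s p (\<lambda>j. x j + t * (l j / 2) - v q j) = 0}) \<le> \<epsilon> * real (card ({..<n} \<times> {..<n}))"
      unfolding S_def by (simp add: card_cartesian_product algebra_simps)
  qed simp
qed

lemma exceptional_window_density:
  assumes p: "p < N" and nz: "bad_poly N c s p y \<noteq> 0" and ind: "int_indep l {..<N}" and e: "\<epsilon> > 0"
    and W: "W = {m :: nat. \<exists>t\<in>{0..1}. sec_prod N (\<lambda>j. (real m + t) * (l j / 2)) = 0 \<and>
       bad_poly N c s p (\<lambda>j. (real m + t) * (l j / 2)) = 0}"
  shows "\<exists>C. \<forall>T. real (card {m\<in>W. m < T}) \<le> \<epsilon> * real T + C"
proof -
  \<comment> \<open>A single nonnegative function whose zeros are the common zeros of both
    trigonometric polynomials.\<close>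
  define H where "H = (\<lambda>x. cmod (sec_prod N x) + cmod (bad_poly N c s p x))"
  have tb: "trig_poly {..<N} (bad_poly N c s p)" by (rule trig_poly_mono[OF trig_poly_bad_poly]) auto
  have H0: "H x = 0 \<longleftrightarrow> sec_prod N x = 0 \<and> bad_poly N c s p x = 0" for x
    unfolding H_def by (simp add: add_nonneg_eq_0_iff)
  obtain L1 where L1: "L1 \<ge> 0" "\<And>x y. cmod (sec_prod N x - sec_prod N y) \<le> L1 * (\<Sum>j<N. \<bar>x j - y j\<bar>)"
    using trig_poly_Lipschitz[OF trig_poly_sec_prod] by blast
  obtain L2 where L2: "L2 \<ge> 0" "\<And>x y. cmod (bad_poly N c s p x - bad_poly N c s p y) \<le> L2 * (\<Sum>j<N. \<bar>x j - y j\<bar>)"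
    using trig_poly_Lipschitz[OF tb] by blast
  show ?thesis
  proof (rule window_density_zero[where H = H and L = "L1 + L2", OF ind])
    show "continuous_on UNIV H" unfolding H_def
      using trig_poly_continuous[OF trig_poly_sec_prod] trig_poly_continuous[OF tb] by (intro continuous_intros)
    show "0 \<le> H x" for x by (simp add: H_def)
    show "H (\<lambda>j. x j + 2 * pi * of_int (h j)) = H x" for x and h :: "nat \<Rightarrow> int"
      unfolding H_def trig_poly_periodic[OF trig_poly_sec_prod] trig_poly_periodic[OF tb] ..
    show "0 \<le> L1 + L2" using L1 L2 by simp
    show "\<bar>H x - H y\<bar> \<le> (L1 + L2) * (\<Sum>j<N. \<bar>x j - y j\<bar>)" for x y
    proof -
      have "\<bar>H x - H y\<bar> \<le> cmod (sec_prod N x - sec_prod N y) + cmod (bad_poly N c s p x - bad_poly N c s p y)"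
        unfolding H_def
        using norm_triangle_ineq3[of "sec_prod N x" "sec_prod N y"] norm_triangle_ineq3[of "bad_poly N c s p x" "bad_poly N c s p y"]
        by linarith
      then show ?thesis using L1(2)[of x y] L2(2)[of x y] by (simp add: distrib_right)
    qed
    show "\<exists>(I :: (nat \<times> nat) set) v. finite I \<and> I \<noteq> {} \<and>
       (\<forall>x. real (card {i\<in>I. \<exists>t\<in>{0..2}. H (\<lambda>j. x j + t * (l j / 2) - v i j) = 0}) \<le> \<epsilon> * real (card I))" if "\<epsilon> > 0" for \<epsilon>
      unfolding H0 by (rule exceptional_few_translates[OF p nz ind that])
    show "W = {m. \<exists>t\<in>{0..1}. H (\<lambda>j. (real m + t) * (l j / 2)) = 0}" unfolding H0 by (rule W)
  qed (rule e)
qed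

section \<open>Ergodic genericity\<close>

lemma Q_independent_int_indep:
  assumes "Q_independent N l"
  shows "int_indep l {..<N}"
  unfolding int_indep_def
proof (intro allI impI)
  fix h :: "nat \<Rightarrow> int" assume h: "(\<Sum>j<N. of_int (h j) * l j) = 0"
  then have "(\<Sum>j<N. of_rat (of_int (h j)) * l j) = 0" by simp
  with assms have "\<forall>j<N. (of_int (h j) :: rat) = 0"
    unfolding Q_independent_def by (elim allE[of _ "\<lambda>j. of_int (h j)"]) blast
  then show "\<forall>j\<in>{..<N}. h j = 0" by simp
qed

section \<open>Interlacing and linear growth of the spectrum\<close>

lemma differentiable_prod_real:
  fixes f :: "'i \<Rightarrow> real \<Rightarrow> real"
  assumes "\<And>i. i \<in> I \<Longrightarrow> f i differentiable (at x)"
  shows "(\<lambda>x. \<Prod>i\<in>I. f i x) differentiable (at x)"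
  using assms by (induction I rule: infinite_finite_induct) (auto intro: differentiable_mult)

lemma secular_tan:
  assumes "\<And>j. j < N \<Longrightarrow> cos (x j) \<noteq> 0"
  shows "secular N 1 x = (\<Prod>j<N. cos (x j)) * (\<Sum>j<N. tan (x j))"
  unfolding secular_def sum_distrib_left
proof (rule sum.cong[OF refl])
  fix j assume j: "j \<in> {..<N}"
  then have "(\<Prod>i<N. cos (x i)) = cos (x j) * (\<Prod>i\<in>{..<N}-{j}. cos (x i))" by (intro prod.remove) auto
  then show "sn 1 (x j) * (\<Prod>i\<in>{..<N}-{j}. cs 1 (x i)) = (\<Prod>j<N. cos (x j)) * tan (x j)"
    using assms j by (simp add: sn_def cs_def tan_def)
qed

text \<open>Where the secular function does not vanish, its quotient with the product of cosines, i.e. the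
  reciprocal of the sum of tangents, is strictly decreasing; hence a zero separates two zeros of the product.\<close>

lemma secular_zero_between:
  assumes l: "l \<in> posorth N" and N: "N > 0" and ab: "\<alpha> < \<beta>"
    and \<alpha>: "(\<Prod>j<N. cos (\<alpha> * l j / 2)) = 0" and \<beta>: "(\<Prod>j<N. cos (\<beta> * l j / 2)) = 0"
  shows "\<exists>k\<in>{\<alpha>..\<beta>}. secular N 1 (\<lambda>j. k * l j / 2) = 0"
proof (rule ccontr)
  assume neg: "\<not> ?thesis"
  have lp: "l j > 0" if "j < N" for j using l that by (auto simp: posorth_def)
  define \<Phi> where "\<Phi> = (\<lambda>k. \<Prod>j<N. cos (k * l j / 2))"
  define F where "F = (\<lambda>k. secular N 1 (\<lambda>j. k * l j / 2))"
  define u where "u = (\<lambda>k. \<Phi> k / F k)"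
  \<comment> \<open>The split is due to the poles of the tangents. Where cos (k l_i / 2) = 0 this
    factor is split off, F equals P times the sine there, and the slope is - l_i / 2; elsewhere u =
    1/S with S increasing.\<close>
  have "\<exists>y. DERIV u k :> y \<and> y < 0" if k: "\<alpha> \<le> k" "k \<le> \<beta>" for k
  proof (cases "\<exists>i<N. cos (k * l i / 2) = 0")
    case True
    then obtain i where i: "i < N" "cos (k * l i / 2) = 0" by blast
    define P where "P = (\<lambda>k. \<Prod>j\<in>{..<N}-{i}. cos (k * l j / 2))"
    have Fk: "F k \<noteq> 0" using neg k unfolding F_def by auto
    have cd: "(\<lambda>k. cos (k * a / 2)) differentiable (at k)" "(\<lambda>k. sin (k * a / 2)) differentiable (at k)" for a
      unfolding real_differentiable_def by (auto intro!: exI derivative_eq_intros)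
    have dP: "P differentiable (at k)" unfolding P_def by (intro differentiable_prod_real cd)
    have dF: "F differentiable (at k)" unfolding F_def secular_def cs_def sn_def
      by (simp, intro differentiable_sum differentiable_mult differentiable_prod_real cd ballI) auto
    obtain D where D: "DERIV (\<lambda>k. P k / F k) k :> D"
      using differentiable_divide[OF dP dF Fk] unfolding real_differentiable_def by blast
    have dc: "DERIV (\<lambda>k. cos (k * l i / 2)) k :> - sin (k * l i / 2) * (l i / 2)"
      by (auto intro!: derivative_eq_intros)
    have eq: "u = (\<lambda>k. cos (k * l i / 2) * (P k / F k))"
    proof
      fix k
      have "\<Phi> k = cos (k * l i / 2) * P k" unfolding \<Phi>_def P_def using i(1) by (intro prod.remove) auto
      then show "u k = cos (k * l i / 2) * (P k / F k)" by (simp add: u_def)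
    qed
    have "F k = P k * sin (k * l i / 2)"
      unfolding F_def secular_split[OF i(1)] P_def elim_a_def using i(2) by (simp add: cs_def sn_def)
    then have e1: "- sin (k * l i / 2) * (l i / 2) * (P k / F k) = - (l i / 2)" using Fk by auto
    have "DERIV u k :> - sin (k * l i / 2) * (l i / 2) * (P k / F k) + D * cos (k * l i / 2)"
      unfolding eq by (rule DERIV_mult[OF dc D])
    then have "DERIV u k :> - (l i / 2)" unfolding e1 i(2) by simp
    then show ?thesis using lp[OF i(1)] by (intro exI[of _ "- (l i / 2)"]) auto
  next
    case False
    define S where "S = (\<lambda>k. \<Sum>j<N. tan (k * l j / 2))"
    define U where "U = (\<Inter>j\<in>{..<N}. {k. cos (k * l j / 2) \<noteq> 0})"
    have U: "open U" unfolding U_def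
      by (intro open_INT ballI open_Collect_neq) (auto intro!: continuous_intros)
    have kU: "k \<in> U" using False unfolding U_def by auto
    have FS: "F k' = \<Phi> k' * S k'" "\<Phi> k' \<noteq> 0" if "k' \<in> U" for k'
      using secular_tan[of N "\<lambda>j. k' * l j / 2"] that unfolding F_def \<Phi>_def S_def U_def by auto
    have Sk: "S k \<noteq> 0" using neg k FS[OF kU] unfolding F_def by auto
    have dS: "DERIV S k :> (\<Sum>j<N. inverse ((cos (k * l j / 2))\<^sup>2) * (l j / 2))" unfolding S_def
    proof (rule DERIV_sum)
      fix j assume "j \<in> {..<N}"
      then have "cos (k * l j / 2) \<noteq> 0" using False by auto
      moreover have "DERIV (\<lambda>k. k * l j / 2) k :> l j / 2" by (auto intro!: derivative_eq_intros)
      ultimately show "DERIV (\<lambda>k. tan (k * l j / 2)) k :> inverse ((cos (k * l j / 2))\<^sup>2) * (l j / 2)"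
        by (intro DERIV_chain2[OF DERIV_tan])
    qed
    define s where "s = (\<Sum>j<N. inverse ((cos (k * l j / 2))\<^sup>2) * (l j / 2))"
    have spos: "s > 0" unfolding s_def using False lp N by (intro sum_pos) auto
    have "DERIV (\<lambda>k. inverse (S k)) k :> - (inverse (S k) * s * inverse (S k))"
      using DERIV_inverse'[OF dS Sk] unfolding s_def by simp
    then have du: "DERIV u k :> - (inverse (S k) * s * inverse (S k))"
      by (rule has_field_derivative_transform_within_open[OF _ U kU])
        (use FS in \<open>auto simp: u_def field_simps\<close>)
    have "inverse (S k) * s * inverse (S k) = s * (inverse (S k))\<^sup>2" by (simp add: power2_eq_square)
    moreover have "s * (inverse (S k))\<^sup>2 > 0" using Sk spos by simp
    ultimately have "inverse (S k) * s * inverse (S k) > 0" by (simp only:)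
    then show ?thesis using du by (intro exI[of _ "- (inverse (S k) * s * inverse (S k))"] conjI) auto
  qed
  from DERIV_neg_imp_decreasing[OF ab this] have "u \<beta> < u \<alpha>" by blast
  then show False using \<alpha> \<beta> by (simp add: u_def \<Phi>_def)
qed

text \<open>\<open>A n\<close> and \<open>B n\<close> are consecutive zeros of cos (t l_0 / 2), so
  each [\<open>A n\<close>, \<open>B n\<close>] contains a symmetric eigenvalue. These intervals are
  disjoint and repeat with period 4 pi / l_0; skipping the gaps costs a factor, but linear growth is
  enough.\<close>

lemma spectral_lower_bound:
  assumes l: "l \<in> posorth N" and N: "N > 0" and fin: "finite (spec_upto N l T)" and T: "T \<ge> 0"
  shows "T * l 0 / (4 * pi) - 1 \<le> real (card (spec_upto N l T))"
proof -
  have l0: "l 0 > 0" using l N by (auto simp: posorth_def)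
  define A where "A = (\<lambda>n::nat. (4 * real n + 1) * pi / l 0)"
  define B where "B = (\<lambda>n::nat. (4 * real n + 3) * pi / l 0)"
  have z: "(\<Prod>j<N. cos (t * l j / 2)) = 0" if "t * l 0 / 2 = of_int i * (pi / 2)" "odd i" for t i
  proof -
    have "cos (t * l 0 / 2) = 0" unfolding cos_zero_iff_int using that by blast
    then show ?thesis using N by (intro prod_zero) auto
  qed
  have zA: "(\<Prod>j<N. cos (A n * l j / 2)) = 0" for n
    by (rule z[of _ "4 * int n + 1"]) (use l0 in \<open>auto simp: A_def\<close>)
  have zB: "(\<Prod>j<N. cos (B n * l j / 2)) = 0" for n
    by (rule z[of _ "4 * int n + 3"]) (use l0 in \<open>auto simp: B_def\<close>)
  have AB: "A n < B n" for n unfolding A_def B_def using l0 by (intro divide_strict_right_mono mult_strict_right_mono) auto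
  have "\<forall>n. \<exists>k. k \<in> {A n..B n} \<and> secular N 1 (\<lambda>j. k * l j / 2) = 0"
    using secular_zero_between[OF l N AB zA zB] by blast
  from choice[OF this] obtain \<kappa> where \<kappa>: "\<And>n. \<kappa> n \<in> {A n..B n}" "\<And>n. secular N 1 (\<lambda>j. \<kappa> n * l j / 2) = 0" by blast
  define n0 where "n0 = nat \<lfloor>T * l 0 / (4 * pi)\<rfloor>"
  have lt: "\<kappa> n < \<kappa> m" if "n < m" for n m
  proof -
    have "4 * real n + 3 < 4 * real m + 1" using that by linarith
    then have "B n < A m" unfolding A_def B_def using l0 by (intro divide_strict_right_mono mult_strict_right_mono) auto
    then show ?thesis using \<kappa>(1)[of n] \<kappa>(1)[of m] by auto
  qed
  have inj: "inj_on \<kappa> {..<n0}"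
    using lt by (intro inj_onI) (metis less_irrefl linorder_neqE_nat)
  have "\<kappa> ` {..<n0} \<subseteq> spec_upto N l T"
  proof
    fix k assume "k \<in> \<kappa> ` {..<n0}"
    then obtain n where n: "n < n0" "k = \<kappa> n" by blast
    have "A n > 0" unfolding A_def using l0 by (intro divide_pos_pos mult_pos_pos) auto
    then have pos: "k > 0" using \<kappa>(1)[of n] n(2) by auto
    have "real n0 \<le> T * l 0 / (4 * pi)" unfolding n0_def using T l0 by (simp add: of_nat_nat)
    then have "4 * real n0 * pi / l 0 \<le> T" using l0 by (simp add: field_simps)
    moreover have "B n \<le> 4 * real n0 * pi / l 0"
    proof -
      have "4 * real n + 3 \<le> 4 * real n0" using n(1) by linarith
      then show ?thesis unfolding B_def using l0 by (intro divide_right_mono mult_right_mono) auto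
    qed
    ultimately have "k \<le> T" using \<kappa>(1)[of n] n(2) by auto
    moreover have "is_eigenvalue N l (k\<^sup>2)"
      unfolding is_eigenvalue_iff_secular[OF l pos N] using \<kappa>(2)[of n] n(2) by blast
    ultimately show "k \<in> spec_upto N l T" using pos by (auto simp: spec_upto_def)
  qed
  from card_mono[OF fin this] have "n0 \<le> card (spec_upto N l T)" using card_image[OF inj] by simp
  moreover have "T * l 0 / (4 * pi) - 1 \<le> real n0" unfolding n0_def by linarith
  ultimately show ?thesis by linarith
qed

text \<open>The window [m, m + 1] is a piece of the flow line through m l/2, and zero counts along
  the flow are uniform in the base point.\<close>

lemma spectrum_windows:
  assumes N: "N > 0" and ind: "int_indep l {..<N}"
  shows "\<exists>M::nat. \<forall>X Ms. finite Ms \<and> (\<forall>k\<in>X. 0 < k \<and> sec_prod N (\<lambda>j. k * l j / 2) = 0 \<and> nat \<lfloor>k\<rfloor> \<in> Ms) \<longrightarrow>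
     finite X \<and> card X \<le> M * card Ms"
proof -
  obtain y where y: "sec_prod N y \<noteq> 0" using sec_prod_nonzero[OF N] by blast
  obtain M :: nat where M: "\<And>x. finite {t\<in>{0..1}. sec_prod N (\<lambda>j. x j + t * (l j / 2)) = 0} \<and>
      card {t\<in>{0..1}. sec_prod N (\<lambda>j. x j + t * (l j / 2)) = 0} \<le> M"
    using trig_poly_zeros_bounded[OF trig_poly_sec_prod, of N "\<lambda>j. l j / 2" 0 1]
      trig_poly_orbit_nonzero[OF trig_poly_sec_prod _ ind y] by auto
  show ?thesis
  proof (intro exI[of _ M] allI impI)
    fix X and Ms :: "nat set"
    assume a: "finite Ms \<and> (\<forall>k\<in>X. 0 < k \<and> sec_prod N (\<lambda>j. k * l j / 2) = 0 \<and> nat \<lfloor>k\<rfloor> \<in> Ms)"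
    define Z where "Z = (\<lambda>m::nat. (\<lambda>t. real m + t) ` {t\<in>{0..1}. sec_prod N (\<lambda>j. real m * (l j / 2) + t * (l j / 2)) = 0})"
    have Z: "finite (Z m) \<and> card (Z m) \<le> M" for m
      using M[of "\<lambda>j. real m * (l j / 2)"] card_image_le unfolding Z_def by (meson finite_imageI order_trans)
    have sub: "X \<subseteq> (\<Union>m\<in>Ms. Z m)"
    proof
      fix k assume k: "k \<in> X"
      define m where "m = nat \<lfloor>k\<rfloor>"
      have k0: "0 < k" "sec_prod N (\<lambda>j. k * l j / 2) = 0" "m \<in> Ms" using a k unfolding m_def by auto
      have "real m \<le> k" "k < real m + 1" unfolding m_def using k0(1) by linarith+
      then have t: "k - real m \<in> {0..1}" by auto
      have "real m * w + (k - real m) * w = k * w" for w by (simp add: algebra_simps)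
      from this[of "l _ / 2"] have "real m * (l j / 2) + (k - real m) * (l j / 2) = k * l j / 2" for j
        by (simp only: times_divide_eq_right)
      then have "(\<lambda>j. real m * (l j / 2) + (k - real m) * (l j / 2)) = (\<lambda>j. k * l j / 2)" by (rule ext)
      then have "k \<in> Z m" unfolding Z_def using t k0(2) by (intro image_eqI[of _ _ "k - real m"]) auto
      then show "k \<in> (\<Union>m\<in>Ms. Z m)" using k0(3) by blast
    qed
    have fin: "finite (\<Union>m\<in>Ms. Z m)" using a Z by blast
    have "card X \<le> card (\<Union>m\<in>Ms. Z m)" by (rule card_mono[OF fin sub])
    also have "\<dots> \<le> (\<Sum>m\<in>Ms. card (Z m))" using a by (intro card_UN_le) blast
    also have "\<dots> \<le> (\<Sum>m\<in>Ms. M)" using Z by (intro sum_mono) blast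
    finally show "finite X \<and> card X \<le> M * card Ms" using finite_subset[OF sub fin] by (simp add: mult.commute)
  qed
qed

text \<open>k = 0 is never counted as good and is treated crudely: its multiplicity is the constant
  m0, and the lower bound gives up one more unit for it. K is the maximal multiplicity N + 1 times
  the bound on eigenvalues per unit window.\<close>

lemma ergodic_estimate:
  assumes l: "l \<in> posorth N" and ind: "int_indep l {..<N}"
    and s: "s = 1 \<or> s = -1" and p: "p < N" and h: "homog_poly N c d" and nz: "bad_poly N c s p y \<noteq> 0"
  shows "\<exists>m0 K. m0 \<ge> 0 \<and> K \<ge> 0 \<and> (\<forall>\<epsilon>>0. \<exists>C. \<forall>T\<ge>0.
      good_count N (prop_q N c s) l T \<le> spec_count N l T \<and>
      spec_count N l T - good_count N (prop_q N c s) l T \<le> m0 + K * (\<epsilon> * (T + 1) + C)) \<and>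
      (\<forall>T\<ge>0. T * l 0 / (4 * pi) - 2 \<le> spec_count N l T)"
proof -
  have N: "N > 0" using p by simp
  have indJ: "int_indep l ({..<N}-{p})" by (rule int_indep_subset[OF ind]) auto
  obtain M :: nat where M: "\<And>X Ms. finite Ms \<Longrightarrow> (\<And>k. k \<in> X \<Longrightarrow> 0 < k \<and> sec_prod N (\<lambda>j. k * l j / 2) = 0 \<and> nat \<lfloor>k\<rfloor> \<in> Ms) \<Longrightarrow>
     finite X \<and> card X \<le> M * card Ms"
    using spectrum_windows[OF N ind] by meson
  define W where "W = {m :: nat. \<exists>t\<in>{0..1}. sec_prod N (\<lambda>j. (real m + t) * (l j / 2)) = 0 \<and>
       bad_poly N c s p (\<lambda>j. (real m + t) * (l j / 2)) = 0}"
  define Sp where "Sp = (\<lambda>T. spec_upto N l T)"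
  define Gd where "Gd = (\<lambda>T. {k\<in>spec_upto N l T. 0 < k \<and> (\<exists>f. eigenfunction N l (k\<^sup>2) f \<and> prop_q N c s l k f)})"
  define mu where "mu = (\<lambda>k. real (eigen_mult N l (k\<^sup>2)))"
  define Bk where "Bk = (\<lambda>T. {k\<in>Sp T - Gd T. 0 < k})"
  have ev: "sec_prod N (\<lambda>j. k * l j / 2) = 0" if "0 < k" "k \<in> Sp T" for k T
    using that is_eigenvalue_iff_secular[OF l that(1) N] unfolding Sp_def spec_upto_def sec_prod_zero_iff by blast
  have floor: "nat \<lfloor>k\<rfloor> < nat \<lfloor>T\<rfloor> + 1" if "0 < k" "k \<in> Sp T" for k T
  proof -
    have "k \<le> T" using that by (simp add: Sp_def spec_upto_def)
    then have "\<lfloor>k\<rfloor> \<le> \<lfloor>T\<rfloor>" by (rule floor_mono)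
    then show ?thesis by linarith
  qed
  have finSp: "finite (Sp T)" for T
  proof -
    have "finite {k\<in>Sp T. 0 < k}"
      using M[of "{..<nat \<lfloor>T\<rfloor> + 1}" "{k\<in>Sp T. 0 < k}"] ev floor by auto
    moreover have "Sp T \<subseteq> insert 0 {k\<in>Sp T. 0 < k}" by (auto simp: Sp_def spec_upto_def)
    ultimately show ?thesis using finite_subset by blast
  qed
  have bad: "nat \<lfloor>k\<rfloor> \<in> {m\<in>W. m < nat \<lfloor>T\<rfloor> + 1}" if k: "k \<in> Bk T" for k T
  proof -
    have k0: "0 < k" "k \<in> Sp T" "k \<notin> Gd T" using k unfolding Bk_def by auto
    then have "is_eigenvalue N l (k\<^sup>2)" unfolding Sp_def spec_upto_def by blast
    then obtain f where f: "eigenfunction N l (k\<^sup>2) f" unfolding is_eigenvalue_def by blast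
    then have "\<not> prop_q N c s l k f" using k0 unfolding Gd_def Sp_def by blast
    then have "bad_locus N c s (\<lambda>j. k * l j / 2)" using not_prop_q_iff_bad_locus[OF l k0(1) N s h] f by blast
    from bad_locus_nondeg[OF s p h this nondeg_int_indep[OF indJ k0(1)] nondeg_int_indep[OF indJ k0(1)]]
    have b: "bad_poly N c s p (\<lambda>j. k * l j / 2) = 0" by auto
    define m where "m = nat \<lfloor>k\<rfloor>"
    have "real m \<le> k" "k < real m + 1" unfolding m_def using k0(1) by linarith+
    then have t: "k - real m \<in> {0..1}" by auto
    have "(\<lambda>j. (real m + (k - real m)) * (l j / 2)) = (\<lambda>j. k * l j / 2)" by simp
    then have "m \<in> W" unfolding W_def using b ev[OF k0(1,2)] t by (intro CollectI bexI[of _ "k - real m"]) auto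
    then show ?thesis using floor[OF k0(1,2)] unfolding m_def by blast
  qed
  have mu: "mu k \<le> real (N + 1)" if "0 < k" for k
    unfolding mu_def using eigen_mult_le[OF l that N] by linarith
  have mu0: "mu k \<ge> 0" for k by (simp add: mu_def)
  have split: "spec_count N l T = good_count N (prop_q N c s) l T + sum mu (Sp T - Gd T)" for T
  proof -
    have "sum mu (Sp T) = sum mu (Sp T - Gd T) + sum mu (Gd T)"
      by (rule sum.subset_diff[OF _ finSp]) (auto simp: Gd_def Sp_def)
    then show ?thesis unfolding spec_count_def good_count_def Sp_def Gd_def mu_def by simp
  qed
  have est: "sum mu (Sp T - Gd T) \<le> mu 0 + real (N + 1) * real M * real (card {m\<in>W. m < nat \<lfloor>T\<rfloor> + 1})" for T
  proof -
    have finB: "finite (Bk T)" using finSp unfolding Bk_def by simp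
    have cB: "card (Bk T) \<le> M * card {m\<in>W. m < nat \<lfloor>T\<rfloor> + 1}"
    proof -
      have "0 < k \<and> sec_prod N (\<lambda>j. k * l j / 2) = 0 \<and> nat \<lfloor>k\<rfloor> \<in> {m\<in>W. m < nat \<lfloor>T\<rfloor> + 1}" if "k \<in> Bk T" for k
        using bad[OF that] ev that unfolding Bk_def by blast
      then show ?thesis using M[of "{m\<in>W. m < nat \<lfloor>T\<rfloor> + 1}" "Bk T"] by simp
    qed
    have "sum mu (Sp T - Gd T) \<le> sum mu (insert 0 (Bk T))"
      by (rule sum_mono2) (use finB mu0 in \<open>auto simp: Bk_def Sp_def spec_upto_def\<close>)
    also have "\<dots> = mu 0 + sum mu (Bk T)" using finB by (subst sum.insert) (auto simp: Bk_def)
    also have "sum mu (Bk T) \<le> (\<Sum>k\<in>Bk T. real (N + 1))" using mu by (intro sum_mono) (auto simp: Bk_def)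
    also have "\<dots> = real (N + 1) * real (card (Bk T))" by simp
    also have "\<dots> \<le> real (N + 1) * (real M * real (card {m\<in>W. m < nat \<lfloor>T\<rfloor> + 1}))"
      using cB by (intro mult_left_mono) (auto simp flip: of_nat_mult)
    finally show ?thesis by (simp add: mult.assoc)
  qed
  have "\<exists>C. \<forall>T\<ge>0. good_count N (prop_q N c s) l T \<le> spec_count N l T \<and>
      spec_count N l T - good_count N (prop_q N c s) l T \<le> mu 0 + real (N + 1) * real M * (\<epsilon> * (T + 1) + C)" if e: "\<epsilon> > 0" for \<epsilon>
  proof -
    obtain C where C: "\<And>n. real (card {m\<in>W. m < n}) \<le> \<epsilon> * real n + C"
      using exceptional_window_density[OF p nz ind e W_def] by blast
    have "spec_count N l T - good_count N (prop_q N c s) l T \<le> mu 0 + real (N + 1) * real M * (\<epsilon> * (T + 1) + C)" if T: "T \<ge> 0" for T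
    proof -
      have "real (nat \<lfloor>T\<rfloor> + 1) \<le> T + 1" using T by linarith
      then have "\<epsilon> * real (nat \<lfloor>T\<rfloor> + 1) \<le> \<epsilon> * (T + 1)" using e by (intro mult_left_mono) auto
      then have "real (card {m\<in>W. m < nat \<lfloor>T\<rfloor> + 1}) \<le> \<epsilon> * (T + 1) + C" using C[of "nat \<lfloor>T\<rfloor> + 1"] by linarith
      then have "real (N + 1) * real M * real (card {m\<in>W. m < nat \<lfloor>T\<rfloor> + 1}) \<le> real (N + 1) * real M * (\<epsilon> * (T + 1) + C)"
        by (intro mult_left_mono) auto
      then show ?thesis using split[of T] est[of T] by linarith
    qed
    moreover have "good_count N (prop_q N c s) l T \<le> spec_count N l T" for T
      using split[of T] sum_nonneg[of "Sp T - Gd T" mu] mu0 by simp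
    ultimately show ?thesis by blast
  qed
  moreover have "T * l 0 / (4 * pi) - 2 \<le> spec_count N l T" if T: "T \<ge> 0" for T
  proof -
    have finPos: "mu k \<ge> 1" if "k \<in> {k\<in>Sp T. 0 < k}" for k
      using eigen_mult_ge[OF l _ N, of k 1] one_in_indep_sols_iff[of N l "k\<^sup>2"] that
      unfolding mu_def Sp_def spec_upto_def by auto
    have "real (card (Sp T)) \<le> sum mu (Sp T) + 1"
    proof -
      have "card (Sp T) \<le> card (insert 0 {k\<in>Sp T. 0 < k})"
      proof (rule card_mono)
        show "finite (insert 0 {k\<in>Sp T. 0 < k})" using finSp[of T] by simp
      qed (auto simp: Sp_def spec_upto_def)
      also have "\<dots> \<le> card {k\<in>Sp T. 0 < k} + 1" using card_insert_le_m1 by (simp add: card_insert_if finSp)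
      finally have "real (card (Sp T)) \<le> real (card {k\<in>Sp T. 0 < k}) + 1" by simp
      also have "real (card {k\<in>Sp T. 0 < k}) = (\<Sum>k\<in>{k\<in>Sp T. 0 < k}. 1)" by simp
      also have "\<dots> \<le> sum mu {k\<in>Sp T. 0 < k}" by (intro sum_mono finPos)
      also have "\<dots> \<le> sum mu (Sp T)" by (intro sum_mono2 finSp) (use mu0 in auto)
      finally show ?thesis by simp
    qed
    then show ?thesis using spectral_lower_bound[OF l N finSp[unfolded Sp_def] T] unfolding spec_count_def Sp_def mu_def by simp
  qed
  ultimately show ?thesis using mu0[of 0] by (intro exI[of _ "mu 0"] exI[of _ "real (N + 1) * real M"] conjI) auto
qed

lemma ergodically_generic_prop_q:
  assumes s: "s = 1 \<or> s = -1" and p: "p < N" and h: "homog_poly N c d" and nz: "bad_poly N c s p y \<noteq> 0"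
  shows "ergodically_generic N (prop_q N c s)"
  unfolding ergodically_generic_def
proof (intro ballI impI tendstoI)
  fix l and e :: real assume l: "l \<in> posorth N" and Q: "Q_independent N l" and e: "e > 0"
  let ?b = "good_count N (prop_q N c s) l" and ?a = "spec_count N l"
  define \<gamma> where "\<gamma> = l 0 / (4 * pi)"
  have \<gamma>: "\<gamma> > 0" using l p unfolding \<gamma>_def posorth_def by auto
  obtain m0 K where mK: "m0 \<ge> 0" "K \<ge> 0" and
    est: "\<And>\<epsilon>. \<epsilon> > 0 \<Longrightarrow> \<exists>C. \<forall>T\<ge>0. ?b T \<le> ?a T \<and> ?a T - ?b T \<le> m0 + K * (\<epsilon> * (T + 1) + C)" and
    low: "\<And>T. T \<ge> 0 \<Longrightarrow> T * l 0 / (4 * pi) - 2 \<le> ?a T"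
    using ergodic_estimate[OF l Q_independent_int_indep[OF Q] s p h nz] by blast
  \<comment> \<open>The exceptional part then grows with slope at most a quarter of e \<gamma>,
    where \<gamma> is the lower bound for the growth rate of the spectrum.\<close>
  define \<epsilon> where "\<epsilon> = e * \<gamma> / (4 * (K + 1))"
  have \<epsilon>: "\<epsilon> > 0" "K * \<epsilon> \<le> e * \<gamma> / 4"
    unfolding \<epsilon>_def using e \<gamma> mK by (auto simp: field_simps)
  obtain C where C: "\<And>T. T \<ge> 0 \<Longrightarrow> ?b T \<le> ?a T \<and> ?a T - ?b T \<le> m0 + K * (\<epsilon> * (T + 1) + C)"
    using est[OF \<epsilon>(1)] by blast
  \<comment> \<open>The first entry makes the spectral count positive; the second makes all
    constants together less than half of e \<gamma> T.\<close>
  define T0 where "T0 = max (2 / \<gamma>) (2 * (m0 + e * \<gamma> / 4 + K * \<bar>C\<bar> + 2 * e) / (e * \<gamma>))"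
  have "dist (?b T / ?a T) 1 < e" if T: "T > T0" for T
  proof -
    have T1: "T > 2 / \<gamma>" "T > 2 * (m0 + e * \<gamma> / 4 + K * \<bar>C\<bar> + 2 * e) / (e * \<gamma>)" using T unfolding T0_def by auto
    have "2 / \<gamma> > 0" using \<gamma> by simp
    then have Tpos: "T > 0" using T1(1) by linarith
    have a1: "T * \<gamma> > 2" using T1(1) \<gamma> by (simp add: pos_divide_less_eq)
    have a2: "2 * (m0 + e * \<gamma> / 4 + K * \<bar>C\<bar> + 2 * e) < T * (e * \<gamma>)"
      using T1(2) e \<gamma> by (simp only: pos_divide_less_eq mult_pos_pos)
    have a: "?a T \<ge> T * \<gamma> - 2" using low[of T] Tpos unfolding \<gamma>_def by simp
    then have apos: "?a T > 0" using a1 by linarith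
    have "K * (\<epsilon> * (T + 1) + C) \<le> (e * \<gamma> / 4) * (T + 1) + K * \<bar>C\<bar>"
    proof -
      have "K * (\<epsilon> * (T + 1) + C) = (K * \<epsilon>) * (T + 1) + K * C" by (simp add: algebra_simps)
      also have "\<dots> \<le> (e * \<gamma> / 4) * (T + 1) + K * \<bar>C\<bar>"
        using \<epsilon>(2) Tpos mK(2) by (intro add_mono mult_right_mono mult_left_mono) auto
      finally show ?thesis .
    qed
    then have "?a T - ?b T \<le> m0 + ((e * \<gamma> / 4) * (T + 1) + K * \<bar>C\<bar>)" using C[of T] Tpos by linarith
    also have "\<dots> < e * (T * \<gamma> - 2)"
    proof -
      define X where "X = T * (e * \<gamma>)"
      have "0 < X" unfolding X_def using e \<gamma> Tpos by simp
      have "(e * \<gamma> / 4) * (T + 1) = X / 4 + e * \<gamma> / 4" "e * (T * \<gamma> - 2) = X - 2 * e"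
        by (simp_all add: X_def algebra_simps)
      note eqs = this
      have "2 * (m0 + e * \<gamma> / 4 + K * \<bar>C\<bar> + 2 * e) < X" using a2 unfolding X_def .
      moreover have "2 * (a + b + c + f) < X \<Longrightarrow> a + (X / 4 + b + c) < X - f" for a b c f
        using \<open>0 < X\<close> by (simp add: field_simps)
      ultimately show ?thesis unfolding eqs by blast
    qed
    also have "\<dots> \<le> e * ?a T" using a e by (intro mult_left_mono) auto
    finally have lt: "?a T - ?b T < e * ?a T" .
    have "dist (?b T / ?a T) 1 = \<bar>(?b T - ?a T) / ?a T\<bar>"
      using apos by (simp add: dist_real_def diff_divide_distrib)
    also have "\<dots> = (?a T - ?b T) / ?a T" using C[of T] Tpos apos by (simp add: abs_div)
    also have "\<dots> < e" using lt apos by (simp add: pos_divide_less_eq)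
    finally show ?thesis .
  qed
  then show "\<forall>\<^sub>F T in at_top. dist (?b T / ?a T) 1 < e"
    unfolding eventually_at_top_dense by blast
qed

theorem mainTheorem4:
  fixes N :: nat and c :: "(nat \<Rightarrow> nat) \<times> (nat \<Rightarrow> nat) \<Rightarrow> complex" and d :: nat and s :: complex
  assumes "3 \<le> N"
    and "homog_poly N c d"
    and "s = 1 \<or> s = -1"
    and "\<exists>l k f. l \<in> posorth N \<and> 0 < k \<and> eigenfunction N l (k^2) f \<and> simple_ev N l (k^2) \<and>
               sym_type N l s f \<and> poly_eval N c (expikl N l k) (trk N l k f) \<noteq> 0"
  shows "strongly_generic N (prop_q N c s) \<and> ergodically_generic N (prop_q N c s)"
proof -
  have N: "N > 0" using assms(1) by simp
  obtain l k f where w: "l \<in> posorth N" "0 < k" "eigenfunction N l (k^2) f" "simple_ev N l (k^2)"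
    "sym_type N l s f" "poly_eval N c (expikl N l k) (trk N l k f) \<noteq> 0" using assms(4) by blast
  obtain p x where p: "p < N" and x: "nondeg N s p x" "secular N s x = 0" "ker_value N c s p x \<noteq> 0"
    using witness_ker_value[OF w(1,2) N assms(3,2) w(3-6)] by blast
  obtain y where "bad_poly N c s p y \<noteq> 0"
    using bad_poly_nonzero[OF assms(3,1,2) p x] by blast
  then show ?thesis
    using strongly_generic_prop_q[OF assms(3) p assms(2)] ergodically_generic_prop_q[OF assms(3) p assms(2)] by blast
qed

end
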